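(* If $k=(k,|\cdot|,\preceq)$ is an extension of $\mathbb R$, then there exists a unique $\Lambda$-homomorphism $T:S_\tau(I_\Lambda)\to k$ such that $$T:(S_\tau(I_\Lambda),\mathbf 1,\gamma_\xi)\to(k,\mu(I_\Lambda),m)$$ is a morphism in $\mathrm{Hom}_{\mathscr N^p}((S_\tau(I_\Lambda),\mathbf 1,\gamma_\xi),(k,\mu(I_\Lambda),m))$ and $T$ equals the composite $$(S_\tau(I_\Lambda),\mathbf 1,\gamma_\xi)\xrightarrow{\subseteq}(\widehat{S_\tau(I_\Lambda)},\mathbf 1,\widehat\gamma_\xi)\xrightarrow{\widehat T}(k,\mu(I_\Lambda),m),$$ where $\widehat T$ is the unique morphism lying in $\mathrm{Hom}_{\mathscr A^p}((\widehat{S_\tau(I_\Lambda)},\mathbf 1,\widehat\gamma_\xi),(k,\mu(I_\Lambda),m))$. Furthermore, if $p=1$, then $\widehat T=\varinjlim T_i:\varinjlim E_i\to k$ and: (1) $\widehat T(\mathbf 1)=\mu(I_\Lambda)$; (2) $\widehat T:\widehat{S_\tau(I_\Lambda)}\to k$ is a homomorphism of $\Lambda$-modules; (3) $|\widehat T(f)|\le\widehat T(|f|)$ for $f\in\widehat{S_\tau(I_\Lambda)}$, where $|f|$ is the pointwise norm of $f$.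
   Context: Ground field and algebra. $k$ is a field with a total order $\preceq$ (only the total order on the subset $I$ below is actually needed) and a norm $|\cdot|:k\to\mathbb R_{\ge 0}$ ($|x|=0$ iff $x=0$, $|xy|=|x||y|$, $|x+y|\le|x|+|y|$). $\Lambda$ is a finite-dimensional associative unital $k$-algebra with $k$-basis $b_1,\dots,b_n$, $n=\dim_k\Lambda$; for a fixed real $p\ge1$ and a fixed function $\mathfrak n:\{b_1,\dots,b_n\}\to\mathbb R_{>0}$ it carries the norm $\|\sum_i k_ib_i\|_p=(\sum_i(|k_i|\mathfrak n(b_i))^p)^{1/p}$. $\Lambda$ is complete (equivalently, $k$ is complete). $\tau:\Lambda\to k$ is a homomorphism of $k$-algebras. All modules are left modules; $k$ is a $\Lambda$-module by $\lambda\cdot x=\tau(\lambda)x$, with norm $|\cdot|$. Intervals. $I=[a,b]_k=\{x\in k: a\preceq x\preceq b\}$ with $a\prec b$ is an infinite totally ordered set, and $\xi$ satisfies $a\prec\xi\prec b$ and is such that order-preserving bijections $\kappa_a:I\to[a,\xi]_k$ and $\kappa_b:I\to[\xi,b]_k$ exist; these are fixed. $I_\Lambda=\{\sum_i k_ib_i: k_i\in I\}$, identified with $I^n$. Measure. $\Sigma_k$ is the $\sigma$-algebra generated by all intervals of $k$; $\mu:\Sigma_k\to\mathbb R_{\ge0}$ is a countably additive function with $\mu(\varnothing)=0$ and $\mu(\{x\})=0$ for all $x\in k$. The induced product measure on $\Lambda$ is also written $\mu$: $\mu(\sum_i J_ib_i)=\prod_i\mu(J_i)$ for $J_i\in\Sigma_k$.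 Simple functions. $S(I_\Lambda)$ is the space of elementary simple functions $f=\sum_{i=1}^t k_i\mathbf 1_{I_i}:I_\Lambda\to k$, where $k_i\in k$, the $I_i=I_{i1}\times\cdots\times I_{in}$ are pairwise disjoint, and each $I_{ij}\subseteq I$ is an interval (open, closed or half-open) with endpoints $a\preceq c_{ij}\prec d_{ij}\preceq b$; functions that agree outside a $\mu$-null set are identified. $S_\tau(I_\Lambda)$ is $S(I_\Lambda)$ with the $\Lambda$-action $\lambda\cdot f=\tau(\lambda)f$ and the norm $\|f\|_p=(\sum_i(|k_i|\mu(I_i))^p)^{1/p}$. $\mathbf 1$ is the constant function $1$ on $I_\Lambda$. The juxtaposition map $\gamma_\xi:S(I_\Lambda)^{\oplus 2^n}\to S(I_\Lambda)$ sends $(f_\omega)_{\omega\in\{a,b\}^n}$ to the function $$(k_1,\dots,k_n)\mapsto\sum_{\omega}\mathbf 1_{\kappa_{\omega_1}(I)\times\cdots\times\kappa_{\omega_n}(I)}(k_1,\dots,k_n)\, f_\omega(\kappa_{\omega_1}^{-1}(k_1),\dots,\kappa_{\omega_n}^{-1}(k_n))\qquad(k_i\ne\xi\text{ for all }i).$$ Normed modules. A normed $\Lambda$-module is a $\Lambda$-module $M$ with a norm $\|\cdot\|$ such that $\|am\|=|\tau(a)|\,\|m\|$ for $a\in\Lambda,m\in M$; its completion (by Cauchy sequences) is $\widehat M$; $M$ is a Banach $\Lambda$-module if $\widehat M=M$. For normed $\Lambda$-modules $X_1,\dots,X_{2^n}$, their direct sum $\oplus_p$ has norm $\|(x_i)\|=\big((\mu(I)/\mu(I_\Lambda))^n\sum_{i=1}^{2^n}\|x_i\|^p\big)^{1/p}$.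 $\widehat\gamma_\xi$ denotes the map on completions induced by $\gamma_\xi$. Categories. Objects of $\mathscr N^p$ are triples $(N,v,\delta)$: $N$ a normed $\Lambda$-module, $v\in N$ with $\|v\|\le\mu(I_\Lambda)$, and $\delta:N^{\oplus_p2^n}\to N$ a $\Lambda$-homomorphism with $\delta(v,\dots,v)=v$ that commutes with limits of Cauchy sequences: $\lim\delta(x_i)=\delta(\lim x_i)$ (limits in the completions, to which $\delta$ is understood to be extended). A morphism $(N,v,\delta)\to(N',v',\delta')$ is a $\Lambda$-homomorphism $\theta:N\to N'$ with $\theta(v)=v'$ and $\theta\circ\delta=\delta'\circ\theta^{\oplus2^n}$. $\mathscr A^p$ is the full subcategory of $\mathscr N^p$ of triples with $N$ a Banach $\Lambda$-module. Step functions $E_u$, maps $T_u$ and $m$. Level-$0$ points are $\xi_{00}=a$, $\xi_{01}=b$; level-$(u+1)$ points $a=\xi_{u+1,0}\prec\dots\prec\xi_{u+1,2^{u+1}}=b$ are the images under $\kappa_a$ and $\kappa_b$ of the level-$u$ points. Put $I^{(u,s+1)}=[\xi_{u,s},\xi_{u,s+1}]_k$ for $0\le s<2^u$. $E_u\subseteq S_\tau(I_\Lambda)$ is the normed submodule of step functions constant on each box $\prod_{i=1}^nI^{(u,v_i)}$, $1\le v_i\le2^u$; $E_0\subseteq E_1\subseteq\cdots$, and $\widehat{S_\tau(I_\Lambda)}$ is identified with $\varinjlim E_u$ (direct limit in Banach $\Lambda$-modules and continuous $\Lambda$-homomorphisms). $T_u:E_u\to k$ sends $\sum_{v} k_{v}\mathbf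 1_{\prod_iI^{(u,v_i)}}$ to $\sum_v k_v\,\mu(\prod_iI^{(u,v_i)})$. The map $m:k^{\oplus_p2^n}\to k$ is $m(k_1,\dots,k_{2^n})=T_{u+1}(\gamma_\xi(f_{k_1},\dots,f_{k_{2^n}}))$ with $f_x=\frac{x}{\mu(I_\Lambda)}\mathbf 1$ (independent of $u$).
   Formalization: Morphisms are taken continuous; it is assumed that μ(I)>0, that κ_a, κ_b scale μ of intervals by constant factors, that the union of the E_u is dense in S, and, for p>1, that ‖f‖_p is independent of the representation of f (which leaves only degenerate μ). *)

theory Defs
  imports "HOL-Analysis.Analysis"
begin

section \<open>Normed modules over a possibly noncommutative ring\<close>

record ('l, 'm) nmod =
  mcarrier :: "'m set"
  madd :: "'m \<Rightarrow> 'm \<Rightarrow> 'm"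
  mzero :: "'m"
  mact :: "'l \<Rightarrow> 'm \<Rightarrow> 'm"
  mnorm :: "'m \<Rightarrow> real"

definition left_module :: "('l::ring_1, 'm) nmod \<Rightarrow> bool" where
  "left_module N \<longleftrightarrow>
     mzero N \<in> mcarrier N \<and>
     (\<forall>x\<in>mcarrier N. \<forall>y\<in>mcarrier N. madd N x y \<in> mcarrier N \<and> madd N x y = madd N y x) \<and>
     (\<forall>x\<in>mcarrier N. \<forall>y\<in>mcarrier N. \<forall>z\<in>mcarrier N.
        madd N (madd N x y) z = madd N x (madd N y z)) \<and>
     (\<forall>x\<in>mcarrier N. madd N (mzero N) x = x) \<and>
     (\<forall>x\<in>mcarrier N. \<exists>y\<in>mcarrier N. madd N x y = mzero N) \<and>
     (\<forall>r. \<forall>x\<in>mcarrier N. mact N r x \<in> mcarrier N) \<and>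
     (\<forall>x\<in>mcarrier N. mact N 1 x = x) \<and>
     (\<forall>r s. \<forall>x\<in>mcarrier N. mact N (r * s) x = mact N r (mact N s x)) \<and>
     (\<forall>r s. \<forall>x\<in>mcarrier N. mact N (r + s) x = madd N (mact N r x) (mact N s x)) \<and>
     (\<forall>r. \<forall>x\<in>mcarrier N. \<forall>y\<in>mcarrier N.
        mact N r (madd N x y) = madd N (mact N r x) (mact N r y))"

definition normed_module :: "('l::ring_1 \<Rightarrow> 'k::real_normed_field) \<Rightarrow> ('l, 'm) nmod \<Rightarrow> bool" where
  "normed_module t N \<longleftrightarrow>
     left_module N \<and>
     (\<forall>x\<in>mcarrier N. 0 \<le> mnorm N x \<and> (mnorm N x = 0 \<longleftrightarrow> x = mzero N)) \<and>
     (\<forall>x\<in>mcarrier N. \<forall>y\<in>mcarrier N. mnorm N (madd N x y) \<le> mnorm N x + mnorm N y) \<and>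
     (\<forall>r. \<forall>x\<in>mcarrier N. mnorm N (mact N r x) = norm (t r) * mnorm N x)"

definition mdist :: "('l::ring_1, 'm) nmod \<Rightarrow> 'm \<Rightarrow> 'm \<Rightarrow> real" where
  "mdist N x y = mnorm N (madd N x (mact N (- 1) y))"

definition mCauchy :: "('l::ring_1, 'm) nmod \<Rightarrow> (nat \<Rightarrow> 'm) \<Rightarrow> bool" where
  "mCauchy N x \<longleftrightarrow>
     (\<forall>j. x j \<in> mcarrier N) \<and>
     (\<forall>e>0. \<exists>K. \<forall>i\<ge>K. \<forall>j\<ge>K. mdist N (x i) (x j) < e)"

text \<open>The completion consists of the classes of Cauchy sequences modulo null sequences; the class
  of a Cauchy sequence plays the role of its limit.\<close>

definition cclass :: "('l::ring_1, 'm) nmod \<Rightarrow> (nat \<Rightarrow> 'm) \<Rightarrow> (nat \<Rightarrow> 'm) set" where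
  "cclass N x = {y. mCauchy N y \<and> (\<lambda>j. mdist N (x j) (y j)) \<longlonglongrightarrow> 0}"

definition mcompletion :: "('l::ring_1, 'm) nmod \<Rightarrow> ('l, (nat \<Rightarrow> 'm) set) nmod" where
  "mcompletion N =
     \<lparr> mcarrier = {cclass N x | x. mCauchy N x},
       madd = (\<lambda>X Y. {z. \<exists>x\<in>X. \<exists>y\<in>Y. z \<in> cclass N (\<lambda>j. madd N (x j) (y j))}),
       mzero = cclass N (\<lambda>_. mzero N),
       mact = (\<lambda>r X. {z. \<exists>x\<in>X. z \<in> cclass N (\<lambda>j. mact N r (x j))}),
       mnorm = (\<lambda>X. THE r. \<exists>x\<in>X. (\<lambda>j. mnorm N (x j)) \<longlonglongrightarrow> r) \<rparr>"

definition cembed :: "('l::ring_1, 'm) nmod \<Rightarrow> 'm \<Rightarrow> (nat \<Rightarrow> 'm) set" where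
  "cembed N x = cclass N (\<lambda>_. x)"

definition banach_module :: "('l::ring_1 \<Rightarrow> 'k::real_normed_field) \<Rightarrow> ('l, 'm) nmod \<Rightarrow> bool" where
  "banach_module t N \<longleftrightarrow>
     normed_module t N \<and> cembed N ` mcarrier N = mcarrier (mcompletion N)"

definition mod_hom :: "('l::ring_1, 'm) nmod \<Rightarrow> ('l, 'q) nmod \<Rightarrow> ('m \<Rightarrow> 'q) \<Rightarrow> bool" where
  "mod_hom N N' h \<longleftrightarrow>
     (\<forall>x\<in>mcarrier N. h x \<in> mcarrier N') \<and>
     (\<forall>x\<in>mcarrier N. \<forall>y\<in>mcarrier N. h (madd N x y) = madd N' (h x) (h y)) \<and>
     (\<forall>r. \<forall>x\<in>mcarrier N. h (mact N r x) = mact N' r (h x))"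

definition mcontinuous :: "('l::ring_1, 'm) nmod \<Rightarrow> ('l, 'q) nmod \<Rightarrow> ('m \<Rightarrow> 'q) \<Rightarrow> bool" where
  "mcontinuous N N' h \<longleftrightarrow>
     (\<forall>x\<in>mcarrier N. \<forall>e>0. \<exists>d>0. \<forall>y\<in>mcarrier N. mdist N x y < d \<longrightarrow> mdist N' (h x) (h y) < e)"

text \<open>Maps are extensional on the carrier, so that equality of elements of a Hom set is equality
  of maps on the carrier.\<close>

definition cont_homs :: "('l::ring_1, 'm) nmod \<Rightarrow> ('l, 'q) nmod \<Rightarrow> ('m \<Rightarrow> 'q) set" where
  "cont_homs N N' = {h \<in> extensional (mcarrier N). mod_hom N N' h \<and> mcontinuous N N' h}"

definition direct_sum ::
  "real \<Rightarrow> real \<Rightarrow> ('w::finite \<Rightarrow> ('l::ring_1, 'm) nmod) \<Rightarrow> ('l, 'w \<Rightarrow> 'm) nmod" where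
  "direct_sum w p X =
     \<lparr> mcarrier = {x. \<forall>i. x i \<in> mcarrier (X i)},
       madd = (\<lambda>x y i. madd (X i) (x i) (y i)),
       mzero = (\<lambda>i. mzero (X i)),
       mact = (\<lambda>r x i. mact (X i) r (x i)),
       mnorm = (\<lambda>x. (w * (\<Sum>i\<in>UNIV. mnorm (X i) (x i) powr p)) powr (1 / p)) \<rparr>"

text \<open>The extension of \<open>\<delta>\<close> to tuples of elements of the completion. It is a genuine function into
  the completion exactly when \<open>\<delta>\<close> respects equivalence of Cauchy sequences.\<close>

definition tuple_ext ::
  "('l::ring_1, 'm) nmod \<Rightarrow> (('w \<Rightarrow> 'm) \<Rightarrow> 'm) \<Rightarrow> ('w \<Rightarrow> (nat \<Rightarrow> 'm) set) \<Rightarrow> (nat \<Rightarrow> 'm) set" where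
  "tuple_ext N \<delta> X = {z. \<exists>x. (\<forall>i. x i \<in> X i) \<and> z \<in> cclass N (\<lambda>j. \<delta> (\<lambda>i. x i j))}"

text \<open>\<open>lim \<delta>(x\<^sub>j) = \<delta>(lim x\<^sub>j)\<close> for every Cauchy sequence \<open>x\<close> in the direct sum \<open>P\<close> of copies of \<open>N\<close>.\<close>

definition commutes_with_limits ::
  "('l::ring_1, 'w \<Rightarrow> 'm) nmod \<Rightarrow> ('l, 'm) nmod \<Rightarrow> (('w \<Rightarrow> 'm) \<Rightarrow> 'm) \<Rightarrow> bool" where
  "commutes_with_limits P N \<delta> \<longleftrightarrow>
     (\<forall>x. mCauchy P x \<longrightarrow>
        mCauchy N (\<lambda>j. \<delta> (x j)) \<and>
        cclass N (\<lambda>j. \<delta> (x j)) = tuple_ext N \<delta> (\<lambda>i. cclass N (\<lambda>j. x j i)))"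


section \<open>The data\<close>

text \<open>\<open>scl\<close>: the action of the field on the algebra; \<open>bas\<close>: the basis \<open>b\<^sub>1, \<dots>, b\<^sub>n\<close>, indexed by a
  finite type with \<open>n\<close> elements; \<open>wgt\<close>: the weight function on the basis; \<open>tau\<close>: the character
  of the algebra; \<open>expo\<close>: the exponent \<open>p\<close>; \<open>leq\<close>: the total order, which is not required to be
  compatible with the field operations; \<open>lft\<close>, \<open>mid\<close>, \<open>rgt\<close>: the points \<open>a \<prec> \<xi> \<prec> b\<close>.\<close>

record ('k, 'l, 'n) integration_data =
  scl :: "'k \<Rightarrow> 'l \<Rightarrow> 'l"
  bas :: "'n \<Rightarrow> 'l"
  wgt :: "'n \<Rightarrow> real"
  tau :: "'l \<Rightarrow> 'k"
  expo :: real
  leq :: "'k \<Rightarrow> 'k \<Rightarrow> bool"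
  lft :: 'k
  mid :: 'k
  rgt :: 'k
  kapA :: "'k \<Rightarrow> 'k"
  kapB :: "'k \<Rightarrow> 'k"
  mu :: "'k measure"

definition alg_norm ::
  "('k::real_normed_field, 'l::ring_1, 'n::finite) integration_data \<Rightarrow> 'l \<Rightarrow> real" where
  "alg_norm D x =
     (\<Sum>i\<in>UNIV. (norm (module.representation (scl D) (range (bas D)) x (bas D i)) * wgt D i)
        powr expo D) powr (1 / expo D)"

definition algebra_data ::
  "('k::real_normed_field, 'l::ring_1, 'n::finite) integration_data \<Rightarrow> bool" where
  "algebra_data D \<longleftrightarrow>
     finite_dimensional_vector_space (scl D) (range (bas D)) \<and> inj (bas D) \<and>
     (\<forall>c x y. scl D c (x * y) = scl D c x * y \<and> scl D c (x * y) = x * scl D c y) \<and>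
     (\<forall>i. 0 < wgt D i) \<and>
     (\<forall>X. (\<forall>e>0. \<exists>K. \<forall>i\<ge>K. \<forall>j\<ge>K. alg_norm D (X i - X j) < e) \<longrightarrow>
        (\<exists>L. (\<lambda>j::nat. alg_norm D (X j - L)) \<longlonglongrightarrow> 0)) \<and>
     tau D 1 = 1 \<and>
     (\<forall>x y. tau D (x + y) = tau D x + tau D y \<and> tau D (x * y) = tau D x * tau D y) \<and>
     (\<forall>c x. tau D (scl D c x) = c * tau D x)"

definition lt :: "('k, 'l, 'n) integration_data \<Rightarrow> 'k \<Rightarrow> 'k \<Rightarrow> bool" where
  "lt D x y \<longleftrightarrow> leq D x y \<and> x \<noteq> y"

definition cc_ivl :: "('k, 'l, 'n) integration_data \<Rightarrow> 'k \<Rightarrow> 'k \<Rightarrow> 'k set" where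
  "cc_ivl D c d = {x. leq D c x \<and> leq D x d}"

definition ivls :: "('k, 'l, 'n) integration_data \<Rightarrow> 'k \<Rightarrow> 'k \<Rightarrow> 'k set set" where
  "ivls D c d =
     {cc_ivl D c d, {x. leq D c x \<and> lt D x d}, {x. lt D c x \<and> leq D x d}, {x. lt D c x \<and> lt D x d}}"

definition base_ivl :: "('k, 'l, 'n) integration_data \<Rightarrow> 'k set" where
  "base_ivl D = cc_ivl D (lft D) (rgt D)"

definition sub_ivls :: "('k, 'l, 'n) integration_data \<Rightarrow> 'k set set" where
  "sub_ivls D = \<Union> {ivls D c d | c d. leq D (lft D) c \<and> lt D c d \<and> leq D d (rgt D)}"

definition order_iso ::
  "('k, 'l, 'n) integration_data \<Rightarrow> 'k set \<Rightarrow> 'k set \<Rightarrow> ('k \<Rightarrow> 'k) \<Rightarrow> bool" where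
  "order_iso D A B h \<longleftrightarrow>
     bij_betw h A B \<and> (\<forall>x\<in>A. \<forall>y\<in>A. leq D x y \<longrightarrow> leq D (h x) (h y))"

definition interval_data :: "('k, 'l, 'n) integration_data \<Rightarrow> bool" where
  "interval_data D \<longleftrightarrow>
     linear_order {(x, y). leq D x y} \<and>
     infinite (base_ivl D) \<and>
     lt D (lft D) (mid D) \<and> lt D (mid D) (rgt D) \<and>
     order_iso D (base_ivl D) (cc_ivl D (lft D) (mid D)) (kapA D) \<and>
     order_iso D (base_ivl D) (cc_ivl D (mid D) (rgt D)) (kapB D)"

text \<open>The field extends the reals as a normed field by its sort; this says that its order extends
  the order of the reals.\<close>

definition order_extends_real :: "('k::real_normed_field, 'l, 'n) integration_data \<Rightarrow> bool" where
  "order_extends_real D \<longleftrightarrow> (\<forall>x y. leq D (of_real x) (of_real y) \<longleftrightarrow> x \<le> y)"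

definition measure_data :: "('k, 'l, 'n) integration_data \<Rightarrow> bool" where
  "measure_data D \<longleftrightarrow>
     space (mu D) = UNIV \<and>
     sets (mu D) = sigma_sets UNIV (\<Union>c d. ivls D c d) \<and>
     finite_measure (mu D) \<and>
     (\<forall>x. measure (mu D) {x} = 0)"

text \<open>Up to a scalar, \<open>\<kappa>\<^sub>a\<close> and \<open>\<kappa>\<^sub>b\<close> preserve the measure of intervals. Without this, juxtaposition need
  not be well defined modulo null sets, and integration need not commute with it.\<close>

definition self_similar :: "('k, 'l, 'n) integration_data \<Rightarrow> bool" where
  "self_similar D \<longleftrightarrow>
     (\<forall>h\<in>{kapA D, kapB D}. \<forall>J\<in>sub_ivls D.
        measure (mu D) (h ` J) * measure (mu D) (base_ivl D) =
        measure (mu D) (h ` base_ivl D) * measure (mu D) J)"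


section \<open>Elementary simple functions\<close>

text \<open>Elements of the algebra are identified with their coordinate vectors with respect to the
  basis.\<close>

definition lam_ivl :: "('k, 'l, 'n) integration_data \<Rightarrow> ('n \<Rightarrow> 'k) set" where
  "lam_ivl D = Pi UNIV (\<lambda>_. base_ivl D)"

definition lam_mu :: "('k, 'l, 'n::finite) integration_data \<Rightarrow> ('n \<Rightarrow> 'k) measure" where
  "lam_mu D = PiM UNIV (\<lambda>_. mu D)"

abbreviation lam_mass :: "('k, 'l, 'n::finite) integration_data \<Rightarrow> real" where
  "lam_mass D \<equiv> measure (lam_mu D) (lam_ivl D)"

definition elementary_rep ::
  "('k::real_normed_field, 'l, 'n::finite) integration_data
     \<Rightarrow> nat \<Rightarrow> (nat \<Rightarrow> 'k) \<Rightarrow> (nat \<Rightarrow> 'n \<Rightarrow> 'k set) \<Rightarrow> (('n \<Rightarrow> 'k) \<Rightarrow> 'k) \<Rightarrow> bool" where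
  "elementary_rep D t c J f \<longleftrightarrow>
     (\<forall>i<t. \<forall>j. J i j \<in> sub_ivls D) \<and>
     disjoint_family_on (\<lambda>i. Pi UNIV (J i)) {..<t} \<and>
     f = (\<lambda>x. \<Sum>i<t. c i * indicator (Pi UNIV (J i)) x)"

definition elementary ::
  "('k::real_normed_field, 'l, 'n::finite) integration_data \<Rightarrow> (('n \<Rightarrow> 'k) \<Rightarrow> 'k) set" where
  "elementary D = {f. \<exists>t c J. elementary_rep D t c J f}"

text \<open>Functions on \<open>I\<^sub>\<Lambda>\<close> are represented by total functions; the class of \<open>f\<close> contains all functions
  agreeing with \<open>f\<close> almost everywhere on \<open>I\<^sub>\<Lambda>\<close>, with arbitrary values elsewhere.\<close>

definition ae_class ::
  "('k, 'l, 'n::finite) integration_data \<Rightarrow> (('n \<Rightarrow> 'k) \<Rightarrow> 'k) \<Rightarrow> (('n \<Rightarrow> 'k) \<Rightarrow> 'k) set" where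
  "ae_class D f = {g. AE x in lam_mu D. x \<in> lam_ivl D \<longrightarrow> g x = f x}"

definition rep_norm ::
  "('k::real_normed_field, 'l, 'n::finite) integration_data
     \<Rightarrow> nat \<Rightarrow> (nat \<Rightarrow> 'k) \<Rightarrow> (nat \<Rightarrow> 'n \<Rightarrow> 'k set) \<Rightarrow> real" where
  "rep_norm D t c J =
     (\<Sum>i<t. (norm (c i) * measure (lam_mu D) (Pi UNIV (J i))) powr expo D) powr (1 / expo D)"

text \<open>For \<open>p = 1\<close> the value of the norm does not depend on the representation, by additivity of the
  measure. For \<open>p > 1\<close> it is a genuine and very restrictive condition: of two disjoint boxes, at
  least one must be a null set.\<close>

definition norm_well_defined ::
  "('k::real_normed_field, 'l, 'n::finite) integration_data \<Rightarrow> bool" where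
  "norm_well_defined D \<longleftrightarrow>
     (\<forall>t c J f t' c' J' f'.
        elementary_rep D t c J f \<and> elementary_rep D t' c' J' f' \<and> ae_class D f = ae_class D f' \<longrightarrow>
        rep_norm D t c J = rep_norm D t' c' J')"

definition S_mod ::
  "('k::real_normed_field, 'l::ring_1, 'n::finite) integration_data
     \<Rightarrow> ('l, (('n \<Rightarrow> 'k) \<Rightarrow> 'k) set) nmod" where
  "S_mod D =
     \<lparr> mcarrier = ae_class D ` elementary D,
       madd = (\<lambda>F G. {h. \<exists>f\<in>F. \<exists>g\<in>G. h \<in> ae_class D (\<lambda>x. f x + g x)}),
       mzero = ae_class D (\<lambda>_. 0),
       mact = (\<lambda>r F. {h. \<exists>f\<in>F. h \<in> ae_class D (\<lambda>x. tau D r * f x)}),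
       mnorm = (\<lambda>F. THE r. \<exists>t c J f.
          elementary_rep D t c J f \<and> F = ae_class D f \<and> r = rep_norm D t c J) \<rparr>"

definition S_one ::
  "('k::real_normed_field, 'l, 'n::finite) integration_data \<Rightarrow> (('n \<Rightarrow> 'k) \<Rightarrow> 'k) set" where
  "S_one D = ae_class D (\<lambda>_. 1)"

definition S_abs ::
  "('k::real_normed_field, 'l, 'n::finite) integration_data
     \<Rightarrow> (('n \<Rightarrow> 'k) \<Rightarrow> 'k) set \<Rightarrow> (('n \<Rightarrow> 'k) \<Rightarrow> 'k) set" where
  "S_abs D F = {h. \<exists>f\<in>F. h \<in> ae_class D (\<lambda>x. of_real (norm (f x)))}"

text \<open>Words in \<open>{a, b}\<^sup>n\<close> are functions \<open>\<omega> :: 'n \<Rightarrow> bool\<close>, with \<open>False\<close> for \<open>a\<close> and \<open>True\<close> for \<open>b\<close>;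
  they index the summands of the direct sums of \<open>2\<^sup>n\<close> copies.\<close>

definition kap :: "('k, 'l, 'n) integration_data \<Rightarrow> bool \<Rightarrow> 'k \<Rightarrow> 'k" where
  "kap D e = (if e then kapB D else kapA D)"

definition juxt ::
  "('k::real_normed_field, 'l, 'n::finite) integration_data
     \<Rightarrow> (('n \<Rightarrow> bool) \<Rightarrow> ('n \<Rightarrow> 'k) \<Rightarrow> 'k) \<Rightarrow> ('n \<Rightarrow> 'k) \<Rightarrow> 'k" where
  "juxt D f x =
     (\<Sum>\<omega>\<in>UNIV. indicator (Pi UNIV (\<lambda>i. kap D (\<omega> i) ` base_ivl D)) x *
        f \<omega> (\<lambda>i. inv_into (base_ivl D) (kap D (\<omega> i)) (x i)))"

definition S_juxt ::
  "('k::real_normed_field, 'l, 'n::finite) integration_data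
     \<Rightarrow> (('n \<Rightarrow> bool) \<Rightarrow> (('n \<Rightarrow> 'k) \<Rightarrow> 'k) set) \<Rightarrow> (('n \<Rightarrow> 'k) \<Rightarrow> 'k) set" where
  "S_juxt D F = {h. \<exists>f. (\<forall>\<omega>. f \<omega> \<in> F \<omega> \<inter> elementary D) \<and> h \<in> ae_class D (juxt D f)}"


section \<open>Step functions of level \<open>u\<close>\<close>

text \<open>The level-\<open>(u+1)\<close> points are the images of the level-\<open>u\<close> points under \<open>\<kappa>\<^sub>a\<close> and \<open>\<kappa>\<^sub>b\<close>, listed
  in increasing order: \<open>\<kappa>\<^sub>a\<close> yields those with index at most \<open>2\<^sup>u\<close>, and \<open>\<kappa>\<^sub>a(b) = \<xi> = \<kappa>\<^sub>b(a)\<close> is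
  the point with index \<open>2\<^sup>u\<close>.\<close>

fun level_pt :: "('k, 'l, 'n) integration_data \<Rightarrow> nat \<Rightarrow> nat \<Rightarrow> 'k" where
  "level_pt D 0 s = (if s = 0 then lft D else rgt D)"
| "level_pt D (Suc u) s =
     (if s \<le> 2 ^ u then kapA D (level_pt D u s) else kapB D (level_pt D u (s - 2 ^ u)))"

definition level_ivl :: "('k, 'l, 'n) integration_data \<Rightarrow> nat \<Rightarrow> nat \<Rightarrow> 'k set" where
  "level_ivl D u s = cc_ivl D (level_pt D u s) (level_pt D u (Suc s))"

definition level_box :: "('k, 'l, 'n) integration_data \<Rightarrow> nat \<Rightarrow> ('n \<Rightarrow> nat) \<Rightarrow> ('n \<Rightarrow> 'k) set" where
  "level_box D u v = Pi UNIV (\<lambda>i. level_ivl D u (v i))"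

text \<open>The closed boxes of level \<open>u\<close> overlap only in null sets.\<close>

definition step_fun ::
  "('k::real_normed_field, 'l, 'n::finite) integration_data
     \<Rightarrow> nat \<Rightarrow> (('n \<Rightarrow> nat) \<Rightarrow> 'k) \<Rightarrow> ('n \<Rightarrow> 'k) \<Rightarrow> 'k" where
  "step_fun D u c x = (\<Sum>v\<in>{v. \<forall>i. v i < 2 ^ u}. c v * indicator (level_box D u v) x)"

definition E_mod ::
  "('k::real_normed_field, 'l::ring_1, 'n::finite) integration_data
     \<Rightarrow> nat \<Rightarrow> ('l, (('n \<Rightarrow> 'k) \<Rightarrow> 'k) set) nmod" where
  "E_mod D u =
     (S_mod D)\<lparr>mcarrier := {F \<in> mcarrier (S_mod D). \<exists>c. F = ae_class D (step_fun D u c)}\<rparr>"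

definition T_level ::
  "('k::real_normed_field, 'l::ring_1, 'n::finite) integration_data
     \<Rightarrow> nat \<Rightarrow> (('n \<Rightarrow> 'k) \<Rightarrow> 'k) set \<Rightarrow> 'k" where
  "T_level D u F =
     (THE r. \<exists>c. F = ae_class D (step_fun D u c) \<and>
        r = (\<Sum>v\<in>{v. \<forall>i. v i < 2 ^ u}. c v * of_real (measure (lam_mu D) (level_box D u v))))"

text \<open>Density of the union of the \<open>E\<^sub>u\<close>, i.e. the identification of the completion of \<open>S\<^sub>\<tau>(I\<^sub>\<Lambda>)\<close> with
  the direct limit of the \<open>E\<^sub>u\<close>.\<close>

definition E_exhausts ::
  "('k::real_normed_field, 'l::ring_1, 'n::finite) integration_data \<Rightarrow> bool" where
  "E_exhausts D \<longleftrightarrow>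
     (\<forall>F\<in>mcarrier (S_mod D). \<forall>e>0. \<exists>u. \<exists>G\<in>mcarrier (E_mod D u). mdist (S_mod D) F G < e)"

definition m_map ::
  "('k::real_normed_field, 'l::ring_1, 'n::finite) integration_data
     \<Rightarrow> nat \<Rightarrow> (('n \<Rightarrow> bool) \<Rightarrow> 'k) \<Rightarrow> 'k" where
  "m_map D u x =
     T_level D (Suc u) (S_juxt D (\<lambda>\<omega>. ae_class D (\<lambda>_. x \<omega> / of_real (lam_mass D))))"

definition k_mod ::
  "('k::real_normed_field, 'l::ring_1, 'n::finite) integration_data \<Rightarrow> ('l, 'k) nmod" where
  "k_mod D =
     \<lparr> mcarrier = UNIV, madd = (+), mzero = 0, mact = (\<lambda>r x. tau D r * x), mnorm = norm \<rparr>"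


section \<open>The categories of triples\<close>

type_synonym ('l, 'm, 'n) triple = "('l, 'm) nmod \<times> 'm \<times> ((('n \<Rightarrow> bool) \<Rightarrow> 'm) \<Rightarrow> 'm)"

definition power_sum ::
  "('k, 'l::ring_1, 'n::finite) integration_data \<Rightarrow> ('l, 'm) nmod \<Rightarrow> ('l, ('n \<Rightarrow> bool) \<Rightarrow> 'm) nmod" where
  "power_sum D N =
     direct_sum ((measure (mu D) (base_ivl D) / lam_mass D) ^ CARD('n)) (expo D) (\<lambda>_. N)"

definition N_obj ::
  "('k::real_normed_field, 'l::ring_1, 'n::finite) integration_data \<Rightarrow> ('l, 'm, 'n) triple \<Rightarrow> bool" where
  "N_obj D = (\<lambda>(N, v, \<delta>).
     normed_module (tau D) N \<and> v \<in> mcarrier N \<and> mnorm N v \<le> lam_mass D \<and>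
     mod_hom (power_sum D N) N \<delta> \<and> \<delta> (\<lambda>_. v) = v \<and>
     commutes_with_limits (power_sum D N) N \<delta>)"

definition A_obj ::
  "('k::real_normed_field, 'l::ring_1, 'n::finite) integration_data \<Rightarrow> ('l, 'm, 'n) triple \<Rightarrow> bool" where
  "A_obj D X \<longleftrightarrow> N_obj D X \<and> banach_module (tau D) (fst X)"

definition Hom_N ::
  "('k::real_normed_field, 'l::ring_1, 'n::finite) integration_data
     \<Rightarrow> ('l, 'm, 'n) triple \<Rightarrow> ('l, 'q, 'n) triple \<Rightarrow> ('m \<Rightarrow> 'q) set" where
  "Hom_N D = (\<lambda>(N, v, \<delta>) (N', v', \<delta>').
     {h \<in> cont_homs N N'.
        N_obj D (N, v, \<delta>) \<and> N_obj D (N', v', \<delta>') \<and> h v = v' \<and>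
        (\<forall>x\<in>mcarrier (power_sum D N). h (\<delta> x) = \<delta>' (\<lambda>\<omega>. h (x \<omega>)))})"

definition Hom_A ::
  "('k::real_normed_field, 'l::ring_1, 'n::finite) integration_data
     \<Rightarrow> ('l, 'm, 'n) triple \<Rightarrow> ('l, 'q, 'n) triple \<Rightarrow> ('m \<Rightarrow> 'q) set" where
  "Hom_A D X Y = {h \<in> Hom_N D X Y. A_obj D X \<and> A_obj D Y}"

definition S_obj ::
  "('k::real_normed_field, 'l::ring_1, 'n::finite) integration_data
     \<Rightarrow> ('l, (('n \<Rightarrow> 'k) \<Rightarrow> 'k) set, 'n) triple" where
  "S_obj D = (S_mod D, S_one D, S_juxt D)"

definition S_hat_obj ::
  "('k::real_normed_field, 'l::ring_1, 'n::finite) integration_data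
     \<Rightarrow> ('l, (nat \<Rightarrow> (('n \<Rightarrow> 'k) \<Rightarrow> 'k) set) set, 'n) triple" where
  "S_hat_obj D =
     (mcompletion (S_mod D), cembed (S_mod D) (S_one D), tuple_ext (S_mod D) (S_juxt D))"

definition k_obj ::
  "('k::real_normed_field, 'l::ring_1, 'n::finite) integration_data \<Rightarrow> nat \<Rightarrow> ('l, 'k, 'n) triple" where
  "k_obj D u = (k_mod D, of_real (lam_mass D), m_map D u)"

definition S_incl ::
  "('k::real_normed_field, 'l::ring_1, 'n::finite) integration_data
     \<Rightarrow> (('n \<Rightarrow> 'k) \<Rightarrow> 'k) set \<Rightarrow> (nat \<Rightarrow> (('n \<Rightarrow> 'k) \<Rightarrow> 'k) set) set" where
  "S_incl D = restrict (cembed (S_mod D)) (mcarrier (S_mod D))"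

definition S_hat_abs ::
  "('k::real_normed_field, 'l::ring_1, 'n::finite) integration_data
     \<Rightarrow> (nat \<Rightarrow> (('n \<Rightarrow> 'k) \<Rightarrow> 'k) set) set \<Rightarrow> (nat \<Rightarrow> (('n \<Rightarrow> 'k) \<Rightarrow> 'k) set) set" where
  "S_hat_abs D X = {z. \<exists>x\<in>X. z \<in> cclass (S_mod D) (\<lambda>j. S_abs D (x j))}"

text \<open>The map induced by the \<open>T\<^sub>u\<close> on the direct limit of the \<open>E\<^sub>u\<close>: the unique continuous homomorphism
  on the completion which restricts to \<open>T\<^sub>u\<close> on every \<open>E\<^sub>u\<close>.\<close>

definition is_lim_T ::
  "('k::real_normed_field, 'l::ring_1, 'n::finite) integration_data
     \<Rightarrow> ((nat \<Rightarrow> (('n \<Rightarrow> 'k) \<Rightarrow> 'k) set) set \<Rightarrow> 'k) \<Rightarrow> bool" where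
  "is_lim_T D h \<longleftrightarrow>
     {g \<in> cont_homs (mcompletion (S_mod D)) (k_mod D).
        \<forall>u. \<forall>F\<in>mcarrier (E_mod D u). g (S_incl D F) = T_level D u F} = {h}"

end

theory Submission
  imports Defs
begin

text \<open>
  The morphism whose existence and uniqueness is claimed is integration. Three observations make this
  precise.

  \<^item> \<^bold>\<open>Norm.\<close> The norm of an elementary function is its \<open>L\<^sup>1\<close> norm. For \<open>p = 1\<close> this is additivity of
    the measure. For \<open>p > 1\<close> independence of the norm of the representation forces every grid to
    have at most one cell of positive measure, and then the exponent has no effect
    (\<open>single_cell\<close>, \<open>rep_norm_eq_l1\<close>). Hence integration is a contraction, and extends to the
    completion because the field is complete (\<open>k_complete\<close>, \<open>extend_contraction\<close>).

  \<^item> \<^bold>\<open>Juxtaposition.\<close> The map \<open>\<kappa>\<^sub>\<omega>\<close> multiplies the measure of boxes by a factor \<open>weight \<omega>\<close>, so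
    the integral of a juxtaposition is the weighted sum of the integrals of its components
    (\<open>integ_juxt\<close>). The map \<open>m\<close> is this same weighted sum (\<open>m_map_eq\<close>). Therefore integration
    intertwines \<open>\<gamma>\<^sub>\<xi>\<close> and \<open>m\<close>. As the factors are at most \<open>1\<close>, juxtaposition is bounded
    (\<open>l1_juxt\<close>), hence well defined on classes, compatible with limits, and extendable to the
    completion (\<open>completion_bounded_tuple_hom\<close>).

  \<^item> \<^bold>\<open>Uniqueness.\<close> The step functions of level \<open>u + 1\<close> are exactly the juxtapositions of step
    functions of level \<open>u\<close>, and those of level \<open>0\<close> are the constants (\<open>juxt_step\<close>, \<open>step_0\<close>). A
    morphism is prescribed on the constant function \<open>1\<close>, so by induction it is integration on all
    step functions (\<open>Hom_A_on_steps\<close>). These are dense, and continuity does the rest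
    (\<open>cont_homs_eq\<close>). On level \<open>u\<close> integration is the defining sum of \<open>T\<^sub>u\<close>, which identifies it with
    the limit of the \<open>T\<^sub>u\<close>.

  For the inequality between \<open>|T f|\<close> and \<open>T |f|\<close>, the integral of \<open>|f|\<close> equals the norm of \<open>f\<close>
  (\<open>S_integ_abs\<close>), so the inequality is the contraction property.

  Elementary functions are awkward to compute with, because a sum of two of them is elementary only after
  a common refinement and after discarding degenerate intervals. They are replaced throughout by grid
  functions, which are constant on the cells cut out by finitely many intervals. These are closed
  under all pointwise operations, and each of them agrees almost everywhere with an elementary
  function (\<open>ex_elementary\<close>).
\<close>

section \<open>Completion of normed modules\<close>

text \<open>The condition on \<open>t (- 1)\<close> makes the distance symmetric. It holds for every ring homomorphism \<open>t\<close>.\<close>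

locale normed_left_module =
  fixes t :: "'l::ring_1 \<Rightarrow> 'k::real_normed_field" and N :: "('l, 'm) nmod"
  assumes normed: "normed_module t N" and norm_minus_one: "norm (t (- 1)) = 1"
begin

lemma zero_closed [simp]: "mzero N \<in> mcarrier N"
  and add_closed [simp]: "x \<in> mcarrier N \<Longrightarrow> y \<in> mcarrier N \<Longrightarrow> madd N x y \<in> mcarrier N"
  and act_closed [simp]: "x \<in> mcarrier N \<Longrightarrow> mact N r x \<in> mcarrier N"
  and add_zero [simp]: "x \<in> mcarrier N \<Longrightarrow> madd N (mzero N) x = x"
  and act_one [simp]: "x \<in> mcarrier N \<Longrightarrow> mact N 1 x = x"
  and act_mult: "x \<in> mcarrier N \<Longrightarrow> mact N (r * s) x = mact N r (mact N s x)"
  and act_add_left: "x \<in> mcarrier N \<Longrightarrow> mact N (r + s) x = madd N (mact N r x) (mact N s x)"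
  and act_add: "x \<in> mcarrier N \<Longrightarrow> y \<in> mcarrier N \<Longrightarrow>
        mact N r (madd N x y) = madd N (mact N r x) (mact N r y)"
  and norm_nonneg [simp]: "x \<in> mcarrier N \<Longrightarrow> 0 \<le> mnorm N x"
  and norm_eq_0: "x \<in> mcarrier N \<Longrightarrow> mnorm N x = 0 \<longleftrightarrow> x = mzero N"
  and norm_add: "x \<in> mcarrier N \<Longrightarrow> y \<in> mcarrier N \<Longrightarrow> mnorm N (madd N x y) \<le> mnorm N x + mnorm N y"
  and norm_act: "x \<in> mcarrier N \<Longrightarrow> mnorm N (mact N r x) = norm (t r) * mnorm N x"
  using normed unfolding normed_module_def left_module_def by auto

lemma add_commute: "x \<in> mcarrier N \<Longrightarrow> y \<in> mcarrier N \<Longrightarrow> madd N x y = madd N y x"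
  using normed unfolding normed_module_def left_module_def by (elim conjE) metis

lemma add_assoc: "x \<in> mcarrier N \<Longrightarrow> y \<in> mcarrier N \<Longrightarrow> z \<in> mcarrier N \<Longrightarrow>
        madd N (madd N x y) z = madd N x (madd N y z)"
  using normed unfolding normed_module_def left_module_def by (elim conjE) metis

lemma add_inverse_ex: "x \<in> mcarrier N \<Longrightarrow> \<exists>y\<in>mcarrier N. madd N x y = mzero N"
  using normed unfolding normed_module_def left_module_def by blast

lemma add_left_commute:
  "x \<in> mcarrier N \<Longrightarrow> y \<in> mcarrier N \<Longrightarrow> z \<in> mcarrier N \<Longrightarrow>
    madd N x (madd N y z) = madd N y (madd N x z)"
  by (metis add_assoc add_commute)

lemmas add_ac = add_assoc add_commute add_left_commute

lemma add_zero_right [simp]: "x \<in> mcarrier N \<Longrightarrow> madd N x (mzero N) = x"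
  by (metis add_commute add_zero zero_closed)

lemma idempotent_is_zero:
  assumes "x \<in> mcarrier N" "madd N x x = x" shows "x = mzero N"
  by (metis add_assoc add_inverse_ex add_zero_right assms)

lemma act_zero_left: "x \<in> mcarrier N \<Longrightarrow> mact N 0 x = mzero N"
  by (rule idempotent_is_zero) (simp_all flip: act_add_left)

lemma act_zero [simp]: "mact N r (mzero N) = mzero N"
  by (rule idempotent_is_zero) (simp_all flip: act_add)

lemma add_minus: "x \<in> mcarrier N \<Longrightarrow> madd N x (mact N (- 1) x) = mzero N"
  using act_add_left[of x 1 "- 1"] act_zero_left[of x] by simp

lemma norm_zero [simp]: "mnorm N (mzero N) = 0"
  by (simp add: norm_eq_0)

lemma norm_minus: "x \<in> mcarrier N \<Longrightarrow> mnorm N (mact N (- 1) x) = mnorm N x"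
  by (simp add: norm_act norm_minus_one)

lemma minus_minus: "x \<in> mcarrier N \<Longrightarrow> mact N (- 1) (mact N (- 1) x) = x"
  by (simp flip: act_mult)

lemma mdist_nonneg [simp]: "x \<in> mcarrier N \<Longrightarrow> y \<in> mcarrier N \<Longrightarrow> 0 \<le> mdist N x y"
  by (simp add: mdist_def)

lemma mdist_self [simp]: "x \<in> mcarrier N \<Longrightarrow> mdist N x x = 0"
  by (simp add: mdist_def add_minus)

lemma mdist_commute:
  assumes "x \<in> mcarrier N" "y \<in> mcarrier N" shows "mdist N x y = mdist N y x"
proof -
  have "mnorm N (mact N (- 1) (madd N x (mact N (- 1) y))) = mnorm N (madd N y (mact N (- 1) x))"
    using assms by (simp add: act_add minus_minus add_commute)
  then show ?thesis using assms by (simp add: norm_minus mdist_def)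
qed

lemma diff_add_diff:
  assumes "x \<in> mcarrier N" "y \<in> mcarrier N" "z \<in> mcarrier N"
  shows "madd N (madd N x (mact N (- 1) y)) (madd N y z) = madd N x z"
proof -
  have "madd N (madd N x (mact N (- 1) y)) (madd N y z) =
      madd N x (madd N (madd N y (mact N (- 1) y)) z)"
    using assms by (simp add: add_ac)
  then show ?thesis using assms by (simp add: add_minus)
qed

lemma mdist_triangle:
  assumes "x \<in> mcarrier N" "y \<in> mcarrier N" "z \<in> mcarrier N"
  shows "mdist N x z \<le> mdist N x y + mdist N y z"
  using norm_add[of "madd N x (mact N (- 1) y)" "madd N y (mact N (- 1) z)"] assms
  by (simp add: mdist_def diff_add_diff)

lemma mdist_eq_0:
  assumes "x \<in> mcarrier N" "y \<in> mcarrier N" shows "mdist N x y = 0 \<longleftrightarrow> x = y"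
  using diff_add_diff[of x y "mzero N"] assms by (auto simp: mdist_def norm_eq_0 add_minus)

lemma mdist_zero [simp]: "x \<in> mcarrier N \<Longrightarrow> mdist N x (mzero N) = mnorm N x"
  by (simp add: mdist_def)

lemma mdist_add:
  assumes "x \<in> mcarrier N" "y \<in> mcarrier N" "x' \<in> mcarrier N" "y' \<in> mcarrier N"
  shows "mdist N (madd N x y) (madd N x' y') \<le> mdist N x x' + mdist N y y'"
  using norm_add[of "madd N x (mact N (- 1) x')" "madd N y (mact N (- 1) y')"] assms
  by (simp add: mdist_def act_add add_ac)

lemma mdist_act:
  assumes "x \<in> mcarrier N" "y \<in> mcarrier N"
  shows "mdist N (mact N r x) (mact N r y) = norm (t r) * mdist N x y"
proof -
  have "mact N (- 1) (mact N r y) = mact N r (mact N (- 1) y)"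
    using assms by (simp flip: act_mult)
  then have "madd N (mact N r x) (mact N (- 1) (mact N r y)) = mact N r (madd N x (mact N (- 1) y))"
    using assms by (simp add: act_add)
  then show ?thesis using assms by (simp add: mdist_def norm_act)
qed

lemma abs_norm_diff_le:
  assumes "x \<in> mcarrier N" "y \<in> mcarrier N"
  shows "\<bar>mnorm N x - mnorm N y\<bar> \<le> mdist N x y"
  using mdist_triangle[of x y "mzero N"] mdist_triangle[of y x "mzero N"] mdist_commute[of x y] assms
  by simp

text \<open>Expressed as a limit along a product filter, the Cauchy condition and the equivalence of Cauchy
  sequences have the same shape, so that one sandwich argument transports both through Lipschitz maps.\<close>

lemma mCauchy_iff:
  "mCauchy N x \<longleftrightarrow> (\<forall>j. x j \<in> mcarrier N) \<and>
     ((\<lambda>(i, j). mdist N (x i) (x j)) \<longlongrightarrow> 0) (sequentially \<times>\<^sub>F sequentially)"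
proof -
  have "((\<lambda>(i, j). mdist N (x i) (x j)) \<longlongrightarrow> 0) (sequentially \<times>\<^sub>F sequentially) \<longleftrightarrow>
     (\<forall>e>0. \<exists>K. \<forall>i\<ge>K. \<forall>j\<ge>K. mdist N (x i) (x j) < e)" if "\<forall>j. x j \<in> mcarrier N"
    using that by (simp add: tendsto_iff eventually_prod_sequentially) meson
  then show ?thesis by (auto simp: mCauchy_def)
qed

lemma mCauchy_closed [simp, dest]: "mCauchy N x \<Longrightarrow> x j \<in> mcarrier N"
  by (simp add: mCauchy_def)

lemma mCauchy_const [simp]: "x \<in> mcarrier N \<Longrightarrow> mCauchy N (\<lambda>_. x)"
  by (simp add: mCauchy_def)

lemma in_cclass_iff: "y \<in> cclass N x \<longleftrightarrow> mCauchy N y \<and> (\<lambda>j. mdist N (x j) (y j)) \<longlonglongrightarrow> 0"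
  by (simp add: cclass_def)

lemma cclass_self [simp]: "mCauchy N x \<Longrightarrow> x \<in> cclass N x"
  by (simp add: in_cclass_iff)

lemma null_dist_trans:
  assumes "\<And>j. x j \<in> mcarrier N" "\<And>j. y j \<in> mcarrier N" "\<And>j. z j \<in> mcarrier N"
    and "(\<lambda>j. mdist N (x j) (y j)) \<longlonglongrightarrow> 0" "(\<lambda>j. mdist N (y j) (z j)) \<longlonglongrightarrow> 0"
  shows "(\<lambda>j. mdist N (x j) (z j)) \<longlonglongrightarrow> 0"
proof (rule tendsto_sandwich[OF _ _ tendsto_const])
  show "(\<lambda>j. mdist N (x j) (y j) + mdist N (y j) (z j)) \<longlonglongrightarrow> 0"
    using tendsto_add[OF assms(4,5)] by simp
qed (use assms in \<open>auto intro!: mdist_triangle always_eventually\<close>)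

lemma cclass_eq_iff:
  assumes x: "mCauchy N x" and y: "mCauchy N y"
  shows "cclass N x = cclass N y \<longleftrightarrow> (\<lambda>j. mdist N (x j) (y j)) \<longlonglongrightarrow> 0"
proof
  assume "cclass N x = cclass N y"
  then have "y \<in> cclass N x" using y by simp
  then show "(\<lambda>j. mdist N (x j) (y j)) \<longlonglongrightarrow> 0" by (simp add: in_cclass_iff)
next
  assume *: "(\<lambda>j. mdist N (x j) (y j)) \<longlonglongrightarrow> 0"
  then have **: "(\<lambda>j. mdist N (y j) (x j)) \<longlonglongrightarrow> 0" using x y by (simp add: mdist_commute)
  show "cclass N x = cclass N y"
    using null_dist_trans[OF _ _ _ *] null_dist_trans[OF _ _ _ **] x y
    by (auto simp: in_cclass_iff)
qed

lemma completion_carrier: "X \<in> mcarrier (mcompletion N) \<longleftrightarrow> (\<exists>x. mCauchy N x \<and> X = cclass N x)"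
  by (auto simp: mcompletion_def)

lemma completion_carrierE:
  assumes "X \<in> mcarrier (mcompletion N)"
  obtains x where "mCauchy N x" "X = cclass N x"
  using assms by (auto simp: completion_carrier)

lemma cclass_closed [simp]: "mCauchy N x \<Longrightarrow> cclass N x \<in> mcarrier (mcompletion N)"
  by (auto simp: completion_carrier)

lemma norms_convergent:
  assumes "mCauchy N x" shows "convergent (\<lambda>j. mnorm N (x j))"
proof -
  have "Cauchy (\<lambda>j. mnorm N (x j))"
  proof (rule metric_CauchyI)
    fix e :: real assume "0 < e"
    then obtain K where "\<forall>i\<ge>K. \<forall>j\<ge>K. mdist N (x i) (x j) < e"
      using assms by (auto simp: mCauchy_def)
    then show "\<exists>K. \<forall>i\<ge>K. \<forall>j\<ge>K. dist (mnorm N (x i)) (mnorm N (x j)) < e"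
      using abs_norm_diff_le assms unfolding dist_real_def
      by (meson le_less_trans mCauchy_closed)
  qed
  then show ?thesis by (simp add: Cauchy_convergent_iff)
qed

text \<open>The norms of equivalent Cauchy sequences differ by a null sequence, so the defining description
  of the norm of a class determines a unique limit.\<close>

lemma completion_norm:
  assumes x: "mCauchy N x"
  shows "(\<lambda>j. mnorm N (x j)) \<longlonglongrightarrow> mnorm (mcompletion N) (cclass N x)"
proof -
  obtain r where r: "(\<lambda>j. mnorm N (x j)) \<longlonglongrightarrow> r"
    using norms_convergent[OF x] by (auto simp: convergent_def)
  have *: "(\<lambda>j. mnorm N (y j)) \<longlonglongrightarrow> r" if "y \<in> cclass N x" for y
  proof -
    have "(\<lambda>j. mnorm N (y j) - mnorm N (x j)) \<longlonglongrightarrow> 0"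
    proof (rule Lim_null_comparison)
      show "\<forall>\<^sub>F j in sequentially. norm (mnorm N (y j) - mnorm N (x j)) \<le> mdist N (x j) (y j)"
      proof (rule always_eventually, rule allI)
        fix j
        show "norm (mnorm N (y j) - mnorm N (x j)) \<le> mdist N (x j) (y j)"
          using that x abs_norm_diff_le[of "x j" "y j"]
          by (simp add: in_cclass_iff abs_minus_commute)
      qed
      show "(\<lambda>j. mdist N (x j) (y j)) \<longlonglongrightarrow> 0" using that by (simp add: in_cclass_iff)
    qed
    then show ?thesis using tendsto_add[OF _ r] by fastforce
  qed
  have "mnorm (mcompletion N) (cclass N x) = r"
    unfolding mcompletion_def
    using * cclass_self[OF x] by (auto intro!: the_equality dest: LIMSEQ_unique)
  then show ?thesis using r by simp
qed

end

lemma normed_left_moduleI: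
  assumes "normed_module t N" "norm (t (- 1)) = 1" shows "normed_left_module t N"
  using assms by unfold_locales

locale two_modules = N: normed_left_module t N + M: normed_left_module t M
  for t :: "'l::ring_1 \<Rightarrow> 'k::real_normed_field" and N :: "('l, 'm) nmod" and M :: "('l, 'q) nmod"
begin

text \<open>One estimate on finite tuples serves addition (two entries), scalar multiplication and pointwise
  norms (one entry) and juxtaposition (\<open>2\<^sup>n\<close> entries): in each case the operation on the completion,
  defined as a union over all representatives, can be computed on any one of them.\<close>

definition lipschitz_tuple :: "real \<Rightarrow> (('w::finite \<Rightarrow> 'm) \<Rightarrow> 'q) \<Rightarrow> bool" where
  "lipschitz_tuple C F \<longleftrightarrow>
     (\<forall>x. (\<forall>i. x i \<in> mcarrier N) \<longrightarrow> F x \<in> mcarrier M) \<and>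
     (\<forall>x y. (\<forall>i. x i \<in> mcarrier N) \<and> (\<forall>i. y i \<in> mcarrier N) \<longrightarrow>
        mdist M (F x) (F y) \<le> C * (\<Sum>i\<in>UNIV. mdist N (x i) (y i)))"

lemma lipschitz_tuple_null:
  assumes F: "lipschitz_tuple C F"
    and "\<And>p i. x p i \<in> mcarrier N" "\<And>p i. y p i \<in> mcarrier N"
    and "\<And>i. ((\<lambda>p. mdist N (x p i) (y p i)) \<longlongrightarrow> 0) G"
  shows "((\<lambda>p. mdist M (F (x p)) (F (y p))) \<longlongrightarrow> 0) G"
proof (rule tendsto_sandwich[OF _ _ tendsto_const])
  have "((\<lambda>p. C * (\<Sum>i\<in>UNIV. mdist N (x p i) (y p i))) \<longlongrightarrow> C * (\<Sum>i\<in>(UNIV::'a set). 0)) G"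
    by (intro tendsto_intros assms)
  then show "((\<lambda>p. C * (\<Sum>i\<in>UNIV. mdist N (x p i) (y p i))) \<longlongrightarrow> 0) G" by simp
qed (use assms in \<open>auto simp: lipschitz_tuple_def intro!: always_eventually\<close>)

lemma lipschitz_tuple_Cauchy:
  assumes F: "lipschitz_tuple C F" and x: "\<And>i. mCauchy N (x i)"
  shows "mCauchy M (\<lambda>j. F (\<lambda>i. x i j))"
proof -
  have "((\<lambda>(j, j'). mdist N (x i j) (x i j')) \<longlongrightarrow> 0) (sequentially \<times>\<^sub>F sequentially)" for i
    using x[of i] by (simp add: N.mCauchy_iff)
  then have "((\<lambda>p. mdist M (F (\<lambda>i. x i (fst p))) (F (\<lambda>i. x i (snd p)))) \<longlongrightarrow> 0)
       (sequentially \<times>\<^sub>F sequentially)"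
    using x by (intro lipschitz_tuple_null[OF F]) (auto simp: case_prod_unfold)
  then show ?thesis
    using F x by (auto simp: M.mCauchy_iff lipschitz_tuple_def case_prod_unfold)
qed

lemma lipschitz_tuple_cclass:
  assumes F: "lipschitz_tuple C F" and x: "\<And>i. mCauchy N (x i)" and y: "\<And>i. y i \<in> cclass N (x i)"
  shows "cclass M (\<lambda>j. F (\<lambda>i. y i j)) = cclass M (\<lambda>j. F (\<lambda>i. x i j))"
proof -
  have y': "mCauchy N (y i)" for i using y by (simp add: N.in_cclass_iff)
  have "(\<lambda>j. mdist M (F (\<lambda>i. x i j)) (F (\<lambda>i. y i j))) \<longlonglongrightarrow> 0"
    using x y y' by (intro lipschitz_tuple_null[OF F]) (auto simp: N.in_cclass_iff)
  then show ?thesis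
    using M.cclass_eq_iff lipschitz_tuple_Cauchy[OF F] x y' by metis
qed

lemma lipschitz_tuple_image:
  assumes F: "lipschitz_tuple C F" and x: "\<And>i. mCauchy N (x i)"
  shows "{z. \<exists>y. (\<forall>i. y i \<in> cclass N (x i)) \<and> z \<in> cclass M (\<lambda>j. F (\<lambda>i. y i j))} =
     cclass M (\<lambda>j. F (\<lambda>i. x i j))"
proof -
  have "cclass M (\<lambda>j. F (\<lambda>i. y i j)) = cclass M (\<lambda>j. F (\<lambda>i. x i j))" if "\<forall>i. y i \<in> cclass N (x i)" for y
    using that by (intro lipschitz_tuple_cclass[OF F x]) auto
  moreover have "\<forall>i. x i \<in> cclass N (x i)" using x by simp
  ultimately show ?thesis by blast
qed

lemma lipschitz_tuple_image_single:
  assumes F: "lipschitz_tuple C (\<lambda>x::unit \<Rightarrow> 'm. F (x ()))" and x: "mCauchy N x"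
  shows "mCauchy M (\<lambda>j. F (x j))"
    and "{z. \<exists>y\<in>cclass N x. z \<in> cclass M (\<lambda>j. F (y j))} = cclass M (\<lambda>j. F (x j))"
proof -
  show "mCauchy M (\<lambda>j. F (x j))"
    using lipschitz_tuple_Cauchy[OF F, of "\<lambda>_. x"] x by simp
  have "cclass M (\<lambda>j. F (y j)) = cclass M (\<lambda>j. F (x j))" if "y \<in> cclass N x" for y
    using lipschitz_tuple_cclass[OF F, of "\<lambda>_. x" "\<lambda>_. y"] x that by simp
  then show "{z. \<exists>y\<in>cclass N x. z \<in> cclass M (\<lambda>j. F (y j))} = cclass M (\<lambda>j. F (x j))"
    using x N.cclass_self by blast
qed

end

context normed_left_module
begin

interpretation two_modules t N N by unfold_locales

lemma lipschitz_act: "lipschitz_tuple (norm (t r)) (\<lambda>x::unit \<Rightarrow> 'm. mact N r (x ()))"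
  by (simp add: lipschitz_tuple_def mdist_act UNIV_unit)

lemma lipschitz_add: "lipschitz_tuple 1 (\<lambda>x::bool \<Rightarrow> 'm. madd N (x True) (x False))"
  using mdist_add by (simp add: lipschitz_tuple_def UNIV_bool add.commute[of "mdist N (_ False) _"])

lemma mCauchy_act: "mCauchy N x \<Longrightarrow> mCauchy N (\<lambda>j. mact N r (x j))"
  by (rule lipschitz_tuple_image_single[OF lipschitz_act])

lemma completion_act:
  "mCauchy N x \<Longrightarrow> mact (mcompletion N) r (cclass N x) = cclass N (\<lambda>j. mact N r (x j))"
  using lipschitz_tuple_image_single(2)[OF lipschitz_act] by (simp add: mcompletion_def)

lemma mCauchy_add: "mCauchy N x \<Longrightarrow> mCauchy N y \<Longrightarrow> mCauchy N (\<lambda>j. madd N (x j) (y j))"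
  using lipschitz_tuple_Cauchy[OF lipschitz_add, of "\<lambda>b. if b then x else y"] by simp

lemma completion_add:
  assumes "mCauchy N x" "mCauchy N y"
  shows "madd (mcompletion N) (cclass N x) (cclass N y) = cclass N (\<lambda>j. madd N (x j) (y j))"
proof -
  have "cclass N (\<lambda>j. madd N (x' j) (y' j)) = cclass N (\<lambda>j. madd N (x j) (y j))"
    if "x' \<in> cclass N x" "y' \<in> cclass N y" for x' y'
    using lipschitz_tuple_cclass[OF lipschitz_add, of "\<lambda>b. if b then x else y" "\<lambda>b. if b then x' else y'"]
      assms that by simp
  then have "{z. \<exists>x'\<in>cclass N x. \<exists>y'\<in>cclass N y. z \<in> cclass N (\<lambda>j. madd N (x' j) (y' j))} =
      cclass N (\<lambda>j. madd N (x j) (y j))"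
    using assms cclass_self by blast
  then show ?thesis by (simp add: mcompletion_def)
qed

lemma completion_zero: "mzero (mcompletion N) = cclass N (\<lambda>_. mzero N)"
  by (simp add: mcompletion_def)

lemma completion_left_module: "left_module (mcompletion N)"
  unfolding left_module_def
proof (intro conjI ballI allI)
  fix x assume "x \<in> mcarrier (mcompletion N)"
  then obtain a where a: "mCauchy N a" "x = cclass N a" by (rule completion_carrierE)
  note C = completion_add completion_act completion_zero mCauchy_add mCauchy_act
  show "madd (mcompletion N) (mzero (mcompletion N)) x = x"
    "mact (mcompletion N) 1 x = x"
    using a by (simp_all add: C)
  show "\<exists>y\<in>mcarrier (mcompletion N). madd (mcompletion N) x y = mzero (mcompletion N)"
    using a by (intro bexI[of _ "cclass N (\<lambda>j. mact N (- 1) (a j))"]) (simp_all add: C add_minus)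
  fix r
  show "mact (mcompletion N) r x \<in> mcarrier (mcompletion N)"
    using a by (simp_all add: C)
  {
    fix s
    show "mact (mcompletion N) (r * s) x = mact (mcompletion N) r (mact (mcompletion N) s x)"
      "mact (mcompletion N) (r + s) x = madd (mcompletion N) (mact (mcompletion N) r x) (mact (mcompletion N) s x)"
      using a by (simp_all add: C act_mult act_add_left)
  }
  fix y assume "y \<in> mcarrier (mcompletion N)"
  then obtain b where b: "mCauchy N b" "y = cclass N b" by (rule completion_carrierE)
  show "mact (mcompletion N) r (madd (mcompletion N) x y) =
      madd (mcompletion N) (mact (mcompletion N) r x) (mact (mcompletion N) r y)"
    using a b by (simp add: C act_add)
  show "madd (mcompletion N) x y \<in> mcarrier (mcompletion N)"
    "madd (mcompletion N) x y = madd (mcompletion N) y x"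
    using a b by (simp_all add: C add_commute)
  fix z assume "z \<in> mcarrier (mcompletion N)"
  then obtain c where c: "mCauchy N c" "z = cclass N c" by (rule completion_carrierE)
  show "madd (mcompletion N) (madd (mcompletion N) x y) z = madd (mcompletion N) x (madd (mcompletion N) y z)"
    using a b c by (simp add: C add_assoc)
qed (simp add: completion_zero)

lemma completion_normed: "normed_module t (mcompletion N)"
  unfolding normed_module_def
proof (intro conjI ballI allI)
  fix x assume "x \<in> mcarrier (mcompletion N)"
  then obtain a where a: "mCauchy N a" "x = cclass N a" by (rule completion_carrierE)
  note na = completion_norm[OF a(1), folded a(2)]
  show "0 \<le> mnorm (mcompletion N) x"
    using a by (intro LIMSEQ_le_const[OF na]) auto
  have "x = mzero (mcompletion N) \<longleftrightarrow> (\<lambda>j. mnorm N (a j)) \<longlonglongrightarrow> 0"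
    using a by (simp add: completion_zero cclass_eq_iff)
  then show "mnorm (mcompletion N) x = 0 \<longleftrightarrow> x = mzero (mcompletion N)"
    using na LIMSEQ_unique by auto
  fix r
  have "(\<lambda>j. norm (t r) * mnorm N (a j)) \<longlonglongrightarrow> norm (t r) * mnorm (mcompletion N) x"
    by (intro tendsto_intros na)
  moreover have "(\<lambda>j. norm (t r) * mnorm N (a j)) \<longlonglongrightarrow> mnorm (mcompletion N) (mact (mcompletion N) r x)"
    using completion_norm[OF mCauchy_act[OF a(1), of r]] a by (simp add: completion_act norm_act)
  ultimately show "mnorm (mcompletion N) (mact (mcompletion N) r x) = norm (t r) * mnorm (mcompletion N) x"
    by (rule LIMSEQ_unique[symmetric])
  fix y assume "y \<in> mcarrier (mcompletion N)"
  then obtain b where b: "mCauchy N b" "y = cclass N b" by (rule completion_carrierE)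
  note nb = completion_norm[OF b(1), folded b(2)]
  show "mnorm (mcompletion N) (madd (mcompletion N) x y) \<le> mnorm (mcompletion N) x + mnorm (mcompletion N) y"
    using completion_norm[OF mCauchy_add[OF a(1) b(1)]] tendsto_add[OF na nb] a b norm_add
    by (intro LIMSEQ_le) (auto simp: completion_add)
qed (rule completion_left_module)

lemma completion_normed_left_module: "normed_left_module t (mcompletion N)"
  using completion_normed norm_minus_one by unfold_locales

lemma completion_mdist:
  assumes "mCauchy N x" "mCauchy N y"
  shows "(\<lambda>j. mdist N (x j) (y j)) \<longlonglongrightarrow> mdist (mcompletion N) (cclass N x) (cclass N y)"
  using completion_norm[OF mCauchy_add[OF assms(1) mCauchy_act[OF assms(2)]], of "- 1"] assms
  by (simp add: mdist_def completion_add completion_act mCauchy_act)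

lemma cembed_closed [simp]: "x \<in> mcarrier N \<Longrightarrow> cembed N x \<in> mcarrier (mcompletion N)"
  by (simp add: cembed_def)

lemma mdist_cembed:
  "x \<in> mcarrier N \<Longrightarrow> y \<in> mcarrier N \<Longrightarrow> mdist (mcompletion N) (cembed N x) (cembed N y) = mdist N x y"
  using completion_mdist[of "\<lambda>_. x" "\<lambda>_. y"] by (simp add: cembed_def LIMSEQ_const_iff)

lemma mnorm_cembed: "x \<in> mcarrier N \<Longrightarrow> mnorm (mcompletion N) (cembed N x) = mnorm N x"
  using completion_norm[of "\<lambda>_. x"] by (simp add: cembed_def LIMSEQ_const_iff)

lemma cembed_hom: "mod_hom N (mcompletion N) (cembed N)"
  by (simp add: mod_hom_def cembed_def completion_add completion_act)

lemma Cauchy_limit_in_completion: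
  assumes x: "mCauchy N x"
  shows "(\<lambda>k. mdist (mcompletion N) (cembed N (x k)) (cclass N x)) \<longlonglongrightarrow> 0"
proof (rule LIMSEQ_I)
  fix e :: real assume "0 < e"
  then have "0 < e / 2" by simp
  then obtain K where K: "\<And>i j. i \<ge> K \<Longrightarrow> j \<ge> K \<Longrightarrow> mdist N (x i) (x j) < e / 2"
    using x unfolding mCauchy_def by meson
  interpret C: normed_left_module t "mcompletion N" by (rule completion_normed_left_module)
  have "mdist (mcompletion N) (cembed N (x k)) (cclass N x) \<le> e / 2" if "k \<ge> K" for k
    unfolding cembed_def
    using completion_mdist[OF mCauchy_const[OF mCauchy_closed[OF x]] x]
    by (rule LIMSEQ_le_const2) (use K that in \<open>auto intro!: exI[of _ K] less_imp_le\<close>)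
  moreover have "0 \<le> mdist (mcompletion N) (cembed N (x k)) (cclass N x)" for k
    using x by simp
  ultimately show "\<exists>K. \<forall>k\<ge>K. norm (mdist (mcompletion N) (cembed N (x k)) (cclass N x) - 0) < e"
    using \<open>0 < e\<close> by (intro exI[of _ K]) (smt (verit) field_sum_of_halves real_norm_def)
qed

lemma cembed_dense:
  assumes "X \<in> mcarrier (mcompletion N)" "0 < e"
  shows "\<exists>x\<in>mcarrier N. mdist (mcompletion N) (cembed N x) X < e"
proof -
  obtain x where x: "mCauchy N x" "X = cclass N x" using assms(1) by (rule completion_carrierE)
  obtain k where "norm (mdist (mcompletion N) (cembed N (x k)) X - 0) < e"
    using LIMSEQ_D[OF Cauchy_limit_in_completion[OF x(1)] assms(2)] x(2) by auto
  then show ?thesis using x by (intro bexI[of _ "x k"]) auto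
qed

text \<open>A Cauchy sequence of classes is approximated, up to \<open>1 / (k + 1)\<close> at position \<open>k\<close>, by a
  sequence in the original module; the class of the latter is the limit.\<close>

lemma completion_banach: "banach_module t (mcompletion N)"
proof -
  interpret C: normed_left_module t "mcompletion N" by (rule completion_normed_left_module)
  let ?d = "mdist (mcompletion N)"
  have lim: "\<exists>L\<in>mcarrier (mcompletion N). (\<lambda>k. ?d (X k) L) \<longlonglongrightarrow> 0" if X: "mCauchy (mcompletion N) X" for X
  proof -
    have "\<exists>x\<in>mcarrier N. ?d (cembed N x) (X k) < inverse (real (Suc k))" for k
      using X by (intro cembed_dense) auto
    then obtain x where x: "\<And>k. x k \<in> mcarrier N"
      and xd: "\<And>k. ?d (cembed N (x k)) (X k) < inverse (real (Suc k))" by metis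
    have Xx: "(\<lambda>k. ?d (X k) (cembed N (x k))) \<longlonglongrightarrow> 0"
      using X x xd by (intro real_tendsto_sandwich[OF _ _ tendsto_const LIMSEQ_inverse_real_of_nat])
        (auto intro!: always_eventually less_imp_le simp: C.mdist_commute)
    have "mCauchy N x"
      unfolding mCauchy_def
    proof (intro conjI allI impI)
      \<comment> \<open>The distance of two approximants is at most the distance of the classes plus two errors.\<close>
      fix e :: real assume e: "0 < e"
      obtain K where K: "\<And>i j. i \<ge> K \<Longrightarrow> j \<ge> K \<Longrightarrow> ?d (X i) (X j) < e / 3"
        using X e unfolding mCauchy_def by (meson divide_pos_pos zero_less_numeral)
      obtain K' where K': "\<And>i. i \<ge> K' \<Longrightarrow> ?d (X i) (cembed N (x i)) < e / 3"
        using LIMSEQ_D[OF Xx, of "e / 3"] e by force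
      show "\<exists>K. \<forall>i\<ge>K. \<forall>j\<ge>K. mdist N (x i) (x j) < e"
      proof (intro exI allI impI)
        fix i j assume ij: "i \<ge> max K K'" "j \<ge> max K K'"
        have "mdist N (x i) (x j) = ?d (cembed N (x i)) (cembed N (x j))"
          using x by (simp add: mdist_cembed)
        also have "\<dots> \<le> ?d (cembed N (x i)) (X i) + (?d (X i) (X j) + ?d (X j) (cembed N (x j)))"
          using C.mdist_triangle[of "cembed N (x i)" "X i" "cembed N (x j)"]
            C.mdist_triangle[of "X i" "X j" "cembed N (x j)"] x X by auto
        also have "\<dots> < e"
          using K[of i j] K'[of i] K'[of j] ij C.mdist_commute[of "X i" "cembed N (x i)"] x X by auto
        finally show "mdist N (x i) (x j) < e" .
      qed
    qed (rule x)
    then show ?thesis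
      using X x by (intro bexI[of _ "cclass N x"] C.null_dist_trans[OF _ _ _ Xx Cauchy_limit_in_completion]) auto
  qed
  have "X \<in> cembed (mcompletion N) ` mcarrier (mcompletion N)"
    if X: "X \<in> mcarrier (mcompletion (mcompletion N))" for X
  proof -
    obtain Y where Y: "mCauchy (mcompletion N) Y" "X = cclass (mcompletion N) Y"
      using X by (rule C.completion_carrierE)
    then obtain L where L: "L \<in> mcarrier (mcompletion N)" "(\<lambda>k. ?d (Y k) L) \<longlonglongrightarrow> 0"
      using lim by blast
    then have "X = cembed (mcompletion N) L"
      using Y by (simp add: cembed_def C.cclass_eq_iff)
    then show ?thesis using L by blast
  qed
  then show ?thesis
    using completion_normed C.cembed_closed unfolding banach_module_def by blast
qed

end

section \<open>Bounded homomorphisms on tuples and extension of contractions\<close>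

lemma direct_sum_simps [simp]:
  "mcarrier (direct_sum w p X) = {x. \<forall>i. x i \<in> mcarrier (X i)}"
  "madd (direct_sum w p X) x y = (\<lambda>i. madd (X i) (x i) (y i))"
  "mact (direct_sum w p X) r x = (\<lambda>i. mact (X i) r (x i))"
  by (simp_all add: direct_sum_def)

lemma mod_hom_direct_sum:
  "mod_hom (direct_sum w p X) M h \<longleftrightarrow>
     (\<forall>x. (\<forall>i. x i \<in> mcarrier (X i)) \<longrightarrow> h x \<in> mcarrier M) \<and>
     (\<forall>x y. (\<forall>i. x i \<in> mcarrier (X i)) \<longrightarrow> (\<forall>i. y i \<in> mcarrier (X i)) \<longrightarrow>
        h (\<lambda>i. madd (X i) (x i) (y i)) = madd M (h x) (h y)) \<and>
     (\<forall>r x. (\<forall>i. x i \<in> mcarrier (X i)) \<longrightarrow> h (\<lambda>i. mact (X i) r (x i)) = mact M r (h x))"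
  by (simp add: mod_hom_def)

text \<open>Homomorphy on a direct sum does not depend on its weight and exponent, and the norms for different
  weights and exponents are equivalent. Measuring against the plain sum of the norms makes one bound
  usable for every module and for its completion.\<close>

definition bounded_tuple_hom ::
  "real \<Rightarrow> ('l::ring_1, 'm) nmod \<Rightarrow> (('w::finite \<Rightarrow> 'm) \<Rightarrow> 'm) \<Rightarrow> bool" where
  "bounded_tuple_hom C N \<delta> \<longleftrightarrow>
     mod_hom (direct_sum 1 1 (\<lambda>_::'w. N)) N \<delta> \<and>
     (\<forall>x. (\<forall>i. x i \<in> mcarrier N) \<longrightarrow> mnorm N (\<delta> x) \<le> C * (\<Sum>i\<in>UNIV. mnorm N (x i)))"

context normed_left_module
begin

interpretation two_modules t N N by unfold_locales

lemma bounded_tuple_lipschitz: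
  assumes "bounded_tuple_hom C N \<delta>" shows "lipschitz_tuple C \<delta>"
proof -
  have h: "(\<forall>i. x i \<in> mcarrier N) \<Longrightarrow> \<delta> x \<in> mcarrier N"
    "(\<forall>i. x i \<in> mcarrier N) \<Longrightarrow> (\<forall>i. y i \<in> mcarrier N) \<Longrightarrow>
        \<delta> (\<lambda>i. madd N (x i) (y i)) = madd N (\<delta> x) (\<delta> y)"
    "(\<forall>i. x i \<in> mcarrier N) \<Longrightarrow> \<delta> (\<lambda>i. mact N r (x i)) = mact N r (\<delta> x)"
    "(\<forall>i. x i \<in> mcarrier N) \<Longrightarrow> mnorm N (\<delta> x) \<le> C * (\<Sum>i\<in>UNIV. mnorm N (x i))" for x y r
    using assms unfolding bounded_tuple_hom_def mod_hom_direct_sum by auto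
  have "mdist N (\<delta> x) (\<delta> y) \<le> C * (\<Sum>i\<in>UNIV. mdist N (x i) (y i))"
    if "\<forall>i. x i \<in> mcarrier N" "\<forall>i. y i \<in> mcarrier N" for x y
  proof -
    have "\<delta> (\<lambda>i. madd N (x i) (mact N (- 1) (y i))) = madd N (\<delta> x) (mact N (- 1) (\<delta> y))"
      using h(2)[of x "\<lambda>i. mact N (- 1) (y i)"] h(3)[of y "- 1"] that by simp
    then show ?thesis
      using h(4)[of "\<lambda>i. madd N (x i) (mact N (- 1) (y i))"] that by (simp add: mdist_def)
  qed
  then show ?thesis using h(1) by (simp add: lipschitz_tuple_def)
qed

lemma tuple_ext_cclass:
  assumes "bounded_tuple_hom C N \<delta>" "\<And>i. mCauchy N (x i)"
  shows "tuple_ext N \<delta> (\<lambda>i. cclass N (x i)) = cclass N (\<lambda>j. \<delta> (\<lambda>i. x i j))"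
  unfolding tuple_ext_def
  by (rule lipschitz_tuple_image[OF bounded_tuple_lipschitz[OF assms(1)] assms(2)])

text \<open>Each summand is dominated by the norm of the direct sum, up to the factor \<open>w powr (1 / p)\<close>.\<close>

lemma direct_sum_Cauchy:
  fixes x :: "nat \<Rightarrow> 'w::finite \<Rightarrow> 'm"
  assumes "0 < w" "0 < p" and x: "mCauchy (direct_sum w p (\<lambda>_. N)) x"
  shows "mCauchy N (\<lambda>j. x j i)"
proof -
  have xc: "x j i \<in> mcarrier N" for j i using x by (auto simp: mCauchy_def)
  have le: "w powr (1 / p) * mdist N (x j i) (x j' i) \<le> mdist (direct_sum w p (\<lambda>_. N)) (x j) (x j')" for j j'
  proof -
    have "w powr (1 / p) * mdist N (x j i) (x j' i) = (w * mdist N (x j i) (x j' i) powr p) powr (1 / p)"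
      using assms(1,2) xc by (simp add: powr_mult powr_powr)
    also have "\<dots> \<le> (w * (\<Sum>i\<in>UNIV. mdist N (x j i) (x j' i) powr p)) powr (1 / p)"
      using assms(1,2) by (intro powr_mono2 mult_left_mono member_le_sum) auto
    also have "\<dots> = mdist (direct_sum w p (\<lambda>_. N)) (x j) (x j')"
      unfolding mdist_def direct_sum_simps by (simp add: direct_sum_def)
    finally show ?thesis .
  qed
  show ?thesis
    unfolding mCauchy_def
  proof (intro conjI allI impI)
    fix e :: real assume e: "0 < e"
    then have "0 < w powr (1 / p) * e" using assms(1) by simp
    then obtain K where K: "\<And>j j'. j \<ge> K \<Longrightarrow> j' \<ge> K \<Longrightarrow>
        mdist (direct_sum w p (\<lambda>_. N)) (x j) (x j') < w powr (1 / p) * e"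
      using x unfolding mCauchy_def by meson
    then have "w powr (1 / p) * mdist N (x j i) (x j' i) < w powr (1 / p) * e" if "j \<ge> K" "j' \<ge> K" for j j'
      using le[of j j'] K[OF that] by linarith
    then show "\<exists>K. \<forall>j\<ge>K. \<forall>j'\<ge>K. mdist N (x j i) (x j' i) < e"
      using assms(1) by (intro exI[of _ K]) simp
  qed (rule xc)
qed

lemma bounded_commutes_with_limits:
  fixes \<delta> :: "('w::finite \<Rightarrow> 'm) \<Rightarrow> 'm"
  assumes "bounded_tuple_hom C N \<delta>" "0 < w" "0 < p"
  shows "commutes_with_limits (direct_sum w p (\<lambda>_. N)) N \<delta>"
  unfolding commutes_with_limits_def
proof (intro allI impI conjI)
  fix x :: "nat \<Rightarrow> 'w \<Rightarrow> 'm" assume "mCauchy (direct_sum w p (\<lambda>_. N)) x"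
  then have x: "mCauchy N (\<lambda>j. x j i)" for i by (rule direct_sum_Cauchy[OF assms(2,3)])
  show "mCauchy N (\<lambda>j. \<delta> (x j))"
    using lipschitz_tuple_Cauchy[OF bounded_tuple_lipschitz[OF assms(1)] x] by simp
  show "cclass N (\<lambda>j. \<delta> (x j)) = tuple_ext N \<delta> (\<lambda>i. cclass N (\<lambda>j. x j i))"
    using tuple_ext_cclass[OF assms(1) x] by simp
qed

lemma completion_bounded_tuple_hom:
  fixes \<delta> :: "('w::finite \<Rightarrow> 'm) \<Rightarrow> 'm"
  assumes \<delta>: "bounded_tuple_hom C N \<delta>"
  shows "bounded_tuple_hom C (mcompletion N) (tuple_ext N \<delta>)"
proof -
  have rep: "\<exists>x. (\<forall>i. mCauchy N (x i)) \<and> X = (\<lambda>i. cclass N (x i))"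
    if "\<forall>i. X i \<in> mcarrier (mcompletion N)" for X :: "'w \<Rightarrow> (nat \<Rightarrow> 'm) set"
    using that unfolding completion_carrier by (metis (no_types))
  have h: "\<delta> (\<lambda>i. madd N (x i) (y i)) = madd N (\<delta> x) (\<delta> y)" "\<delta> (\<lambda>i. mact N r (x i)) = mact N r (\<delta> x)"
    "mnorm N (\<delta> x) \<le> C * (\<Sum>i\<in>UNIV. mnorm N (x i))"
    if "\<forall>i. x i \<in> mcarrier N" "\<forall>i. y i \<in> mcarrier N" for x y r
    using \<delta> that unfolding bounded_tuple_hom_def mod_hom_direct_sum by auto
  note Cau = lipschitz_tuple_Cauchy[OF bounded_tuple_lipschitz[OF \<delta>]]
  note E = tuple_ext_cclass[OF \<delta>]
  show ?thesis
    unfolding bounded_tuple_hom_def mod_hom_direct_sum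
  proof (intro conjI allI impI)
    fix X :: "'w \<Rightarrow> (nat \<Rightarrow> 'm) set" assume X: "\<forall>i. X i \<in> mcarrier (mcompletion N)"
    obtain x where x: "\<And>i. mCauchy N (x i)" "X = (\<lambda>i. cclass N (x i))" using rep[OF X] by blast
    have Ex: "tuple_ext N \<delta> X = cclass N (\<lambda>j. \<delta> (\<lambda>i. x i j))"
      using E[of x] x by simp
    show "tuple_ext N \<delta> X \<in> mcarrier (mcompletion N)"
      unfolding Ex using Cau[of x] x by simp
    have "(\<lambda>j. C * (\<Sum>i\<in>UNIV. mnorm N (x i j))) \<longlonglongrightarrow> C * (\<Sum>i\<in>UNIV. mnorm (mcompletion N) (X i))"
      unfolding x(2) by (intro tendsto_intros completion_norm x)
    moreover have "mnorm N (\<delta> (\<lambda>i. x i j)) \<le> C * (\<Sum>i\<in>UNIV. mnorm N (x i j))" for j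
      using x by (intro h(3)) auto
    ultimately show "mnorm (mcompletion N) (tuple_ext N \<delta> X) \<le> C * (\<Sum>i\<in>UNIV. mnorm (mcompletion N) (X i))"
      unfolding Ex by (intro LIMSEQ_le[OF completion_norm[OF Cau[of x, OF x(1)]]]) auto
    fix r
    show "tuple_ext N \<delta> (\<lambda>i. mact (mcompletion N) r (X i)) = mact (mcompletion N) r (tuple_ext N \<delta> X)"
    proof -
      have "tuple_ext N \<delta> (\<lambda>i. mact (mcompletion N) r (X i)) = cclass N (\<lambda>j. \<delta> (\<lambda>i. mact N r (x i j)))"
        using x(1) E[of "\<lambda>i j. mact N r (x i j)"] by (simp add: x(2) completion_act mCauchy_act)
      also have "(\<lambda>j. \<delta> (\<lambda>i. mact N r (x i j))) = (\<lambda>j. mact N r (\<delta> (\<lambda>i. x i j)))"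
        using x(1) by (intro ext h(2)) auto
      finally show ?thesis
        unfolding Ex using Cau[of x, OF x(1)] by (simp add: completion_act)
    qed
    fix Y :: "'w \<Rightarrow> (nat \<Rightarrow> 'm) set" assume Y: "\<forall>i. Y i \<in> mcarrier (mcompletion N)"
    obtain y where y: "\<And>i. mCauchy N (y i)" "Y = (\<lambda>i. cclass N (y i))" using rep[OF Y] by blast
    have Ey: "tuple_ext N \<delta> Y = cclass N (\<lambda>j. \<delta> (\<lambda>i. y i j))"
      using E[of y] y by simp
    show "tuple_ext N \<delta> (\<lambda>i. madd (mcompletion N) (X i) (Y i)) =
        madd (mcompletion N) (tuple_ext N \<delta> X) (tuple_ext N \<delta> Y)"
    proof -
      have "tuple_ext N \<delta> (\<lambda>i. madd (mcompletion N) (X i) (Y i)) =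
          cclass N (\<lambda>j. \<delta> (\<lambda>i. madd N (x i j) (y i j)))"
        using x(1) y(1) E[of "\<lambda>i j. madd N (x i j) (y i j)"]
        by (simp add: x(2) y(2) completion_add mCauchy_add)
      also have "(\<lambda>j. \<delta> (\<lambda>i. madd N (x i j) (y i j))) = (\<lambda>j. madd N (\<delta> (\<lambda>i. x i j)) (\<delta> (\<lambda>i. y i j)))"
        using x(1) y(1) by (intro ext h(1)) auto
      finally show ?thesis
        unfolding Ex Ey using Cau[of x, OF x(1)] Cau[of y, OF y(1)] by (simp add: completion_add)
    qed
  qed
qed

lemma tuple_ext_cembed:
  assumes "bounded_tuple_hom C N \<delta>" "\<And>i. x i \<in> mcarrier N"
  shows "tuple_ext N \<delta> (\<lambda>i. cembed N (x i)) = cembed N (\<delta> x)"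
  using tuple_ext_cclass[OF assms(1), of "\<lambda>i _. x i"] assms(2) by (simp add: cembed_def)

end

text \<open>Boundedness is a convenient sufficient condition for compatibility with limits; it passes to the
  completion, and so settles both triples at once.\<close>

lemma N_objI:
  fixes D :: "('k::real_normed_field, 'l::ring_1, 'n::finite) integration_data"
  assumes "normed_left_module (tau D) N" "bounded_tuple_hom C N \<delta>" "v \<in> mcarrier N"
    and "mnorm N v \<le> lam_mass D" "\<delta> (\<lambda>_. v) = v"
    and "0 < measure (mu D) (base_ivl D) / lam_mass D" "0 < expo D"
  shows "N_obj D (N, v, \<delta>)"
proof -
  interpret normed_left_module "tau D" N by fact
  have "mod_hom (power_sum D N) N \<delta>"
    using assms(2) by (simp add: power_sum_def bounded_tuple_hom_def mod_hom_direct_sum)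
  moreover have "commutes_with_limits (power_sum D N) N \<delta>"
    unfolding power_sum_def using assms by (intro bounded_commutes_with_limits[OF assms(2)]) auto
  ultimately show ?thesis
    using assms normed by (simp add: N_obj_def)
qed

context two_modules
begin

lemma mod_hom_mdist:
  assumes "mod_hom N M T" "\<And>x. x \<in> mcarrier N \<Longrightarrow> mnorm M (T x) \<le> C * mnorm N x"
    and "x \<in> mcarrier N" "y \<in> mcarrier N"
  shows "mdist M (T x) (T y) \<le> C * mdist N x y"
proof -
  have "T (madd N x (mact N (- 1) y)) = madd M (T x) (mact M (- 1) (T y))"
    using assms(1,3,4) by (simp add: mod_hom_def)
  then show ?thesis using assms(2)[of "madd N x (mact N (- 1) y)"] assms(3,4) by (simp add: mdist_def)
qed

lemma contraction_mcontinuous: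
  assumes "mod_hom N M T" "\<And>x. x \<in> mcarrier N \<Longrightarrow> mnorm M (T x) \<le> mnorm N x"
  shows "mcontinuous N M T"
  unfolding mcontinuous_def
proof (intro ballI allI impI)
  fix x e assume x: "x \<in> mcarrier N" and e: "(0::real) < e"
  have "mdist M (T x) (T y) \<le> mdist N x y" if "y \<in> mcarrier N" for y
    using mod_hom_mdist[OF assms(1), of 1] assms(2) x that by simp
  then show "\<exists>d>0. \<forall>y\<in>mcarrier N. mdist N x y < d \<longrightarrow> mdist M (T x) (T y) < e"
    using e by (meson le_less_trans)
qed

lemma mcontinuous_eq_on_dense:
  assumes "mcontinuous N M g" "mcontinuous N M h"
    and "\<And>x. x \<in> mcarrier N \<Longrightarrow> g x \<in> mcarrier M" "\<And>x. x \<in> mcarrier N \<Longrightarrow> h x \<in> mcarrier M"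
    and "B \<subseteq> mcarrier N" "\<And>x. x \<in> B \<Longrightarrow> g x = h x"
    and "\<And>e. 0 < e \<Longrightarrow> \<exists>y\<in>B. mdist N x y < e" and "x \<in> mcarrier N"
  shows "g x = h x"
proof (rule ccontr)
  assume "g x \<noteq> h x"
  then have e: "0 < mdist M (g x) (h x) / 2"
    using M.mdist_eq_0[of "g x" "h x"] M.mdist_nonneg[of "g x" "h x"] assms(3,4)[OF assms(8)] by (simp add: less_le)
  obtain d d' where d: "0 < d" "\<And>y. y \<in> mcarrier N \<Longrightarrow> mdist N x y < d \<Longrightarrow> mdist M (g x) (g y) < mdist M (g x) (h x) / 2"
    and d': "0 < d'" "\<And>y. y \<in> mcarrier N \<Longrightarrow> mdist N x y < d' \<Longrightarrow> mdist M (h x) (h y) < mdist M (g x) (h x) / 2"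
    using bspec[OF assms(1)[unfolded mcontinuous_def] assms(8)]
      bspec[OF assms(2)[unfolded mcontinuous_def] assms(8)] e by metis
  obtain y where y: "y \<in> B" "mdist N x y < min d d'" using assms(7)[of "min d d'"] d(1) d'(1) by auto
  then have yN: "y \<in> mcarrier N" using assms(5) by blast
  have "mdist M (g x) (h x) \<le> mdist M (g x) (g y) + mdist M (h x) (h y)"
    using M.mdist_triangle[of "g x" "g y" "h x"] M.mdist_commute[of "h x" "h y"] assms(6)[OF y(1)]
      assms(3,4)[OF assms(8)] assms(3,4)[OF yN] by simp
  then show False using d(2)[OF yN] d'(2)[OF yN] y by simp
qed

text \<open>The value at the class of \<open>x\<close> is the limit of the values along \<open>x\<close>. Equivalent sequences have values
  at vanishing distance, hence the same limit, and every algebraic identity passes to the limit.\<close>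

lemma extend_contraction:
  assumes T: "mod_hom N M T" and bd: "\<And>x. x \<in> mcarrier N \<Longrightarrow> mnorm M (T x) \<le> mnorm N x"
    and complete: "\<And>y. mCauchy M y \<Longrightarrow> \<exists>L\<in>mcarrier M. (\<lambda>j. mdist M (y j) L) \<longlonglongrightarrow> 0"
  obtains That where "That \<in> extensional (mcarrier (mcompletion N))"
    "mod_hom (mcompletion N) M That"
    "\<And>X. X \<in> mcarrier (mcompletion N) \<Longrightarrow> mnorm M (That X) \<le> mnorm (mcompletion N) X"
    "\<And>x. mCauchy N x \<Longrightarrow> (\<lambda>j. mdist M (T (x j)) (That (cclass N x))) \<longlonglongrightarrow> 0"
proof -
  have Tc: "x \<in> mcarrier N \<Longrightarrow> T x \<in> mcarrier M" for x using T by (simp add: mod_hom_def)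
  have lip: "lipschitz_tuple 1 (\<lambda>x::unit \<Rightarrow> 'm. T (x ()))"
    using mod_hom_mdist[OF T, of 1] bd Tc by (auto simp: lipschitz_tuple_def UNIV_unit)
  note Cau = lipschitz_tuple_image_single(1)[OF lip]
  have "\<exists>L. L \<in> mcarrier M \<and> (\<forall>x. mCauchy N x \<and> X = cclass N x \<longrightarrow> (\<lambda>j. mdist M (T (x j)) L) \<longlonglongrightarrow> 0)"
    if "X \<in> mcarrier (mcompletion N)" for X
  proof -
    obtain x where x: "mCauchy N x" "X = cclass N x" using \<open>X \<in> _\<close> by (rule N.completion_carrierE)
    obtain L where L: "L \<in> mcarrier M" "(\<lambda>j. mdist M (T (x j)) L) \<longlonglongrightarrow> 0"
      using complete[OF Cau[OF x(1)]] by blast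
    have "(\<lambda>j. mdist M (T (y j)) L) \<longlonglongrightarrow> 0" if y: "mCauchy N y" "X = cclass N y" for y
    proof (rule M.null_dist_trans[OF _ _ _ _ L(2)])
      show "(\<lambda>j. mdist M (T (y j)) (T (x j))) \<longlonglongrightarrow> 0"
        using lipschitz_tuple_null[OF lip, of "\<lambda>j _. y j" "\<lambda>j _. x j"] x y by (simp add: N.cclass_eq_iff)
    qed (use x y Tc L in auto)
    then show ?thesis using L by blast
  qed
  then obtain S where S: "\<And>X. X \<in> mcarrier (mcompletion N) \<Longrightarrow> S X \<in> mcarrier M"
    and lim: "\<And>x. mCauchy N x \<Longrightarrow> (\<lambda>j. mdist M (T (x j)) (S (cclass N x))) \<longlonglongrightarrow> 0"
    using N.cclass_closed by metis
  have unique: "S (cclass N x) = L"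
    if "mCauchy N x" "L \<in> mcarrier M" "(\<lambda>j. mdist M (T (x j)) L) \<longlonglongrightarrow> 0" for x L
  proof -
    have SX: "S (cclass N x) \<in> mcarrier M" using S that by simp
    have "(\<lambda>j. mdist M (S (cclass N x)) (T (x j))) \<longlonglongrightarrow> 0"
      using lim[OF that(1)] SX Tc that by (simp add: M.mdist_commute)
    then have "(\<lambda>j::nat. mdist M (S (cclass N x)) L) \<longlonglongrightarrow> 0"
      using that(3) by (rule M.null_dist_trans[rotated -2]) (use SX that Tc in auto)
    then show ?thesis using SX that by (simp add: LIMSEQ_const_iff M.mdist_eq_0)
  qed
  show thesis
  proof
    show "restrict S (mcarrier (mcompletion N)) \<in> extensional (mcarrier (mcompletion N))" by simp
    show "(\<lambda>j. mdist M (T (x j)) (restrict S (mcarrier (mcompletion N)) (cclass N x))) \<longlonglongrightarrow> 0"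
      if "mCauchy N x" for x using lim that by simp
    have "S (mact (mcompletion N) r X) = mact M r (S X)" if "X \<in> mcarrier (mcompletion N)" for r X
    proof -
      obtain x where x: "mCauchy N x" "X = cclass N x" using \<open>X \<in> _\<close> by (rule N.completion_carrierE)
      have "(\<lambda>j. norm (t r) * mdist M (T (x j)) (S X)) \<longlonglongrightarrow> norm (t r) * 0"
        using lim[OF x(1)] x(2) by (intro tendsto_intros) simp
      moreover have "T (mact N r (x j)) = mact M r (T (x j))" for j
        using T x by (simp add: mod_hom_def)
      ultimately have "(\<lambda>j. mdist M (T (mact N r (x j))) (mact M r (S X))) \<longlonglongrightarrow> 0"
        using x Tc S by (simp add: M.mdist_act)
      then show ?thesis
        using unique[OF N.mCauchy_act[OF x(1)]] x S by (simp add: N.completion_act)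
    qed
    moreover have "S (madd (mcompletion N) X Y) = madd M (S X) (S Y)"
      if "X \<in> mcarrier (mcompletion N)" "Y \<in> mcarrier (mcompletion N)" for X Y
    proof -
      obtain x where x: "mCauchy N x" "X = cclass N x" using \<open>X \<in> _\<close> by (rule N.completion_carrierE)
      obtain y where y: "mCauchy N y" "Y = cclass N y" using \<open>Y \<in> _\<close> by (rule N.completion_carrierE)
      have eq: "T (madd N (x j) (y j)) = madd M (T (x j)) (T (y j))" for j
        using T x y by (simp add: mod_hom_def)
      have lim0: "(\<lambda>j. mdist M (T (x j)) (S X) + mdist M (T (y j)) (S Y)) \<longlonglongrightarrow> 0"
        using tendsto_add[OF lim[OF x(1)] lim[OF y(1)]] x y by simp
      have "(\<lambda>j. mdist M (T (madd N (x j) (y j))) (madd M (S X) (S Y))) \<longlonglongrightarrow> 0"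
        using x y Tc S unfolding eq
        by (intro tendsto_sandwich[OF _ _ tendsto_const lim0]) (auto intro!: always_eventually M.mdist_add)
      then show ?thesis
        using unique[OF N.mCauchy_add[OF x(1) y(1)]] x y S by (simp add: N.completion_add)
    qed
    ultimately show "mod_hom (mcompletion N) M (restrict S (mcarrier (mcompletion N)))"
      using S normed_left_module.act_closed[OF N.completion_normed_left_module]
        normed_left_module.add_closed[OF N.completion_normed_left_module]
      by (simp add: mod_hom_def)
    show "mnorm M (restrict S (mcarrier (mcompletion N)) X) \<le> mnorm (mcompletion N) X"
      if "X \<in> mcarrier (mcompletion N)" for X
    proof -
      obtain x where x: "mCauchy N x" "X = cclass N x" using \<open>X \<in> _\<close> by (rule N.completion_carrierE)
      have SX: "S X \<in> mcarrier M" using S that by simp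
      have "(\<lambda>j. mnorm N (x j) + mdist M (T (x j)) (S X)) \<longlonglongrightarrow> mnorm (mcompletion N) X"
        using tendsto_add[OF N.completion_norm[OF x(1)] lim[OF x(1)]] x by simp
      moreover have "mnorm M (S X) \<le> mnorm N (x j) + mdist M (T (x j)) (S X)" for j
        using M.abs_norm_diff_le[of "T (x j)" "S X"] bd[of "x j"] SX Tc x by simp
      ultimately have "mnorm M (S X) \<le> mnorm (mcompletion N) X"
        by (intro LIMSEQ_le_const) auto
      then show ?thesis using that by simp
    qed
  qed
qed

end

section \<open>Intervals, grids and grid functions\<close>

text \<open>Every interval is the intersection of an up-set and a down-set, and the up-sets (as well as the
  down-sets) bounded by single points form a chain. All case distinctions about open, closed and
  half-open ends reduce to these two facts. The flag is true if the end point belongs to the ray.\<close>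

definition up :: "('k, 'l, 'n) integration_data \<Rightarrow> bool \<Rightarrow> 'k \<Rightarrow> 'k set" where
  "up D s c = {x. if s then leq D c x else lt D c x}"

definition dn :: "('k, 'l, 'n) integration_data \<Rightarrow> bool \<Rightarrow> 'k \<Rightarrow> 'k set" where
  "dn D s c = {x. if s then leq D x c else lt D x c}"

text \<open>In contrast to \<^term>\<open>sub_ivls\<close>, the ends may coincide or come in the wrong order. This makes the
  family closed under intersection, at the price of including null sets.\<close>

definition pieces :: "('k, 'l, 'n) integration_data \<Rightarrow> 'k set set" where
  "pieces D = {up D s c \<inter> dn D t d | s t c d. c \<in> base_ivl D \<and> d \<in> base_ivl D}"

definition same_cell :: "'k set set \<Rightarrow> ('n \<Rightarrow> 'k) \<Rightarrow> ('n \<Rightarrow> 'k) \<Rightarrow> bool" where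
  "same_cell Q x y \<longleftrightarrow> (\<forall>i. \<forall>q\<in>Q. x i \<in> q \<longleftrightarrow> y i \<in> q)"

text \<open>Grid functions: those that cannot separate points lying in the same members of some finite family of
  intervals. The family need not be disjoint, which makes stability under arbitrary pointwise
  operations immediate. They are the elementary simple functions, up to null sets.\<close>

definition gridded :: "('k, 'l, 'n) integration_data \<Rightarrow> (('n \<Rightarrow> 'k) \<Rightarrow> 'z) \<Rightarrow> bool" where
  "gridded D f \<longleftrightarrow> (\<exists>Q. finite Q \<and> Q \<subseteq> pieces D \<and>
     (\<forall>x\<in>lam_ivl D. \<forall>y\<in>lam_ivl D. same_cell Q x y \<longrightarrow> f x = f y))"

definition ivl_partition :: "('k, 'l, 'n) integration_data \<Rightarrow> 'k set set \<Rightarrow> bool" where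
  "ivl_partition D P \<longleftrightarrow> finite P \<and> P \<subseteq> pieces D \<and> \<Union> P = base_ivl D \<and>
     (\<forall>p\<in>P. \<forall>q\<in>P. \<forall>x. x \<in> p \<longrightarrow> x \<in> q \<longrightarrow> p = q)"

definition resolves :: "'k set set \<Rightarrow> 'k set \<Rightarrow> bool" where
  "resolves P A \<longleftrightarrow> (\<forall>p\<in>P. p \<subseteq> A \<or> p \<inter> A = {})"

definition cells :: "'k set set \<Rightarrow> ('n \<Rightarrow> 'k set) set" where
  "cells P = {v. \<forall>i. v i \<in> P}"

text \<open>Linear combinations of indicator functions of boxes, indexed so that the same box may occur more
  than once. Elementary functions, step functions, expansions along a grid and juxtapositions of these
  are all of this form.\<close>

definition boxsum ::
  "'i set \<Rightarrow> ('i \<Rightarrow> 'n \<Rightarrow> 'k set) \<Rightarrow> ('i \<Rightarrow> 'z::real_normed_field) \<Rightarrow> ('n \<Rightarrow> 'k) \<Rightarrow> 'z" where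
  "boxsum A J c x = (\<Sum>a\<in>A. c a * indicator (Pi UNIV (J a)) x)"

lemma gridded_compose2:
  fixes D :: "('k, 'l, 'n) integration_data"
  assumes "gridded D f" "gridded D g"
  shows "gridded D (\<lambda>x. h (f x) (g x))"
proof -
  obtain Q where Q: "finite Q" "Q \<subseteq> pieces D"
    "\<forall>x\<in>lam_ivl D. \<forall>y\<in>lam_ivl D. same_cell Q x y \<longrightarrow> f x = f y"
    using assms(1) unfolding gridded_def by blast
  obtain R where R: "finite R" "R \<subseteq> pieces D"
    "\<forall>x\<in>lam_ivl D. \<forall>y\<in>lam_ivl D. same_cell R x y \<longrightarrow> g x = g y"
    using assms(2) unfolding gridded_def by blast
  have "same_cell Q x y \<and> same_cell R x y" if "same_cell (Q \<union> R) x y" for x y :: "'n \<Rightarrow> 'k"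
    using that by (auto simp: same_cell_def)
  then have "\<forall>x\<in>lam_ivl D. \<forall>y\<in>lam_ivl D. same_cell (Q \<union> R) x y \<longrightarrow> h (f x) (g x) = h (f y) (g y)"
    using Q(3) R(3) by metis
  then show ?thesis
    unfolding gridded_def using Q(1,2) R(1,2) by (intro exI[of _ "Q \<union> R"]) simp
qed

lemma gridded_const: "gridded D (\<lambda>_. c)"
  unfolding gridded_def by (intro exI[of _ "{}"]) simp

lemma gridded_compose1: "gridded D f \<Longrightarrow> gridded D (\<lambda>x. h (f x))"
  by (rule gridded_compose2[of D f f "\<lambda>a _. h a"])

lemma gridded_boxsum:
  fixes D :: "('k, 'l, 'n::finite) integration_data"
  assumes "finite A" "\<And>a i. a \<in> A \<Longrightarrow> J a i \<in> pieces D"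
  shows "gridded D (boxsum A J c)"
  unfolding gridded_def
proof (intro exI[of _ "\<Union>a\<in>A. range (J a)"] conjI ballI impI)
  fix x y :: "'n \<Rightarrow> 'k" assume *: "same_cell (\<Union>a\<in>A. range (J a)) x y"
  have "x \<in> Pi UNIV (J a) \<longleftrightarrow> y \<in> Pi UNIV (J a)" if "a \<in> A" for a
    using * that by (auto simp: same_cell_def Pi_iff)
  then show "boxsum A J c x = boxsum A J c y"
    unfolding boxsum_def by (intro sum.cong) (auto simp: indicator_def)
qed (use assms in auto)

locale integration =
  fixes D :: "('k::real_normed_field, 'l::ring_1, 'n::finite) integration_data"
  assumes algebra: "algebra_data D"
    and interval: "interval_data D"
    and order_extends: "order_extends_real D"
    and measure: "measure_data D"
    and expo_ge_1: "1 \<le> expo D"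
    and mass_pos: "0 < measure (mu D) (base_ivl D)"
    and self_sim: "self_similar D"
    and exhausts: "E_exhausts D"
    and norm_well_def: "1 < expo D \<Longrightarrow> norm_well_defined D"
begin

lemma leq_refl [simp]: "leq D x x"
  and leq_trans [trans]: "leq D x y \<Longrightarrow> leq D y z \<Longrightarrow> leq D x z"
  and leq_antisym: "leq D x y \<Longrightarrow> leq D y x \<Longrightarrow> x = y"
  and leq_total: "leq D x y \<or> leq D y x"
proof -
  have "linear_order {(x, y). leq D x y}" using interval by (simp add: interval_data_def)
  then have *: "refl {(x, y). leq D x y}" "trans {(x, y). leq D x y}" "antisym {(x, y). leq D x y}"
    "total {(x, y). leq D x y}"
    by (auto simp: linear_order_on_def partial_order_on_def preorder_on_def)
  show r: "leq D x x" for x using *(1) by (auto simp: refl_on_def)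
  show "leq D x y \<Longrightarrow> leq D y z \<Longrightarrow> leq D x z" using *(2) unfolding trans_def by blast
  show "leq D x y \<Longrightarrow> leq D y x \<Longrightarrow> x = y" using *(3) unfolding antisym_def by blast
  show "leq D x y \<or> leq D y x" using *(4) r by (cases "x = y") (auto simp: total_on_def)
qed

lemma leq_not: "\<not> leq D x y \<Longrightarrow> leq D y x"
  using leq_total by blast

lemma lt_iff: "lt D x y \<longleftrightarrow> \<not> leq D y x"
  using leq_antisym[of x y] leq_total[of x y] by (auto simp: lt_def)

lemma in_base: "x \<in> base_ivl D \<longleftrightarrow> leq D (lft D) x \<and> leq D x (rgt D)"
  by (simp add: base_ivl_def cc_ivl_def)

lemma lft_mid: "leq D (lft D) (mid D)" and mid_rgt: "leq D (mid D) (rgt D)"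
  using interval by (auto simp: interval_data_def lt_def)

lemma lft_in [simp]: "lft D \<in> base_ivl D" and mid_in [simp]: "mid D \<in> base_ivl D"
  and rgt_in [simp]: "rgt D \<in> base_ivl D"
  using lft_mid mid_rgt leq_trans[OF lft_mid mid_rgt] by (simp_all add: in_base)

lemma up_closed: "x \<in> up D s c \<Longrightarrow> leq D x y \<Longrightarrow> y \<in> up D s c"
  using leq_trans[of c x y] leq_trans[of x y c] by (cases s) (simp_all add: up_def lt_iff, blast)

lemma dn_closed: "x \<in> dn D s c \<Longrightarrow> leq D y x \<Longrightarrow> y \<in> dn D s c"
  using leq_trans[of y x c] leq_trans[of c y x] by (cases s) (simp_all add: dn_def lt_iff, blast)

lemma up_nested: "up D s c \<subseteq> up D s' c' \<or> up D s' c' \<subseteq> up D s c"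
proof (rule disjCI, rule subsetI, rule ccontr)
  fix x assume "\<not> up D s' c' \<subseteq> up D s c" and x: "x \<in> up D s c" "x \<notin> up D s' c'"
  then obtain y where "y \<in> up D s' c'" "y \<notin> up D s c" by blast
  then show False using x up_closed leq_total[of x y] by blast
qed

lemma dn_nested: "dn D s c \<subseteq> dn D s' c' \<or> dn D s' c' \<subseteq> dn D s c"
proof (rule disjCI, rule subsetI, rule ccontr)
  fix x assume "\<not> dn D s' c' \<subseteq> dn D s c" and x: "x \<in> dn D s c" "x \<notin> dn D s' c'"
  then obtain y where "y \<in> dn D s' c'" "y \<notin> dn D s c" by blast
  then show False using x dn_closed leq_total[of x y] by blast
qed

lemma piecesI: "c \<in> base_ivl D \<Longrightarrow> d \<in> base_ivl D \<Longrightarrow> up D s c \<inter> dn D t d \<in> pieces D"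
  unfolding pieces_def by blast

lemma piecesE:
  assumes "A \<in> pieces D"
  obtains s t c d where "c \<in> base_ivl D" "d \<in> base_ivl D" "A = up D s c \<inter> dn D t d"
  using assms unfolding pieces_def by blast

lemma pieces_Int:
  assumes "A \<in> pieces D" "B \<in> pieces D" shows "A \<inter> B \<in> pieces D"
proof -
  obtain s t c d where A: "c \<in> base_ivl D" "d \<in> base_ivl D" "A = up D s c \<inter> dn D t d"
    using assms(1) by (rule piecesE)
  obtain s' t' c' d' where B: "c' \<in> base_ivl D" "d' \<in> base_ivl D" "B = up D s' c' \<inter> dn D t' d'"
    using assms(2) by (rule piecesE)
  have "\<exists>s'' c''. c'' \<in> base_ivl D \<and> up D s c \<inter> up D s' c' = up D s'' c''"
    using up_nested[of s c s' c'] A B by (metis inf.absorb1 inf.absorb2)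
  moreover have "\<exists>t'' d''. d'' \<in> base_ivl D \<and> dn D t d \<inter> dn D t' d' = dn D t'' d''"
    using dn_nested[of t d t' d'] A B by (metis inf.absorb1 inf.absorb2)
  moreover have "A \<inter> B = (up D s c \<inter> up D s' c') \<inter> (dn D t d \<inter> dn D t' d')"
    using A B by blast
  ultimately show ?thesis using piecesI by metis
qed

lemma base_eq: "base_ivl D = up D True (lft D) \<inter> dn D True (rgt D)"
  by (auto simp: in_base up_def dn_def)

lemma base_piece: "base_ivl D \<in> pieces D"
  unfolding base_eq by (rule piecesI) simp_all

lemma piece_subset: "A \<in> pieces D \<Longrightarrow> A \<subseteq> base_ivl D"
proof (erule piecesE)
  fix s t c d assume "c \<in> base_ivl D" "d \<in> base_ivl D" "A = up D s c \<inter> dn D t d"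
  then show "A \<subseteq> base_ivl D"
    using leq_trans[of "lft D" c] leq_trans[of _ d "rgt D"]
    by (auto simp: in_base up_def dn_def lt_def split: if_splits)
qed

lemma up_cut:
  assumes "c \<in> base_ivl D"
  shows "base_ivl D \<inter> up D s c \<in> pieces D" "base_ivl D - up D s c \<in> pieces D"
proof -
  have "base_ivl D \<inter> up D s c = up D s c \<inter> dn D True (rgt D)"
    using assms leq_trans[of "lft D" c] by (auto simp: in_base up_def dn_def lt_def split: if_splits)
  then show "base_ivl D \<inter> up D s c \<in> pieces D" using piecesI assms by simp
  have "base_ivl D - up D s c = up D True (lft D) \<inter> dn D (\<not> s) c"
    using assms leq_not[of c] leq_trans[of _ c "rgt D"] unfolding up_def dn_def lt_iff
    by (cases s) (auto simp: in_base)
  then show "base_ivl D - up D s c \<in> pieces D" using piecesI assms by simp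
qed

lemma dn_cut:
  assumes "c \<in> base_ivl D"
  shows "base_ivl D \<inter> dn D s c \<in> pieces D" "base_ivl D - dn D s c \<in> pieces D"
proof -
  have "base_ivl D \<inter> dn D s c = up D True (lft D) \<inter> dn D s c"
    using assms leq_trans[of _ c "rgt D"] by (auto simp: in_base up_def dn_def lt_def split: if_splits)
  then show "base_ivl D \<inter> dn D s c \<in> pieces D" using piecesI assms by simp
  have "base_ivl D - dn D s c = up D (\<not> s) c \<inter> dn D True (rgt D)"
    using assms leq_not[of _ c] leq_trans[of "lft D" c] unfolding up_def dn_def lt_iff
    by (cases s) (auto simp: in_base)
  then show "base_ivl D - dn D s c \<in> pieces D" using piecesI assms by simp
qed

text \<open>One step of refinement, used with \<open>A\<close> a ray. What has been resolved stays resolved, so the rays bounding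
  finitely many intervals can be treated one after the other.\<close>

lemma split_partition:
  assumes P: "ivl_partition D P" and A: "base_ivl D \<inter> A \<in> pieces D" "base_ivl D - A \<in> pieces D"
  shows "\<exists>P'. ivl_partition D P' \<and> resolves P' A \<and> (\<forall>B. resolves P B \<longrightarrow> resolves P' B)"
proof (intro exI[of _ "(\<lambda>p. p \<inter> A) ` P \<union> (\<lambda>p. p - A) ` P"] conjI)
  have sub: "p \<subseteq> base_ivl D" if "p \<in> P" for p using P that by (auto simp: ivl_partition_def)
  have 1: "p \<inter> A \<in> pieces D" "p - A \<in> pieces D" if "p \<in> P" for p
  proof -
    have "p \<inter> A = p \<inter> (base_ivl D \<inter> A)" "p - A = p \<inter> (base_ivl D - A)" using sub[OF that] by auto
    then show "p \<inter> A \<in> pieces D" "p - A \<in> pieces D"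
      using pieces_Int A P that by (auto simp: ivl_partition_def)
  qed
  have 2: "p = q" if "p \<in> P" "q \<in> P" "x \<in> p" "x \<in> q" for p q x
    using P that unfolding ivl_partition_def by metis
  show "ivl_partition D ((\<lambda>p. p \<inter> A) ` P \<union> (\<lambda>p. p - A) ` P)"
    unfolding ivl_partition_def
  proof (intro conjI ballI allI impI)
    show "finite ((\<lambda>p. p \<inter> A) ` P \<union> (\<lambda>p. p - A) ` P)" using P by (simp add: ivl_partition_def)
    show "(\<lambda>p. p \<inter> A) ` P \<union> (\<lambda>p. p - A) ` P \<subseteq> pieces D" using 1 by blast
    show "p = q" if "p \<in> (\<lambda>p. p \<inter> A) ` P \<union> (\<lambda>p. p - A) ` P" "q \<in> (\<lambda>p. p \<inter> A) ` P \<union> (\<lambda>p. p - A) ` P"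
      "x \<in> p" "x \<in> q" for p q x
    proof -
      obtain p' q' where "p' \<in> P" "q' \<in> P" "p = p' \<inter> A \<or> p = p' - A" "q = q' \<inter> A \<or> q = q' - A"
        using \<open>p \<in> _\<close> \<open>q \<in> _\<close> by blast
      moreover from this have "p' = q'" using 2[of p' q' x] \<open>x \<in> p\<close> \<open>x \<in> q\<close> by blast
      ultimately show ?thesis using \<open>x \<in> p\<close> \<open>x \<in> q\<close> by blast
    qed
    show "\<Union> ((\<lambda>p. p \<inter> A) ` P \<union> (\<lambda>p. p - A) ` P) = base_ivl D"
    proof -
      have "\<Union> ((\<lambda>p. p \<inter> A) ` P \<union> (\<lambda>p. p - A) ` P) = \<Union> P" by auto
      then show ?thesis using P by (simp add: ivl_partition_def)
    qed
  qed
  show "resolves ((\<lambda>p. p \<inter> A) ` P \<union> (\<lambda>p. p - A) ` P) A"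
    by (auto simp: resolves_def)
  show "\<forall>B. resolves P B \<longrightarrow> resolves ((\<lambda>p. p \<inter> A) ` P \<union> (\<lambda>p. p - A) ` P) B"
  proof (intro allI impI)
    fix B assume B: "resolves P B"
    have "p \<inter> A \<subseteq> B \<or> p \<inter> A \<inter> B = {}" "p - A \<subseteq> B \<or> (p - A) \<inter> B = {}" if "p \<in> P" for p
      using B that unfolding resolves_def by auto
    then show "resolves ((\<lambda>p. p \<inter> A) ` P \<union> (\<lambda>p. p - A) ` P) B"
      unfolding resolves_def by blast
  qed
qed

lemma ex_resolving_partition:
  assumes "finite Q" "Q \<subseteq> pieces D"
  shows "\<exists>P. ivl_partition D P \<and> (\<forall>q\<in>Q. resolves P q)"
  using assms
proof (induction Q)
  case empty
  have "ivl_partition D {base_ivl D}" using base_piece by (simp add: ivl_partition_def)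
  then show ?case by auto
next
  case (insert q Q)
  then obtain P where P: "ivl_partition D P" "\<forall>q\<in>Q. resolves P q" by auto
  have "q \<in> pieces D" using insert.prems by simp
  obtain s t c d where q: "c \<in> base_ivl D" "d \<in> base_ivl D" "q = up D s c \<inter> dn D t d"
    using \<open>q \<in> pieces D\<close> by (rule piecesE)
  obtain P' where P': "ivl_partition D P'" "resolves P' (up D s c)" "\<forall>B. resolves P B \<longrightarrow> resolves P' B"
    using split_partition[OF P(1) up_cut[OF q(1)]] by blast
  obtain P'' where P'': "ivl_partition D P''" "resolves P'' (dn D t d)" "\<forall>B. resolves P' B \<longrightarrow> resolves P'' B"
    using split_partition[OF P'(1) dn_cut[OF q(2)]] by blast
  have "resolves P'' q"
    using P''(2) P''(3)[rule_format, OF P'(2)] unfolding q(3) resolves_def by blast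
  then show ?case using P P' P'' by blast
qed

lemma finite_cells:
  assumes "ivl_partition D P" shows "finite (cells P :: ('n \<Rightarrow> 'k set) set)"
proof -
  have "cells P = (PiE UNIV (\<lambda>_. P) :: ('n \<Rightarrow> 'k set) set)" by (auto simp: cells_def)
  then show ?thesis using assms by (simp add: ivl_partition_def finite_PiE)
qed

lemma cell_pieces: "ivl_partition D P \<Longrightarrow> v \<in> cells P \<Longrightarrow> v i \<in> pieces D"
  by (auto simp: ivl_partition_def cells_def)

lemma box_subset: "(\<And>i. v i \<in> pieces D) \<Longrightarrow> Pi UNIV v \<subseteq> lam_ivl D"
  using piece_subset by (fastforce simp: lam_ivl_def Pi_iff)

lemma ex_cell:
  assumes "ivl_partition D P" "x \<in> lam_ivl D" shows "\<exists>v\<in>cells P. x \<in> Pi UNIV v"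
proof -
  have "x i \<in> \<Union> P" for i using assms by (auto simp: ivl_partition_def lam_ivl_def)
  then have "\<exists>p. p \<in> P \<and> x i \<in> p" for i by blast
  then obtain v where "\<And>i. v i \<in> P \<and> x i \<in> v i" by metis
  then show ?thesis by (intro bexI[of _ v]) (auto simp: cells_def)
qed

lemma cell_unique:
  assumes "ivl_partition D P" "v \<in> cells P" "w \<in> cells P" "x \<in> Pi UNIV v" "x \<in> Pi UNIV w" shows "v = w"
proof
  fix i
  have "v i \<in> P" "w i \<in> P" "x i \<in> v i" "x i \<in> w i" using assms by (auto simp: cells_def)
  then show "v i = w i" using assms(1) unfolding ivl_partition_def by metis
qed

lemma boxsum_cell:
  fixes v :: "'n \<Rightarrow> 'k set"
  assumes "ivl_partition D P" "v \<in> cells P" "x \<in> Pi UNIV v"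
  shows "boxsum (cells P) (\<lambda>v. v) c x = c v"
proof -
  have "boxsum (cells P) (\<lambda>v. v) c x = (\<Sum>w\<in>cells P. if w = v then c w else 0)"
    unfolding boxsum_def using cell_unique[OF assms(1)] assms by (intro sum.cong) (auto simp: indicator_def)
  then show ?thesis using finite_cells[OF assms(1)] assms by simp
qed

text \<open>Refine the family of intervals to a partition; a cell of the resulting grid is contained in or
  disjoint from the slab over each interval of the family, so the function is constant on it.\<close>

lemma gridded_expand:
  fixes f :: "('n \<Rightarrow> 'k) \<Rightarrow> 'z"
  assumes "gridded D f"
  obtains P c where "ivl_partition D P" "\<forall>v\<in>cells P. \<forall>x\<in>Pi UNIV v. f x = c v"
proof -
  obtain Q where Q: "finite Q" "Q \<subseteq> pieces D"
    "\<forall>x\<in>lam_ivl D. \<forall>y\<in>lam_ivl D. same_cell Q x y \<longrightarrow> f x = f y"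
    using assms unfolding gridded_def by blast
  obtain P where P: "ivl_partition D P" "\<forall>q\<in>Q. resolves P q"
    using ex_resolving_partition[OF Q(1,2)] by blast
  have "f x = f y" if "v \<in> cells P" "x \<in> Pi UNIV v" "y \<in> Pi UNIV v" for v x y
  proof (rule Q(3)[rule_format])
    show "x \<in> lam_ivl D" "y \<in> lam_ivl D" using box_subset cell_pieces[OF P(1) that(1)] that by blast+
    have "x i \<in> q \<longleftrightarrow> y i \<in> q" if "q \<in> Q" for i q
    proof -
      have "v i \<subseteq> q \<or> v i \<inter> q = {}"
        using P(2) that \<open>v \<in> cells P\<close> by (simp add: resolves_def cells_def)
      moreover have "x i \<in> v i" "y i \<in> v i" using \<open>x \<in> Pi UNIV v\<close> \<open>y \<in> Pi UNIV v\<close> by auto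
      ultimately show ?thesis by blast
    qed
    then show "same_cell Q x y" by (simp add: same_cell_def)
  qed
  then have "f x = f (SOME y. y \<in> Pi UNIV v)" if "v \<in> cells P" "x \<in> Pi UNIV v" for v x
    using that by (metis someI)
  then show thesis using that[OF P(1), of "\<lambda>v. f (SOME y. y \<in> Pi UNIV v)"] by blast
qed

lemma gridded_eq_boxsum:
  fixes f :: "('n \<Rightarrow> 'k) \<Rightarrow> 'z::real_normed_field"
  assumes "ivl_partition D P" "\<forall>v\<in>cells P. \<forall>x\<in>Pi UNIV v. f x = c v" "x \<in> lam_ivl D"
  shows "f x = boxsum (cells P) (\<lambda>v. v) c x"
proof -
  obtain v where "v \<in> cells P" "x \<in> Pi UNIV v" using ex_cell[OF assms(1,3)] by blast
  then show ?thesis using assms(2) by (simp add: boxsum_cell[OF assms(1)])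
qed

end

section \<open>Integration of grid functions\<close>

text \<open>If two terms are positive, each of them is strictly less than the sum \<open>s\<close>, and
  \<open>y\<^sup>p = y * y\<^sup>p\<^sup>-\<^sup>1 < y * s\<^sup>p\<^sup>-\<^sup>1\<close> makes the left-hand side too small.\<close>

lemma powr_sum_eq_imp_single:
  fixes y :: "'i \<Rightarrow> real"
  assumes "finite A" "1 < p" and nonneg: "\<And>a. a \<in> A \<Longrightarrow> 0 \<le> y a"
    and eq: "(\<Sum>a\<in>A. y a powr p) = (\<Sum>a\<in>A. y a) powr p"
    and "a \<in> A" "b \<in> A" "0 < y a" "0 < y b"
  shows "a = b"
proof (rule ccontr)
  assume "a \<noteq> b"
  define s where "s = (\<Sum>a\<in>A. y a)"
  have le: "y i \<le> s" if "i \<in> A" for i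
    unfolding s_def using that assms(1) nonneg by (intro member_le_sum) auto
  have "y a + y b \<le> s"
    using sum_mono2[of A "{a, b}" y] assms(1,5,6) nonneg \<open>a \<noteq> b\<close> unfolding s_def by simp
  then have lt: "y a < s" and s: "0 < s" using assms by simp_all
  have pow: "y i powr p = y i * y i powr (p - 1)" if "i \<in> A" for i
    using nonneg[OF that] assms(2) by (cases "y i = 0") (simp_all add: powr_diff)
  have "(\<Sum>i\<in>A. y i powr p) < (\<Sum>i\<in>A. y i * s powr (p - 1))"
  proof (rule sum_strict_mono_ex1)
    show "\<forall>i\<in>A. y i powr p \<le> y i * s powr (p - 1)"
      using pow nonneg le assms(2) by (auto intro!: mult_left_mono powr_mono2)
    show "\<exists>i\<in>A. y i powr p < y i * s powr (p - 1)"
      using pow[of a] assms lt by (intro bexI[of _ a]) (auto intro!: mult_strict_left_mono powr_less_mono2)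
  qed (rule assms)
  also have "\<dots> = s powr p"
    unfolding sum_distrib_right[symmetric] s_def[symmetric] using s by (simp add: powr_diff)
  finally show False using eq by (simp add: s_def)
qed

lemma powr_sum_single:
  fixes y :: "'i \<Rightarrow> real"
  assumes "finite A" "0 < p" "\<And>a. a \<in> A \<Longrightarrow> 0 \<le> y a"
    and single: "\<And>a b. a \<in> A \<Longrightarrow> b \<in> A \<Longrightarrow> 0 < y a \<Longrightarrow> 0 < y b \<Longrightarrow> a = b"
  shows "(\<Sum>a\<in>A. y a powr p) powr (1 / p) = (\<Sum>a\<in>A. y a)"
proof (cases "\<exists>a\<in>A. 0 < y a")
  case True
  then obtain a where a: "a \<in> A" "0 < y a" by blast
  have z: "y b = 0" if "b \<in> A - {a}" for b
    using single[OF a(1), of b] a(2) that assms(3)[of b] by force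
  have "(\<Sum>b\<in>A. y b powr p) = y a powr p" "(\<Sum>b\<in>A. y b) = y a"
    using sum.remove[OF assms(1) a(1), of "\<lambda>b. y b powr p"] sum.remove[OF assms(1) a(1), of y] z
    by simp_all
  then show ?thesis using a assms(2) by (simp add: powr_powr)
next
  case False
  then have "y a = 0" if "a \<in> A" for a using assms(3)[OF that] that by force
  then show ?thesis by simp
qed

context integration
begin

lemma space_mu [simp]: "space (mu D) = UNIV"
  and finite_mu: "finite_measure (mu D)"
  and point_null [simp]: "measure (mu D) {x} = 0"
  and sets_mu: "sets (mu D) = sigma_sets UNIV (\<Union>c d. ivls D c d)"
  using measure by (auto simp: measure_data_def)

interpretation mu: finite_measure "mu D" by (rule finite_mu)

interpretation product_sigma_finite "\<lambda>_::'n. mu D" by unfold_locales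

interpretation finite_product_sigma_finite "\<lambda>_::'n. mu D" UNIV by unfold_locales simp

lemma ivls_eq: "ivls D c d = {up D True c \<inter> dn D True d, up D True c \<inter> dn D False d,
    up D False c \<inter> dn D True d, up D False c \<inter> dn D False d}"
  by (simp add: ivls_def cc_ivl_def up_def dn_def Collect_conj_eq)

lemma up_dn_ivl: "up D s c \<inter> dn D t d \<in> ivls D c d"
  by (cases s; cases t) (simp_all add: ivls_eq)

lemma ivl_up_dn: "J \<in> ivls D c d \<Longrightarrow> \<exists>s t. J = up D s c \<inter> dn D t d"
  unfolding ivls_eq by (elim insertE emptyE) (rule exI, rule exI, assumption)+

lemma piece_measurable: "A \<in> pieces D \<Longrightarrow> A \<in> sets (mu D)"
proof (erule piecesE)
  fix s t c d assume "A = up D s c \<inter> dn D t d"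
  then have "A \<in> ivls D c d" by (simp only: up_dn_ivl)
  then show "A \<in> sets (mu D)"
    unfolding sets_mu by (intro sigma_sets.Basic) blast
qed

lemma sub_ivls_pieces: "J \<in> sub_ivls D \<Longrightarrow> J \<in> pieces D"
proof -
  assume "J \<in> sub_ivls D"
  then obtain c d where cd: "leq D (lft D) c" "lt D c d" "leq D d (rgt D)" "J \<in> ivls D c d"
    unfolding sub_ivls_def by blast
  then have "leq D c d" by (simp add: lt_def)
  then have "c \<in> base_ivl D" "d \<in> base_ivl D"
    using cd leq_trans[of c d "rgt D"] leq_trans[of "lft D" c d] by (simp_all add: in_base)
  then show ?thesis using ivl_up_dn[OF cd(4)] piecesI by blast
qed

text \<open>If the left end is not strictly below the right end, no two different points fit in between.\<close>

lemma degenerate_piece: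
  assumes "J \<in> pieces D" "J \<notin> sub_ivls D"
  obtains c where "J \<subseteq> {c}"
proof -
  obtain s t c d where J: "c \<in> base_ivl D" "d \<in> base_ivl D" "J = up D s c \<inter> dn D t d"
    using assms(1) by (rule piecesE)
  have "\<not> lt D c d"
  proof
    assume "lt D c d"
    then have "J \<in> sub_ivls D"
      unfolding sub_ivls_def using J up_dn_ivl[of s c t d] by (auto simp: in_base)
    then show False using assms(2) by blast
  qed
  then have dc: "leq D d c" by (simp add: lt_iff)
  have "x = c" if "x \<in> J" for x
  proof -
    have "leq D c x" "leq D x d" using that J(3) by (auto simp: up_def dn_def lt_def split: if_splits)
    then show ?thesis using leq_trans[OF _ dc] leq_antisym by blast
  qed
  then show thesis using that by blast
qed

lemma null_subset_point: "A \<subseteq> {c} \<Longrightarrow> measure (mu D) A = 0"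
  by (cases "A = {}") (auto dest!: subset_singletonD)

lemma degenerate_null:
  assumes "J \<in> pieces D" "J \<notin> sub_ivls D" shows "measure (mu D) J = 0"
proof -
  obtain c where "J \<subseteq> {c}" using assms by (rule degenerate_piece)
  then show ?thesis by (rule null_subset_point)
qed

lemma space_lam [simp]: "space (lam_mu D) = UNIV"
  by (simp add: lam_mu_def space_PiM)

lemma box_measurable: "(\<And>i. v i \<in> sets (mu D)) \<Longrightarrow> Pi UNIV v \<in> sets (lam_mu D)"
  using sets_PiM_I_finite[of UNIV v "\<lambda>_::'n. mu D"] by (simp add: lam_mu_def PiE_UNIV_domain)

lemma box_emeasure:
  fixes v :: "'n \<Rightarrow> 'k set"
  assumes "\<And>i. v i \<in> sets (mu D)"
  shows "emeasure (lam_mu D) (Pi UNIV v) = ennreal (\<Prod>i\<in>UNIV. measure (mu D) (v i))"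
  using measure_times[of v] assms
  by (simp add: lam_mu_def PiE_UNIV_domain mu.emeasure_eq_measure prod_ennreal)

lemma box_measure:
  fixes v :: "'n \<Rightarrow> 'k set"
  assumes "\<And>i. v i \<in> sets (mu D)"
  shows "measure (lam_mu D) (Pi UNIV v) = (\<Prod>i\<in>UNIV. measure (mu D) (v i))"
  using box_emeasure[OF assms] by (intro measure_eq_emeasure_eq_ennreal prod_nonneg) auto

lemma finite_lam: "finite_measure (lam_mu D)"
proof (rule finite_measureI)
  show "emeasure (lam_mu D) (space (lam_mu D)) \<noteq> \<infinity>"
    using box_emeasure[of "\<lambda>_. UNIV"] sets.top[of "mu D"] by simp
qed

lemma lam_ivl_measurable [simp]: "lam_ivl D \<in> sets (lam_mu D)"
  unfolding lam_ivl_def using box_measurable piece_measurable[OF base_piece] by simp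

lemma lam_mass_eq: "lam_mass D = measure (mu D) (base_ivl D) ^ CARD('n)"
  unfolding lam_ivl_def using box_measure[of "\<lambda>_. base_ivl D"] piece_measurable[OF base_piece] by simp

lemma lam_mass_pos: "0 < lam_mass D"
  using mass_pos by (simp add: lam_mass_eq)

text \<open>Functions matter on \<open>I\<^sub>\<Lambda>\<close> only: classes are taken modulo null sets of this restricted measure.\<close>

definition rho where "rho = restrict_space (lam_mu D) (lam_ivl D)"

lemma space_rho [simp]: "space rho = lam_ivl D"
  by (simp add: rho_def space_restrict_space)

lemma AE_rho: "(AE x in rho. P x) \<longleftrightarrow> (AE x in lam_mu D. x \<in> lam_ivl D \<longrightarrow> P x)"
  unfolding rho_def by (rule AE_restrict_space_iff) simp

lemma measure_rho: "A \<subseteq> lam_ivl D \<Longrightarrow> measure rho A = measure (lam_mu D) A"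
  unfolding rho_def by (rule measure_restrict_space) simp_all

lemma sets_rho: "A \<in> sets (lam_mu D) \<Longrightarrow> A \<subseteq> lam_ivl D \<Longrightarrow> A \<in> sets rho"
  unfolding rho_def by (simp add: sets_restrict_space_iff)

lemma finite_rho: "finite_measure rho"
  unfolding rho_def by (intro finite_measure_restrict_space finite_lam) simp

interpretation rho: finite_measure rho by (rule finite_rho)

lemma box_sets_rho: "(\<And>i. v i \<in> pieces D) \<Longrightarrow> Pi UNIV v \<in> sets rho"
  by (intro sets_rho box_measurable box_subset piece_measurable)

lemma gridded_simple:
  fixes f :: "('n \<Rightarrow> 'k) \<Rightarrow> 'z::real_vector"
  assumes "gridded D f" shows "Bochner_Integration.simple_bochner_integrable rho f"
proof
  obtain P c where P: "ivl_partition D P"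
    and c: "\<forall>v\<in>cells P. \<forall>x\<in>Pi UNIV v. f x = c v"
    by (rule gridded_expand[OF assms])
  show "simple_function rho f"
    unfolding simple_function_def
  proof (intro conjI ballI)
    have "f ` space rho \<subseteq> c ` cells P"
    proof
      fix y assume "y \<in> f ` space rho"
      then obtain x where "x \<in> lam_ivl D" "y = f x" by auto
      then show "y \<in> c ` cells P" using ex_cell[OF P, of x] c by blast
    qed
    then show "finite (f ` space rho)"
      using finite_cells[OF P] finite_surj by blast
    fix y
    have "f -` {y} \<inter> space rho = (\<Union>v\<in>{v \<in> cells P. c v = y}. Pi UNIV v)"
    proof (intro set_eqI iffI)
      fix x assume "x \<in> f -` {y} \<inter> space rho"
      then show "x \<in> (\<Union>v\<in>{v \<in> cells P. c v = y}. Pi UNIV v)" using ex_cell[OF P, of x] c by auto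
    next
      fix x assume "x \<in> (\<Union>v\<in>{v \<in> cells P. c v = y}. Pi UNIV v)"
      then obtain v where v: "v \<in> cells P" "c v = y" "x \<in> Pi UNIV v" by blast
      then show "x \<in> f -` {y} \<inter> space rho"
        using box_subset[of v] cell_pieces[OF P v(1)] c by auto
    qed
    then show "f -` {y} \<inter> space rho \<in> sets rho"
      using finite_cells[OF P] box_sets_rho[OF cell_pieces[OF P]] by (simp only:) (intro sets.finite_UN, auto)
  qed
  show "emeasure rho {x \<in> space rho. f x \<noteq> 0} \<noteq> \<infinity>" by simp
qed

text \<open>The values lie in a field that may fail to be separable. Integrals of simple functions only ask for
  a real vector space of values.\<close>

abbreviation integ :: "(('n \<Rightarrow> 'k) \<Rightarrow> 'z::real_vector) \<Rightarrow> 'z" where "integ f \<equiv> Bochner_Integration.simple_bochner_integral rho f"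

definition l1 :: "(('n \<Rightarrow> 'k) \<Rightarrow> 'k) \<Rightarrow> real" where "l1 f = integ (\<lambda>x. norm (f x))"

lemma integ_cong:
  assumes "\<And>x. x \<in> lam_ivl D \<Longrightarrow> f x = g x" shows "integ f = integ g"
proof -
  have "f ` lam_ivl D = g ` lam_ivl D" using assms by (rule image_cong[OF refl])
  moreover have "{x \<in> lam_ivl D. f x = y} = {x \<in> lam_ivl D. g x = y}" for y using assms by auto
  ultimately show ?thesis by (simp add: Bochner_Integration.simple_bochner_integral_def)
qed

lemma integ_add: "gridded D f \<Longrightarrow> gridded D g \<Longrightarrow> integ (\<lambda>x. f x + g x) = integ f + integ g"
  by (intro simple_bochner_integral_add gridded_simple)

lemma integ_diff: "gridded D f \<Longrightarrow> gridded D g \<Longrightarrow> integ (\<lambda>x. f x - g x) = integ f - integ g"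
  by (intro simple_bochner_integral_diff gridded_simple)

lemma integ_scale:
  fixes f :: "('n \<Rightarrow> 'k) \<Rightarrow> 'z::real_normed_field"
  shows "gridded D f \<Longrightarrow> integ (\<lambda>x. c * f x) = c * integ f"
  by (rule simple_bochner_integral_linear[OF _ gridded_simple])
    (simp_all add: bounded_linear.linear bounded_linear_mult_right)

lemma gridded_box:
  fixes v :: "'n \<Rightarrow> 'k set" and c :: "'z::real_normed_field"
  assumes "\<And>i. v i \<in> pieces D" shows "gridded D (\<lambda>x. c * indicator (Pi UNIV v) x)"
proof -
  have "gridded D (boxsum {()} (\<lambda>_. v) (\<lambda>_. c))" using assms by (intro gridded_boxsum) auto
  moreover have "boxsum {()} (\<lambda>_. v) (\<lambda>_. c) = (\<lambda>x. c * indicator (Pi UNIV v) x)"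
    unfolding boxsum_def by (intro ext) (simp only: sum.insert[OF finite.emptyI] empty_iff not_False_eq_True sum.empty add_0_right)
  ultimately show ?thesis by simp
qed

lemma boxsum_insert:
  "finite A \<Longrightarrow> a \<notin> A \<Longrightarrow>
    boxsum (insert a A) J c x = c a * indicator (Pi UNIV (J a)) x + boxsum A J c x"
  unfolding boxsum_def by (rule sum.insert)

lemma integ_box:
  fixes c :: "'z::real_normed_field"
  assumes "\<And>i. v i \<in> pieces D"
  shows "integ (\<lambda>x. c * indicator (Pi UNIV v) x) = of_real (measure (lam_mu D) (Pi UNIV v)) * c"
proof -
  let ?A = "Pi UNIV v"
  have ind: "Bochner_Integration.simple_bochner_integrable rho (indicator ?A :: ('n \<Rightarrow> 'k) \<Rightarrow> real)"
    using gridded_simple[OF gridded_box[OF assms, of 1]] by simp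
  have "integ (indicator ?A :: ('n \<Rightarrow> 'k) \<Rightarrow> real) = integral\<^sup>L rho (indicator ?A)"
    by (rule simple_bochner_integrable_eq_integral[OF ind])
  also have "\<dots> = measure (lam_mu D) ?A"
    using box_subset[of v, OF assms] by (simp add: measure_rho Int_absorb2)
  finally have "integ (indicator ?A :: ('n \<Rightarrow> 'k) \<Rightarrow> real) = measure (lam_mu D) ?A" .
  moreover have "integ (\<lambda>x. (\<lambda>r. r *\<^sub>R c) (indicator ?A x)) = (\<lambda>r. r *\<^sub>R c) (integ (indicator ?A))"
    by (rule simple_bochner_integral_linear[OF _ ind])
      (simp add: bounded_linear.linear bounded_linear_scaleR_left)
  moreover have "(\<lambda>x. c * indicator ?A x) = (\<lambda>x. indicator ?A x *\<^sub>R c)"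
    by (auto simp: indicator_def)
  ultimately show ?thesis by (simp add: scaleR_conv_of_real)
qed

lemma integ_boxsum:
  fixes c :: "'i \<Rightarrow> 'z::real_normed_field"
  assumes "finite A" "\<And>a i. a \<in> A \<Longrightarrow> J a i \<in> pieces D"
  shows "integ (boxsum A J c) = (\<Sum>a\<in>A. of_real (measure (lam_mu D) (Pi UNIV (J a))) * c a)"
  using assms
proof (induction A)
  case empty
  have "integ (\<lambda>x. 0 * (0::'z)) = 0 * integ (\<lambda>x. 0 :: 'z)" by (intro integ_scale gridded_const)
  then show ?case by (simp add: boxsum_def[abs_def])
next
  case (insert a A)
  have "integ (\<lambda>x. c a * indicator (Pi UNIV (J a)) x + boxsum A J c x) =
      integ (\<lambda>x. c a * indicator (Pi UNIV (J a)) x) + integ (boxsum A J c)"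
  proof (rule integ_add)
    show "gridded D (\<lambda>x. c a * indicator (Pi UNIV (J a)) x)"
      using insert.prems by (intro gridded_box) simp
    show "gridded D (boxsum A J c)" using insert by (intro gridded_boxsum) auto
  qed
  moreover have "boxsum (insert a A) J c = (\<lambda>x. c a * indicator (Pi UNIV (J a)) x + boxsum A J c x)"
    using insert.hyps by (intro ext boxsum_insert)
  ultimately show ?case using insert by (simp add: integ_box)
qed

lemma integ_real_integral:
  fixes f :: "('n \<Rightarrow> 'k) \<Rightarrow> real"
  assumes "gridded D f" shows "integ f = integral\<^sup>L rho f" "integrable rho f"
proof -
  note s = gridded_simple[OF assms]
  show "integ f = integral\<^sup>L rho f" by (rule simple_bochner_integrable_eq_integral[OF s])
  show "integrable rho f"
    by (rule integrable.intros[OF has_bochner_integral_simple_bochner_integrable[OF s]])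
qed

lemma integ_real_mono:
  fixes f g :: "('n \<Rightarrow> 'k) \<Rightarrow> real"
  assumes "gridded D f" "gridded D g" "\<And>x. x \<in> lam_ivl D \<Longrightarrow> f x \<le> g x"
  shows "integ f \<le> integ g"
  unfolding integ_real_integral(1)[OF assms(1)] integ_real_integral(1)[OF assms(2)]
  using integral_mono[OF integ_real_integral(2)[OF assms(1)] integ_real_integral(2)[OF assms(2)]]
    assms(3) by simp

lemma l1_nonneg [simp]: "0 \<le> l1 f"
  by (simp add: l1_def)

lemma norm_integ_le: "gridded D f \<Longrightarrow> norm (integ f) \<le> l1 f"
  unfolding l1_def by (intro simple_bochner_integral_norm_bound gridded_simple)

lemma l1_mono:
  assumes "gridded D f" "gridded D g" "\<And>x. x \<in> lam_ivl D \<Longrightarrow> norm (f x) \<le> norm (g x)"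
  shows "l1 f \<le> l1 g"
  unfolding l1_def
  by (rule integ_real_mono[OF gridded_compose1[OF assms(1), of norm] gridded_compose1[OF assms(2), of norm] assms(3)])

lemma l1_add:
  assumes "gridded D f" "gridded D g" shows "l1 (\<lambda>x. f x + g x) \<le> l1 f + l1 g"
  unfolding l1_def integ_add[OF gridded_compose1[OF assms(1)] gridded_compose1[OF assms(2)], symmetric]
  by (rule integ_real_mono[OF gridded_compose2[OF assms, of "\<lambda>a b. norm (a + b)"]
        gridded_compose2[OF assms, of "\<lambda>a b. norm a + norm b"] norm_triangle_ineq])

lemma l1_scale:
  assumes "gridded D f" shows "l1 (\<lambda>x. c * f x) = norm c * l1 f"
  unfolding l1_def norm_mult by (rule integ_scale[OF gridded_compose1[OF assms]])

lemma l1_eq_0_iff: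
  assumes "gridded D f" shows "l1 f = 0 \<longleftrightarrow> (AE x in rho. f x = 0)"
proof -
  have "l1 f = integral\<^sup>L rho (\<lambda>x. norm (f x))"
    unfolding l1_def by (rule integ_real_integral(1)[OF gridded_compose1[OF assms]])
  then show ?thesis
    using integral_nonneg_eq_0_iff_AE[OF integ_real_integral(2)[OF gridded_compose1[OF assms, of norm]]]
    by simp
qed

lemma l1_boxsum_le:
  assumes "finite A" "\<And>a i. a \<in> A \<Longrightarrow> J a i \<in> pieces D"
  shows "l1 (boxsum A J c) \<le> (\<Sum>a\<in>A. measure (lam_mu D) (Pi UNIV (J a)) * norm (c a))"
proof -
  have "norm (boxsum A J c x) \<le> boxsum A J (\<lambda>a. norm (c a)) x" for x
    unfolding boxsum_def by (rule order_trans[OF norm_sum]) (auto simp: norm_mult indicator_def intro!: sum_mono)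
  then have "l1 (boxsum A J c) \<le> integ (boxsum A J (\<lambda>a. norm (c a)))"
    unfolding l1_def using assms
    by (intro integ_real_mono gridded_compose1[OF gridded_boxsum] gridded_boxsum)
  also have "\<dots> = (\<Sum>a\<in>A. measure (lam_mu D) (Pi UNIV (J a)) * norm (c a))"
    using integ_boxsum[OF assms, where c = "\<lambda>a. norm (c a)"] by simp
  finally show ?thesis .
qed

lemma l1_boxsum_disjoint:
  assumes "finite A" "\<And>a i. a \<in> A \<Longrightarrow> J a i \<in> pieces D"
    and disj: "disjoint_family_on (\<lambda>a. Pi UNIV (J a)) A"
  shows "l1 (boxsum A J c) = (\<Sum>a\<in>A. measure (lam_mu D) (Pi UNIV (J a)) * norm (c a))"
proof -
  have "norm (boxsum A J c x) = boxsum A J (\<lambda>a. norm (c a)) x" for x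
  proof (cases "\<exists>a\<in>A. x \<in> Pi UNIV (J a)")
    case True
    then obtain a where a: "a \<in> A" "x \<in> Pi UNIV (J a)" by blast
    have "x \<notin> Pi UNIV (J b)" if "b \<in> A - {a}" for b
      using disj a that unfolding disjoint_family_on_def by blast
    then show ?thesis
      unfolding boxsum_def sum.remove[OF assms(1) a(1)] using a by simp
  next
    case False
    then show ?thesis unfolding boxsum_def by simp
  qed
  then have "l1 (boxsum A J c) = integ (boxsum A J (\<lambda>a. norm (c a)))" by (simp add: l1_def)
  then show ?thesis using integ_boxsum[OF assms(1,2), where c = "\<lambda>a. norm (c a)"] by simp
qed

lemma cells_disjoint:
  assumes "ivl_partition D P" shows "disjoint_family_on (\<lambda>v::'n \<Rightarrow> 'k set. Pi UNIV v) (cells P)"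
  unfolding disjoint_family_on_def using cell_unique[OF assms] by blast

end

section \<open>The normed module of elementary functions\<close>

context integration
begin

lemma in_ae_class_iff: "g \<in> ae_class D f \<longleftrightarrow> (AE x in rho. g x = f x)"
  by (simp add: ae_class_def AE_rho)

lemma ae_class_self [simp]: "f \<in> ae_class D f"
  by (simp add: in_ae_class_iff)

lemma ae_class_eq_iff: "ae_class D f = ae_class D g \<longleftrightarrow> (AE x in rho. f x = g x)"
proof
  assume "ae_class D f = ae_class D g"
  then have "f \<in> ae_class D g" using ae_class_self[of f] by simp
  then show "AE x in rho. f x = g x" by (simp add: in_ae_class_iff)
next
  assume *: "AE x in rho. f x = g x"
  have "h \<in> ae_class D f \<longleftrightarrow> h \<in> ae_class D g" for h
    unfolding in_ae_class_iff using * by (intro iffI; elim AE_mp) (auto intro!: AE_I2)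
  then show "ae_class D f = ae_class D g" by blast
qed

lemma ae_class_cong: "(\<And>x. x \<in> lam_ivl D \<Longrightarrow> f x = g x) \<Longrightarrow> ae_class D f = ae_class D g"
  unfolding ae_class_eq_iff by (intro AE_I2) simp

lemma gridded_diff: "gridded D f \<Longrightarrow> gridded D g \<Longrightarrow> gridded D (\<lambda>x. f x - g x :: 'k)"
  by (rule gridded_compose2)

lemma gridded_add: "gridded D f \<Longrightarrow> gridded D g \<Longrightarrow> gridded D (\<lambda>x. f x + g x :: 'k)"
  by (rule gridded_compose2)

lemma gridded_scale: "gridded D f \<Longrightarrow> gridded D (\<lambda>x. c * f x :: 'k)"
  by (rule gridded_compose1)

lemma ae_class_eq_iff_l1:
  "gridded D f \<Longrightarrow> gridded D g \<Longrightarrow> ae_class D f = ae_class D g \<longleftrightarrow> l1 (\<lambda>x. f x - g x) = 0"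
  using l1_eq_0_iff[OF gridded_diff] by (simp add: ae_class_eq_iff)

lemma l1_minus_commute: "l1 (\<lambda>x. f x - g x) = l1 (\<lambda>x. g x - f x)"
  by (simp add: l1_def norm_minus_commute)

lemma l1_diff_le:
  assumes "gridded D f" "gridded D g" shows "l1 f \<le> l1 (\<lambda>x. f x - g x) + l1 g"
  using l1_add[OF gridded_diff[OF assms] assms(2)] by simp

lemma l1_ae_cong:
  assumes "gridded D f" "gridded D g" "ae_class D f = ae_class D g" shows "l1 f = l1 g"
  using l1_diff_le[OF assms(1,2)] l1_diff_le[OF assms(2,1)] assms
  by (simp add: ae_class_eq_iff_l1 l1_minus_commute[of g f])

lemma integ_ae_cong:
  assumes "gridded D f" "gridded D g" "ae_class D f = ae_class D (g :: _ \<Rightarrow> 'k)" shows "integ f = integ g"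
  using norm_integ_le[OF gridded_diff[OF assms(1,2)]] assms
  by (simp add: ae_class_eq_iff_l1 integ_diff)

lemma base_sub_ivl: "base_ivl D \<in> sub_ivls D"
  unfolding sub_ivls_def base_ivl_def ivls_def using interval leq_trans[OF lft_mid mid_rgt]
  by (intro UnionI[of "ivls D (lft D) (rgt D)"] CollectI exI[of _ "lft D"] exI[of _ "rgt D"])
    (auto simp: ivls_def interval_data_def lt_def dest: leq_antisym)

text \<open>Boxes with a degenerate side are null sets. Dropping them turns a disjoint family of boxes into the
  representation of an elementary function without changing its class or the sum of powers.\<close>

lemma ex_elementary:
  fixes J :: "'i \<Rightarrow> 'n \<Rightarrow> 'k set" and c :: "'i \<Rightarrow> 'k"
  assumes A: "finite A" and J: "\<And>a i. a \<in> A \<Longrightarrow> J a i \<in> pieces D"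
    and disj: "disjoint_family_on (\<lambda>a. Pi UNIV (J a)) A"
  shows "\<exists>t c' J' g. elementary_rep D t c' J' g \<and> ae_class D g = ae_class D (boxsum A J c) \<and>
    rep_norm D t c' J' =
      (\<Sum>a\<in>A. (norm (c a) * measure (lam_mu D) (Pi UNIV (J a))) powr expo D) powr (1 / expo D)"
proof -
  define A' where "A' = {a \<in> A. \<forall>i. J a i \<in> sub_ivls D}"
  define t where "t = card A'"
  have A': "A' \<subseteq> A" "finite A'" using A by (auto simp: A'_def)
  obtain e where e: "bij_betw e {..<t} A'"
    using ex_bij_betw_nat_finite[OF A'(2)] by (auto simp: t_def atLeast0LessThan)
  have e_in: "e a \<in> A'" if "a < t" for a using e that by (auto simp: bij_betw_def)
  have null: "measure (lam_mu D) (Pi UNIV (J a)) = 0" if a: "a \<in> A - A'" for a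
  proof -
    obtain i where "J a i \<notin> sub_ivls D" using a by (auto simp: A'_def)
    then have "measure (mu D) (J a i) = 0" using degenerate_null[OF J] a by simp
    then have "(\<Prod>i\<in>UNIV. measure (mu D) (J a i)) = 0" by (intro prod_zero) auto
    then show ?thesis using box_measure[of "J a"] piece_measurable[OF J] a by simp
  qed
  have eq: "(\<lambda>x. \<Sum>i<t. (c \<circ> e) i * indicator (Pi UNIV ((J \<circ> e) i)) x) = boxsum A' J c"
  proof
    fix x
    show "(\<Sum>i<t. (c \<circ> e) i * indicator (Pi UNIV ((J \<circ> e) i)) x) = boxsum A' J c x"
      using sum.reindex_bij_betw[OF e, of "\<lambda>a. c a * indicator (Pi UNIV (J a)) x"]
      by (simp only: boxsum_def comp_apply)
  qed
  have "elementary_rep D t (c \<circ> e) (J \<circ> e) (boxsum A' J c)"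
    unfolding elementary_rep_def
  proof (intro conjI allI impI)
    show "(J \<circ> e) i j \<in> sub_ivls D" if "i < t" for i j
      using e_in[OF that] by (simp add: A'_def)
    show "disjoint_family_on (\<lambda>i. Pi UNIV ((J \<circ> e) i)) {..<t}"
      unfolding disjoint_family_on_def
    proof (intro ballI impI)
      fix i j assume ij: "i \<in> {..<t}" "j \<in> {..<t}" "i \<noteq> j"
      then have "e i \<noteq> e j" using e by (auto simp: bij_betw_def dest: inj_onD)
      moreover have "e i \<in> A" "e j \<in> A" using e_in ij A'(1) by auto
      ultimately show "Pi UNIV ((J \<circ> e) i) \<inter> Pi UNIV ((J \<circ> e) j) = {}"
        using disj by (simp add: disjoint_family_on_def)
    qed
  qed (rule eq[symmetric])
  moreover have "ae_class D (boxsum A' J c) = ae_class D (boxsum A J c)"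
  proof -
    have g: "gridded D (boxsum A J c)" "gridded D (boxsum A' J c)"
      using A A' J by (auto intro!: gridded_boxsum)
    have "boxsum A J c x - boxsum A' J c x = boxsum (A - A') J c x" for x
      using sum.subset_diff[OF A'(1) A, of "\<lambda>a. c a * indicator (Pi UNIV (J a)) x"]
      unfolding boxsum_def by (simp only: add_diff_cancel_right')
    then have "l1 (\<lambda>x. boxsum A J c x - boxsum A' J c x) = l1 (boxsum (A - A') J c)" by simp
    also have "\<dots> \<le> (\<Sum>a\<in>A - A'. measure (lam_mu D) (Pi UNIV (J a)) * norm (c a))"
      using A J by (intro l1_boxsum_le) auto
    also have "\<dots> = 0" using null by simp
    finally have "l1 (\<lambda>x. boxsum A J c x - boxsum A' J c x) = 0" by (simp add: antisym)
    then show ?thesis using ae_class_eq_iff_l1[OF g] by simp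
  qed
  moreover have "rep_norm D t (c \<circ> e) (J \<circ> e) =
      (\<Sum>a\<in>A. (norm (c a) * measure (lam_mu D) (Pi UNIV (J a))) powr expo D) powr (1 / expo D)"
  proof -
    let ?h = "\<lambda>a. (norm (c a) * measure (lam_mu D) (Pi UNIV (J a))) powr expo D"
    have "(\<Sum>i<t. ?h (e i)) = sum ?h A'" by (rule sum.reindex_bij_betw[OF e])
    also have "\<dots> = sum ?h A" using null by (intro sum.mono_neutral_left[OF A A'(1)]) auto
    finally show ?thesis by (simp add: rep_norm_def)
  qed
  ultimately show ?thesis by blast
qed

lemma elementary_repD:
  assumes "elementary_rep D t c J f"
  shows "f = boxsum {..<t} J c" "\<And>a i. a \<in> {..<t} \<Longrightarrow> J a i \<in> pieces D"
    "disjoint_family_on (\<lambda>a. Pi UNIV (J a)) {..<t}"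
  using assms sub_ivls_pieces by (auto simp: elementary_rep_def boxsum_def)

lemma elementary_rep_gridded:
  assumes "elementary_rep D t c J f" shows "gridded D f"
proof -
  have "gridded D (boxsum {..<t} J c)"
    by (rule gridded_boxsum[OF finite_lessThan elementary_repD(2)[OF assms]])
  then show ?thesis using elementary_repD(1)[OF assms] by simp
qed

lemma elementary_gridded: "f \<in> elementary D \<Longrightarrow> gridded D f"
  unfolding elementary_def using elementary_rep_gridded by blast

lemma gridded_cells_rep:
  fixes f :: "('n \<Rightarrow> 'k) \<Rightarrow> 'k"
  assumes P: "ivl_partition D P" and f: "\<forall>v\<in>cells P. \<forall>x\<in>Pi UNIV v. f x = c v"
  shows "\<exists>t c' J' g. elementary_rep D t c' J' g \<and> ae_class D g = ae_class D f \<and>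
      rep_norm D t c' J' =
      (\<Sum>v\<in>cells P. (norm (c v) * measure (lam_mu D) (Pi UNIV v)) powr expo D) powr (1 / expo D)"
    and "l1 f = (\<Sum>v\<in>cells P. norm (c v) * measure (lam_mu D) (Pi UNIV v))"
proof -
  note eq = gridded_eq_boxsum[OF P f]
  note cells = finite_cells[OF P] cell_pieces[OF P] cells_disjoint[OF P]
  have "ae_class D f = ae_class D (boxsum (cells P) (\<lambda>v. v) c)" using eq by (rule ae_class_cong)
  moreover have "\<exists>t c' J' g. elementary_rep D t c' J' g \<and> ae_class D g = ae_class D (boxsum (cells P) (\<lambda>v. v) c) \<and>
      rep_norm D t c' J' =
      (\<Sum>v\<in>cells P. (norm (c v) * measure (lam_mu D) (Pi UNIV v)) powr expo D) powr (1 / expo D)"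
    by (rule ex_elementary) (rule cells | assumption)+
  ultimately show "\<exists>t c' J' g. elementary_rep D t c' J' g \<and> ae_class D g = ae_class D f \<and>
      rep_norm D t c' J' =
      (\<Sum>v\<in>cells P. (norm (c v) * measure (lam_mu D) (Pi UNIV v)) powr expo D) powr (1 / expo D)"
    by simp
  have "l1 f = l1 (boxsum (cells P) (\<lambda>v. v) c)"
    unfolding l1_def using eq by (intro integ_cong) simp
  also have "\<dots> = (\<Sum>v\<in>cells P. measure (lam_mu D) (Pi UNIV v) * norm (c v))"
    by (rule l1_boxsum_disjoint) (rule cells | assumption)+
  finally show "l1 f = (\<Sum>v\<in>cells P. norm (c v) * measure (lam_mu D) (Pi UNIV v))"
    by (simp add: mult.commute)
qed

lemma base_rep: "elementary_rep D 1 (\<lambda>_. 1) (\<lambda>_ _. base_ivl D) (indicator (lam_ivl D))"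
  using base_sub_ivl by (auto simp: elementary_rep_def disjoint_family_on_def lam_ivl_def)

lemma l1_one: "l1 (\<lambda>_. 1) = lam_mass D"
proof -
  have "l1 (\<lambda>_. 1) = l1 (boxsum {()} (\<lambda>_ _. base_ivl D) (\<lambda>_. 1))"
    unfolding l1_def by (intro integ_cong) (simp add: boxsum_def lam_ivl_def)
  also have "\<dots> = lam_mass D"
    using l1_boxsum_disjoint[of "{()}" "\<lambda>_ _. base_ivl D" "\<lambda>_. 1"] base_piece
    by (simp add: disjoint_family_on_def lam_ivl_def)
  finally show ?thesis .
qed

text \<open>The constant function \<open>1\<close> is represented both by the whole box and by all cells of the grid. For
  \<open>p > 1\<close>, equality of the two norms leaves room for at most one cell of positive measure.\<close>

lemma single_cell:
  assumes p: "1 < expo D" and P: "ivl_partition D P"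
    and v: "v \<in> cells P" "0 < measure (lam_mu D) (Pi UNIV (v :: 'n \<Rightarrow> 'k set))"
    and w: "w \<in> cells P" "0 < measure (lam_mu D) (Pi UNIV w)"
  shows "v = w"
proof -
  let ?m = "\<lambda>v::'n \<Rightarrow> 'k set. measure (lam_mu D) (Pi UNIV v)"
  obtain t c J g where g: "elementary_rep D t c J g" "ae_class D g = ae_class D (\<lambda>_. 1)"
    "rep_norm D t c J = (\<Sum>v\<in>cells P. ?m v powr expo D) powr (1 / expo D)"
    using gridded_cells_rep(1)[OF P, of "\<lambda>_. 1" "\<lambda>_. 1"] by auto
  have "ae_class D (indicator (lam_ivl D)) = ae_class D (\<lambda>_. 1)" by (rule ae_class_cong) simp
  then have "rep_norm D t c J = rep_norm D 1 (\<lambda>_. 1) (\<lambda>_ _. base_ivl D)"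
    using norm_well_def[OF p] g(1,2) base_rep unfolding norm_well_defined_def by metis
  then have "(\<Sum>v\<in>cells P. ?m v powr expo D) powr (1 / expo D) = lam_mass D"
    using g(3) p by (simp add: rep_norm_def powr_powr flip: lam_ivl_def)
  moreover have sum: "lam_mass D = (\<Sum>v\<in>cells P. ?m v)"
    using gridded_cells_rep(2)[OF P, of "\<lambda>_. 1" "\<lambda>_. 1"] by (simp add: l1_one)
  ultimately have "((\<Sum>v\<in>cells P. ?m v powr expo D) powr (1 / expo D)) powr expo D =
      (\<Sum>v\<in>cells P. ?m v) powr expo D" by simp
  then have "(\<Sum>v\<in>cells P. ?m v powr expo D) = (\<Sum>v\<in>cells P. ?m v) powr expo D"
    using p by (simp add: powr_powr sum_nonneg)
  then show ?thesis
    using powr_sum_eq_imp_single[OF finite_cells[OF P] p, of ?m] v w by simp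
qed

text \<open>For \<open>p > 1\<close>, compare with the representation of \<open>f\<close> along a grid. By the previous lemma at most one
  term of its norm is nonzero, and then the exponent has no effect.\<close>

lemma rep_norm_eq_l1:
  assumes rep: "elementary_rep D t c J f" shows "rep_norm D t c J = l1 f"
proof (cases "expo D = 1")
  case True
  have "rep_norm D t c J = (\<Sum>i<t. norm (c i) * measure (lam_mu D) (Pi UNIV (J i)))"
    using True by (simp add: rep_norm_def sum_nonneg)
  also have "\<dots> = l1 (boxsum {..<t} J c)"
    using l1_boxsum_disjoint[OF _ elementary_repD(2,3)[OF rep]] by (simp add: mult.commute)
  finally show ?thesis using elementary_repD(1)[OF rep] by simp
next
  case False
  then have p: "1 < expo D" using expo_ge_1 by simp
  obtain P c' where P: "ivl_partition D P" and c': "\<forall>v\<in>cells P. \<forall>x\<in>Pi UNIV v. f x = c' v"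
    using elementary_rep_gridded[OF rep] by (rule gridded_expand)
  let ?y = "\<lambda>v::'n \<Rightarrow> 'k set. norm (c' v) * measure (lam_mu D) (Pi UNIV v)"
  obtain t2 c2 J2 g where g: "elementary_rep D t2 c2 J2 g" "ae_class D g = ae_class D f"
    "rep_norm D t2 c2 J2 = (\<Sum>v\<in>cells P. ?y v powr expo D) powr (1 / expo D)"
    using gridded_cells_rep(1)[OF P c'] by blast
  have "rep_norm D t c J = rep_norm D t2 c2 J2"
    using norm_well_def[OF p] g(1,2) rep unfolding norm_well_defined_def by metis
  also have "\<dots> = (\<Sum>v\<in>cells P. ?y v)"
    unfolding g(3)
  proof (rule powr_sum_single[OF finite_cells[OF P]])
    show "v = w" if "v \<in> cells P" "w \<in> cells P" "0 < ?y v" "0 < ?y w" for v w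
    proof -
      have "0 < measure (lam_mu D) (Pi UNIV v)" "0 < measure (lam_mu D) (Pi UNIV w)"
        using that(3,4) by (auto simp: zero_less_mult_iff)
      then show ?thesis using single_cell[OF p P] that by blast
    qed
  qed (use p in auto)
  finally show ?thesis using gridded_cells_rep(2)[OF P c'] by simp
qed

text \<open>The class of a grid function contains an elementary function; conversely elementary functions are
  grid functions. This identifies the carrier of \<^term>\<open>S_mod D\<close> with the classes of grid functions.\<close>

lemma gridded_rep:
  fixes f :: "('n \<Rightarrow> 'k) \<Rightarrow> 'k"
  assumes "gridded D f" obtains t c J g where "elementary_rep D t c J g" "ae_class D f = ae_class D g"
proof -
  obtain P c' where P: "ivl_partition D P" and c': "\<forall>v\<in>cells P. \<forall>x\<in>Pi UNIV v. f x = c' v"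
    using assms by (rule gridded_expand)
  show thesis using gridded_cells_rep(1)[OF P c'] that by metis
qed

lemma S_carrier: "F \<in> mcarrier (S_mod D) \<longleftrightarrow> (\<exists>f. gridded D f \<and> F = ae_class D f)"
proof
  assume "F \<in> mcarrier (S_mod D)"
  then show "\<exists>f. gridded D f \<and> F = ae_class D f" using elementary_gridded by (auto simp: S_mod_def)
next
  assume "\<exists>f. gridded D f \<and> F = ae_class D f"
  then obtain f where f: "gridded D f" "F = ae_class D f" by blast
  obtain t c J g where g: "elementary_rep D t c J g" "ae_class D f = ae_class D g"
    using f(1) by (rule gridded_rep)
  then have "g \<in> elementary D" unfolding elementary_def by blast
  then show "F \<in> mcarrier (S_mod D)" using f(2) g(2) by (simp add: S_mod_def)
qed

lemma S_carrierE:
  assumes "F \<in> mcarrier (S_mod D)" obtains f where "gridded D f" "F = ae_class D f"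
  using assms by (auto simp: S_carrier)

lemma S_closed [simp]: "gridded D f \<Longrightarrow> ae_class D f \<in> mcarrier (S_mod D)"
  by (auto simp: S_carrier)

lemma S_add: "madd (S_mod D) (ae_class D f) (ae_class D g) = ae_class D (\<lambda>x. f x + g x)"
proof -
  have *: "ae_class D (\<lambda>x. f' x + g' x) = ae_class D (\<lambda>x. f x + g x)"
    if "f' \<in> ae_class D f" "g' \<in> ae_class D g" for f' g'
    using that unfolding in_ae_class_iff ae_class_eq_iff by eventually_elim simp
  have "{h. \<exists>f'\<in>ae_class D f. \<exists>g'\<in>ae_class D g. h \<in> ae_class D (\<lambda>x. f' x + g' x)} =
      ae_class D (\<lambda>x. f x + g x)"
    using * ae_class_self[of f] ae_class_self[of g] by blast
  then show ?thesis by (simp add: S_mod_def)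
qed

lemma S_unary:
  "{h. \<exists>f'\<in>ae_class D f. h \<in> ae_class D (\<lambda>x. \<phi> (f' x))} = ae_class D (\<lambda>x. \<phi> (f x))"
proof -
  have *: "ae_class D (\<lambda>x. \<phi> (f' x)) = ae_class D (\<lambda>x. \<phi> (f x))" if "f' \<in> ae_class D f" for f'
    using that unfolding in_ae_class_iff ae_class_eq_iff by eventually_elim simp
  then show ?thesis using ae_class_self[of f] by blast
qed

lemma S_act: "mact (S_mod D) r (ae_class D f) = ae_class D (\<lambda>x. tau D r * f x)"
  using S_unary[of f "\<lambda>y. tau D r * y"] by (simp add: S_mod_def)

lemma S_abs_class: "S_abs D (ae_class D f) = ae_class D (\<lambda>x. of_real (norm (f x)))"
  using S_unary[of f "\<lambda>y. of_real (norm y)"] by (simp add: S_abs_def)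

lemma S_zero: "mzero (S_mod D) = ae_class D (\<lambda>_. 0)"
  by (simp add: S_mod_def)

lemma S_norm:
  assumes f: "gridded D f" shows "mnorm (S_mod D) (ae_class D f) = l1 f"
proof -
  obtain t c J g where g: "elementary_rep D t c J g" "ae_class D f = ae_class D g"
    using f by (rule gridded_rep)
  have "(THE r. \<exists>t c J f'. elementary_rep D t c J f' \<and> ae_class D f = ae_class D f' \<and> r = rep_norm D t c J) = l1 f"
  proof (rule the_equality)
    show "\<exists>t c J f'. elementary_rep D t c J f' \<and> ae_class D f = ae_class D f' \<and> l1 f = rep_norm D t c J"
      using g rep_norm_eq_l1[OF g(1)] l1_ae_cong[OF f elementary_rep_gridded[OF g(1)] g(2)] by metis
    fix r assume "\<exists>t c J f'. elementary_rep D t c J f' \<and> ae_class D f = ae_class D f' \<and> r = rep_norm D t c J"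
    then obtain t c J f' where r: "elementary_rep D t c J f'" "ae_class D f = ae_class D f'" "r = rep_norm D t c J"
      by (elim exE conjE)
    show "r = l1 f"
      using r(3) rep_norm_eq_l1[OF r(1)] l1_ae_cong[OF f elementary_rep_gridded[OF r(1)] r(2)] by simp
  qed
  then show ?thesis by (simp add: S_mod_def)
qed

lemma tau_one: "tau D 1 = 1" and tau_add: "tau D (x + y) = tau D x + tau D y"
  and tau_mult: "tau D (x * y) = tau D x * tau D y" and tau_scl: "tau D (scl D c 1) = c"
  using algebra by (auto simp: algebra_data_def)

lemma tau_minus_one: "tau D (- 1) = - 1"
  using tau_add[of 0 0] tau_add[of 1 "- 1"] tau_one by (simp add: eq_neg_iff_add_eq_0 add.commute)

lemma S_normed: "normed_module (tau D) (S_mod D)"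
  unfolding normed_module_def
proof (intro conjI ballI allI)
  note S = S_add S_act S_zero S_norm gridded_add gridded_scale gridded_const
  show "left_module (S_mod D)"
    unfolding left_module_def
  proof (intro conjI ballI allI)
    show "mzero (S_mod D) \<in> mcarrier (S_mod D)" by (simp add: S)
    fix F assume "F \<in> mcarrier (S_mod D)"
    then obtain f where f: "gridded D f" "F = ae_class D f" by (rule S_carrierE)
    show "madd (S_mod D) (mzero (S_mod D)) F = F" "mact (S_mod D) 1 F = F"
      using f by (simp_all add: S tau_one)
    show "\<exists>G\<in>mcarrier (S_mod D). madd (S_mod D) F G = mzero (S_mod D)"
      using f gridded_compose1[OF f(1), of uminus]
      by (intro bexI[of _ "ae_class D (\<lambda>x. - f x)"]) (simp_all add: S)
    fix r
    show "mact (S_mod D) r F \<in> mcarrier (S_mod D)" using f by (simp add: S)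
    {
      fix s
      show "mact (S_mod D) (r * s) F = mact (S_mod D) r (mact (S_mod D) s F)"
        "mact (S_mod D) (r + s) F = madd (S_mod D) (mact (S_mod D) r F) (mact (S_mod D) s F)"
        using f by (simp_all add: S tau_mult tau_add mult.assoc distrib_right)
    }
    fix G assume "G \<in> mcarrier (S_mod D)"
    then obtain g where g: "gridded D g" "G = ae_class D g" by (rule S_carrierE)
    show "madd (S_mod D) F G \<in> mcarrier (S_mod D)" "madd (S_mod D) F G = madd (S_mod D) G F"
      "mact (S_mod D) r (madd (S_mod D) F G) = madd (S_mod D) (mact (S_mod D) r F) (mact (S_mod D) r G)"
      using f g by (simp_all add: S add.commute distrib_left)
    fix H assume "H \<in> mcarrier (S_mod D)"
    then obtain h where h: "gridded D h" "H = ae_class D h" by (rule S_carrierE)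
    show "madd (S_mod D) (madd (S_mod D) F G) H = madd (S_mod D) F (madd (S_mod D) G H)"
      using f g h by (simp add: S add.assoc)
  qed
  fix F assume "F \<in> mcarrier (S_mod D)"
  then obtain f where f: "gridded D f" "F = ae_class D f" by (rule S_carrierE)
  show "0 \<le> mnorm (S_mod D) F" using f by (simp add: S)
  show "mnorm (S_mod D) F = 0 \<longleftrightarrow> F = mzero (S_mod D)"
    using ae_class_eq_iff_l1[OF f(1) gridded_const[of D 0]] f by (simp add: S)
  fix r
  show "mnorm (S_mod D) (mact (S_mod D) r F) = norm (tau D r) * mnorm (S_mod D) F"
    using f by (simp add: S l1_scale)
  fix G assume "G \<in> mcarrier (S_mod D)"
  then obtain g where g: "gridded D g" "G = ae_class D g" by (rule S_carrierE)
  show "mnorm (S_mod D) (madd (S_mod D) F G) \<le> mnorm (S_mod D) F + mnorm (S_mod D) G"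
    using f g by (simp add: S l1_add)
qed

lemma S_normed_left_module: "normed_left_module (tau D) (S_mod D)"
  using S_normed by (intro normed_left_moduleI) (simp_all add: tau_minus_one)

lemma S_mdist:
  assumes "gridded D f" "gridded D g"
  shows "mdist (S_mod D) (ae_class D f) (ae_class D g) = l1 (\<lambda>x. f x - g x)"
proof -
  have "mdist (S_mod D) (ae_class D f) (ae_class D g) = mnorm (S_mod D) (ae_class D (\<lambda>x. f x + (- 1) * g x))"
    by (simp add: mdist_def S_add S_act tau_minus_one)
  also have "\<dots> = l1 (\<lambda>x. f x + (- 1) * g x)"
    by (intro S_norm gridded_add gridded_scale assms)
  finally show ?thesis by simp
qed

end

section \<open>Juxtaposition and step functions\<close>

context integration
begin

lemma cc_ivl_eq: "cc_ivl D c d = up D True c \<inter> dn D True d"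
  by (auto simp: cc_ivl_def up_def dn_def)

lemma kap_bij: "bij_betw (kap D e) (base_ivl D) (cc_ivl D (if e then mid D else lft D) (if e then rgt D else mid D))"
  and kap_mono: "x \<in> base_ivl D \<Longrightarrow> y \<in> base_ivl D \<Longrightarrow> leq D x y \<Longrightarrow> leq D (kap D e x) (kap D e y)"
  using interval by (auto simp: interval_data_def order_iso_def kap_def)

lemma kap_image: "kap D e ` base_ivl D = cc_ivl D (if e then mid D else lft D) (if e then rgt D else mid D)"
  using kap_bij[of e] by (simp add: bij_betw_def)

lemma kap_inj: "inj_on (kap D e) (base_ivl D)"
  using kap_bij[of e] by (simp add: bij_betw_def)

lemma kap_in: assumes "x \<in> base_ivl D" shows "kap D e x \<in> base_ivl D"
proof -
  have "kap D e x \<in> cc_ivl D (if e then mid D else lft D) (if e then rgt D else mid D)"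
    using assms by (simp flip: kap_image)
  then show ?thesis
    using leq_trans[OF lft_mid, of "kap D e x"] leq_trans[OF _ mid_rgt, of "kap D e x"]
    by (auto simp: cc_ivl_def in_base split: if_splits)
qed

lemma kap_leq_iff:
  assumes "x \<in> base_ivl D" "y \<in> base_ivl D"
  shows "leq D (kap D e x) (kap D e y) \<longleftrightarrow> leq D x y"
proof
  assume *: "leq D (kap D e x) (kap D e y)"
  show "leq D x y"
  proof (rule ccontr)
    assume "\<not> leq D x y"
    then have yx: "leq D y x" by (rule leq_not)
    then have "kap D e x = kap D e y" using * kap_mono[OF assms(2,1) yx] leq_antisym by blast
    then have "x = y" using inj_onD[OF kap_inj _ assms] by blast
    then show False using \<open>\<not> leq D x y\<close> by simp
  qed
qed (rule kap_mono[OF assms])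

lemma kap_lft: "kap D e (lft D) = (if e then mid D else lft D)"
proof -
  let ?l = "if e then mid D else lft D"
  have "?l \<in> kap D e ` base_ivl D" unfolding kap_image using lft_mid mid_rgt by (simp add: cc_ivl_def)
  then obtain x where x: "x \<in> base_ivl D" "?l = kap D e x" by blast
  have "leq D (kap D e (lft D)) ?l" unfolding x(2) using x(1) by (intro kap_mono) (simp_all add: in_base leq_trans[OF lft_mid mid_rgt])
  moreover have "kap D e (lft D) \<in> kap D e ` base_ivl D" by simp
  then have "leq D ?l (kap D e (lft D))" unfolding kap_image by (simp add: cc_ivl_def)
  ultimately show ?thesis by (rule leq_antisym)
qed

lemma kap_rgt: "kap D e (rgt D) = (if e then rgt D else mid D)"
proof -
  let ?r = "if e then rgt D else mid D"
  have "?r \<in> kap D e ` base_ivl D" unfolding kap_image using lft_mid mid_rgt by (simp add: cc_ivl_def)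
  then obtain x where x: "x \<in> base_ivl D" "?r = kap D e x" by blast
  have "leq D ?r (kap D e (rgt D))" unfolding x(2) using x(1) by (intro kap_mono) (simp_all add: in_base leq_trans[OF lft_mid mid_rgt])
  moreover have "kap D e (rgt D) \<in> kap D e ` base_ivl D" by simp
  then have "leq D (kap D e (rgt D)) ?r" unfolding kap_image by (simp add: cc_ivl_def)
  ultimately show ?thesis by (rule leq_antisym[OF _ _, rotated])
qed

text \<open>The image of \<open>\<kappa>\<close> is itself an interval, hence contains everything between two of its points.\<close>

lemma kap_up_dn:
  assumes c: "c \<in> base_ivl D" and d: "d \<in> base_ivl D"
  shows "kap D e ` (up D s c \<inter> dn D t d) = up D s (kap D e c) \<inter> dn D t (kap D e d)"
proof -
  have iff: "kap D e x \<in> up D s (kap D e c) \<inter> dn D t (kap D e d) \<longleftrightarrow> x \<in> up D s c \<inter> dn D t d"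
    if "x \<in> base_ivl D" for x
    using that c d by (simp add: up_def dn_def lt_iff kap_leq_iff)
  have "z \<in> kap D e ` base_ivl D" if z: "z \<in> up D s (kap D e c) \<inter> dn D t (kap D e d)" for z
  proof -
    have "leq D (kap D e c) z" "leq D z (kap D e d)"
      using z by (auto simp: up_def dn_def lt_def split: if_splits)
    moreover have "kap D e c \<in> kap D e ` base_ivl D" "kap D e d \<in> kap D e ` base_ivl D" using c d by simp_all
    ultimately show ?thesis
      unfolding kap_image cc_ivl_def using leq_trans[of _ "kap D e c" z] leq_trans[of z "kap D e d"] by simp
  qed
  note conv = this
  have sub: "up D s c \<inter> dn D t d \<subseteq> base_ivl D" by (rule piece_subset[OF piecesI[OF c d]])
  show ?thesis
  proof (intro set_eqI iffI)
    fix z assume "z \<in> kap D e ` (up D s c \<inter> dn D t d)"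
    then obtain x where x: "x \<in> up D s c \<inter> dn D t d" "z = kap D e x" by (rule imageE)
    then have "x \<in> base_ivl D" using sub by blast
    then show "z \<in> up D s (kap D e c) \<inter> dn D t (kap D e d)" using iff x by simp
  next
    fix z assume z: "z \<in> up D s (kap D e c) \<inter> dn D t (kap D e d)"
    obtain x where x: "z = kap D e x" "x \<in> base_ivl D" using conv[OF z] by (rule imageE)
    then have "x \<in> up D s c \<inter> dn D t d" using iff z by simp
    then show "z \<in> kap D e ` (up D s c \<inter> dn D t d)" unfolding x(1) by (rule imageI)
  qed
qed

lemma kap_piece: "J \<in> pieces D \<Longrightarrow> kap D e ` J \<in> pieces D"
  by (erule piecesE) (simp add: kap_up_dn piecesI kap_in)

text \<open>The factor by which \<open>\<kappa>\<^sub>a\<close> or \<open>\<kappa>\<^sub>b\<close> contracts the measure of intervals.\<close>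

definition ratio :: "bool \<Rightarrow> real" where
  "ratio e = measure (mu D) (kap D e ` base_ivl D) / measure (mu D) (base_ivl D)"

lemma kap_measure:
  assumes J: "J \<in> pieces D" shows "measure (mu D) (kap D e ` J) = ratio e * measure (mu D) J"
proof (cases "J \<in> sub_ivls D")
  case True
  have "kap D e \<in> {kapA D, kapB D}" by (simp add: kap_def)
  then have "measure (mu D) (kap D e ` J) * measure (mu D) (base_ivl D) =
      measure (mu D) (kap D e ` base_ivl D) * measure (mu D) J"
    using self_sim True unfolding self_similar_def by blast
  then show ?thesis using mass_pos by (simp add: ratio_def field_simps)
next
  case False
  obtain c where c: "J \<subseteq> {c}" using J False by (rule degenerate_piece)
  then have "kap D e ` J \<subseteq> {kap D e c}" by blast
  then show ?thesis using null_subset_point c by simp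
qed

lemma ratio_nonneg: "0 \<le> ratio e"
  by (simp add: ratio_def)

lemma ratio_le_1: "ratio e \<le> 1"
proof -
  interpret finite_measure "mu D" by (rule finite_mu)
  have "measure (mu D) (kap D e ` base_ivl D) \<le> measure (mu D) (base_ivl D)"
    using kap_in piece_measurable[OF base_piece] by (intro finite_measure_mono) auto
  then show ?thesis using mass_pos by (simp add: ratio_def)
qed

text \<open>The contraction factor of the box indexed by the word \<open>\<omega>\<close>. By \<open>m_map_eq\<close> below, these are the
  coefficients of the linear map \<open>m\<close>.\<close>

definition weight :: "('n \<Rightarrow> bool) \<Rightarrow> real" where "weight \<omega> = (\<Prod>i\<in>UNIV. ratio (\<omega> i))"

lemma weight_nonneg: "0 \<le> weight \<omega>" and weight_le_1: "weight \<omega> \<le> 1"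
  unfolding weight_def by (auto intro!: prod_nonneg prod_le_1 ratio_nonneg ratio_le_1)

lemma kap_box_measure:
  assumes "\<And>i. v i \<in> pieces D"
  shows "measure (lam_mu D) (Pi UNIV (\<lambda>i. kap D (\<omega> i) ` v i)) = weight \<omega> * measure (lam_mu D) (Pi UNIV v)"
  using assms by (simp add: box_measure piece_measurable kap_piece kap_measure weight_def prod.distrib)

definition kap_index ::
  "(('n \<Rightarrow> bool) \<Rightarrow> 'i \<Rightarrow> 'n \<Rightarrow> 'k set) \<Rightarrow> ('n \<Rightarrow> bool) \<times> 'i \<Rightarrow> 'n \<Rightarrow> 'k set" where
  "kap_index J = (\<lambda>(\<omega>, a) i. kap D (\<omega> i) ` J \<omega> a i)"

text \<open>Transporting a box along \<open>\<kappa>\<^sub>\<omega>\<close> gives a box, so juxtaposition of sums over boxes only moves the boxes.\<close>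

lemma juxt_eq_boxsum:
  assumes A: "\<And>\<omega>. finite (A \<omega>)" and J: "\<And>\<omega> a i. a \<in> A \<omega> \<Longrightarrow> J \<omega> a i \<in> pieces D"
    and f: "\<And>\<omega> x. x \<in> lam_ivl D \<Longrightarrow> f \<omega> x = boxsum (A \<omega>) (J \<omega>) (c \<omega>) x"
  shows "juxt D f x = boxsum (SIGMA \<omega>:UNIV. A \<omega>) (kap_index J) (\<lambda>(\<omega>, a). c \<omega> a) x"
proof -
  have "indicator (Pi UNIV (\<lambda>i. kap D (\<omega> i) ` base_ivl D)) x *
        f \<omega> (\<lambda>i. inv_into (base_ivl D) (kap D (\<omega> i)) (x i)) =
      (\<Sum>a\<in>A \<omega>. c \<omega> a * indicator (Pi UNIV (\<lambda>i. kap D (\<omega> i) ` J \<omega> a i)) x)" for \<omega>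
  proof (cases "x \<in> Pi UNIV (\<lambda>i. kap D (\<omega> i) ` base_ivl D)")
    case True
    let ?y = "\<lambda>i. inv_into (base_ivl D) (kap D (\<omega> i)) (x i)"
    have xi: "x i \<in> kap D (\<omega> i) ` base_ivl D" for i using True by auto
    have y: "?y i \<in> base_ivl D" "kap D (\<omega> i) (?y i) = x i" for i
      using inv_into_into[OF xi] f_inv_into_f[OF xi] by auto
    have "?y \<in> Pi UNIV (J \<omega> a) \<longleftrightarrow> x \<in> Pi UNIV (\<lambda>i. kap D (\<omega> i) ` J \<omega> a i)" if a: "a \<in> A \<omega>" for a
    proof -
      have "?y i \<in> J \<omega> a i \<longleftrightarrow> x i \<in> kap D (\<omega> i) ` J \<omega> a i" for i
        using inj_on_image_mem_iff[OF kap_inj y(1) piece_subset[OF J[OF a]], of "\<omega> i" i i] y(2) by simp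
      then show ?thesis by (simp add: Pi_iff)
    qed
    then have "boxsum (A \<omega>) (J \<omega>) (c \<omega>) ?y =
        (\<Sum>a\<in>A \<omega>. c \<omega> a * indicator (Pi UNIV (\<lambda>i. kap D (\<omega> i) ` J \<omega> a i)) x)"
      unfolding boxsum_def by (intro sum.cong refl) (simp only: indicator_def)
    moreover have "?y \<in> lam_ivl D" using y(1) by (simp add: lam_ivl_def)
    ultimately show ?thesis using True f[of ?y \<omega>] by simp
  next
    case False
    have "x \<notin> Pi UNIV (\<lambda>i. kap D (\<omega> i) ` J \<omega> a i)" if "a \<in> A \<omega>" for a
    proof
      assume "x \<in> Pi UNIV (\<lambda>i. kap D (\<omega> i) ` J \<omega> a i)"
      then have "x i \<in> kap D (\<omega> i) ` base_ivl D" for i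
        using image_mono[OF piece_subset[OF J[OF that]], of "kap D (\<omega> i)" i] by (auto simp: Pi_iff)
      then show False using False by simp
    qed
    then show ?thesis using False by simp
  qed
  then have "juxt D f x =
      (\<Sum>\<omega>\<in>UNIV. \<Sum>a\<in>A \<omega>. c \<omega> a * indicator (Pi UNIV (\<lambda>i. kap D (\<omega> i) ` J \<omega> a i)) x)"
    unfolding juxt_def by (intro sum.cong refl)
  also have "\<dots> = boxsum (SIGMA \<omega>:UNIV. A \<omega>) (kap_index J) (\<lambda>(\<omega>, a). c \<omega> a) x"
    unfolding boxsum_def kap_index_def using A by (subst sum.Sigma) (simp_all only: finite_class.finite case_prod_unfold ball_UNIV simp_thms)
  finally show ?thesis .
qed

lemma kap_index_pieces:
  assumes "\<And>\<omega> a i. a \<in> A \<omega> \<Longrightarrow> J \<omega> a i \<in> pieces D" and "p \<in> (SIGMA \<omega>:UNIV. A \<omega>)"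
  shows "kap_index J p i \<in> pieces D"
  using assms by (auto simp: kap_index_def intro!: kap_piece)

text \<open>Juxtaposition is expanded along grids of its components. The transported cell has the measure of the
  original one times the weight of its word, and weights are at most \<open>1\<close>.\<close>

lemma
  assumes "\<And>\<omega>. gridded D (f \<omega>)"
  shows gridded_juxt: "gridded D (juxt D f)"
    and integ_juxt: "integ (juxt D f) = (\<Sum>\<omega>\<in>UNIV. of_real (weight \<omega>) * integ (f \<omega>))"
    and l1_juxt: "l1 (juxt D f) \<le> (\<Sum>\<omega>\<in>UNIV. l1 (f \<omega>))"
proof -
  have "\<exists>P c. ivl_partition D P \<and> (\<forall>v\<in>cells P. \<forall>x\<in>Pi UNIV v. f \<omega> x = c v)" for \<omega>
    using assms[of \<omega>] gridded_expand by metis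
  then obtain P c where P: "\<And>\<omega>. ivl_partition D (P \<omega>)"
    and c: "\<And>\<omega>. \<forall>v\<in>cells (P \<omega>). \<forall>x\<in>Pi UNIV v. f \<omega> x = c \<omega> v" by metis
  define A where "A \<omega> = (cells (P \<omega>) :: ('n \<Rightarrow> 'k set) set)" for \<omega>
  define J where "J = (\<lambda>(\<omega> :: 'n \<Rightarrow> bool) (v :: 'n \<Rightarrow> 'k set). v)"
  have A: "finite (A \<omega>)" for \<omega> unfolding A_def by (rule finite_cells[OF P])
  have J: "J \<omega> v i \<in> pieces D" if "v \<in> A \<omega>" for \<omega> v i
    using that cell_pieces[OF P] by (simp add: A_def J_def)
  have f: "f \<omega> x = boxsum (A \<omega>) (J \<omega>) (c \<omega>) x" if "x \<in> lam_ivl D" for \<omega> x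
    using gridded_eq_boxsum[OF P c that] by (simp add: A_def J_def)
  have juxt: "juxt D f = boxsum (SIGMA \<omega>:UNIV. A \<omega>) (kap_index J) (\<lambda>(\<omega>, a). c \<omega> a)"
    by (intro ext juxt_eq_boxsum A J f)
  have fin: "finite (SIGMA \<omega>:UNIV. A \<omega>)" using A by auto
  have pcs: "kap_index J p i \<in> pieces D" if "p \<in> (SIGMA \<omega>:UNIV. A \<omega>)" for p i
    by (rule kap_index_pieces[where A = A and J = J, OF J that])
  have m: "measure (lam_mu D) (Pi UNIV (kap_index J (\<omega>, v))) = weight \<omega> * measure (lam_mu D) (Pi UNIV (J \<omega> v))"
    if "v \<in> A \<omega>" for \<omega> v
    using kap_box_measure[OF J[OF that], of \<omega>] by (simp add: kap_index_def)
  show "gridded D (juxt D f)" unfolding juxt by (rule gridded_boxsum[OF fin pcs])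
  have "integ (juxt D f) =
      (\<Sum>p\<in>(SIGMA \<omega>:UNIV. A \<omega>). of_real (measure (lam_mu D) (Pi UNIV (kap_index J p))) * (\<lambda>(\<omega>, a). c \<omega> a) p)"
    unfolding juxt by (rule integ_boxsum[OF fin pcs])
  also have "\<dots> = (\<Sum>\<omega>\<in>UNIV. \<Sum>v\<in>A \<omega>. of_real (measure (lam_mu D) (Pi UNIV (kap_index J (\<omega>, v)))) * c \<omega> v)"
    using A by (subst sum.Sigma) (auto intro!: sum.cong)
  also have "\<dots> = (\<Sum>\<omega>\<in>UNIV. of_real (weight \<omega>) * integ (f \<omega>))"
  proof (rule sum.cong[OF refl])
    fix \<omega>
    have "integ (f \<omega>) = integ (boxsum (A \<omega>) (J \<omega>) (c \<omega>))" using f by (rule integ_cong)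
    also have "\<dots> = (\<Sum>v\<in>A \<omega>. of_real (measure (lam_mu D) (Pi UNIV (J \<omega> v))) * c \<omega> v)"
      by (rule integ_boxsum[OF A J])
    finally show "(\<Sum>v\<in>A \<omega>. of_real (measure (lam_mu D) (Pi UNIV (kap_index J (\<omega>, v)))) * c \<omega> v) =
        of_real (weight \<omega>) * integ (f \<omega>)"
      by (simp add: m sum_distrib_left mult.assoc)
  qed
  finally show "integ (juxt D f) = (\<Sum>\<omega>\<in>UNIV. of_real (weight \<omega>) * integ (f \<omega>))" .
  have "l1 (juxt D f) \<le>
      (\<Sum>p\<in>(SIGMA \<omega>:UNIV. A \<omega>). measure (lam_mu D) (Pi UNIV (kap_index J p)) * norm ((\<lambda>(\<omega>, a). c \<omega> a) p))"
    unfolding juxt by (rule l1_boxsum_le[OF fin pcs])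
  also have "\<dots> = (\<Sum>\<omega>\<in>UNIV. \<Sum>v\<in>A \<omega>. measure (lam_mu D) (Pi UNIV (kap_index J (\<omega>, v))) * norm (c \<omega> v))"
    using A by (subst sum.Sigma) (auto intro!: sum.cong)
  also have "\<dots> \<le> (\<Sum>\<omega>\<in>UNIV. l1 (f \<omega>))"
  proof (rule sum_mono)
    fix \<omega>
    have "l1 (f \<omega>) = (\<Sum>v\<in>A \<omega>. norm (c \<omega> v) * measure (lam_mu D) (Pi UNIV v))"
      unfolding A_def by (rule gridded_cells_rep(2)[OF P c])
    moreover have "measure (lam_mu D) (Pi UNIV (kap_index J (\<omega>, v))) * norm (c \<omega> v) \<le>
        norm (c \<omega> v) * measure (lam_mu D) (Pi UNIV v)" if "v \<in> A \<omega>" for v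
      using mult_right_mono[OF weight_le_1[of \<omega>], of "measure (lam_mu D) (Pi UNIV v) * norm (c \<omega> v)"] m[OF that]
      by (simp add: J_def ac_simps)
    ultimately show "(\<Sum>v\<in>A \<omega>. measure (lam_mu D) (Pi UNIV (kap_index J (\<omega>, v))) * norm (c \<omega> v)) \<le> l1 (f \<omega>)"
      by (simp add: sum_mono)
  qed
  finally show "l1 (juxt D f) \<le> (\<Sum>\<omega>\<in>UNIV. l1 (f \<omega>))" .
qed

lemma juxt_add: "juxt D (\<lambda>\<omega> y. f \<omega> y + g \<omega> y) x = juxt D f x + juxt D g x"
  unfolding juxt_def distrib_left sum.distrib ..

lemma juxt_diff: "juxt D (\<lambda>\<omega> y. f \<omega> y - g \<omega> y) x = juxt D f x - juxt D g x"
  unfolding juxt_def right_diff_distrib sum_subtractf ..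

lemma juxt_scale: "juxt D (\<lambda>\<omega> y. r * f \<omega> y) x = r * juxt D f x"
  unfolding juxt_def mult.left_commute[of _ r] sum_distrib_left[symmetric] ..

text \<open>Replacing the components by others in the same classes changes the juxtaposition by a function
  whose \<open>L\<^sup>1\<close> norm is at most the sum of the norms of the changes, which is zero.\<close>

lemma S_juxt_class:
  assumes f: "\<And>\<omega>. gridded D (f \<omega>)"
  shows "S_juxt D (\<lambda>\<omega>. ae_class D (f \<omega>)) = ae_class D (juxt D f)"
proof -
  have eq: "ae_class D (juxt D g) = ae_class D (juxt D f)"
    if g: "\<forall>\<omega>. g \<omega> \<in> ae_class D (f \<omega>) \<inter> elementary D" for g
  proof -
    have gg: "gridded D (g \<omega>)" for \<omega> using g elementary_gridded by blast
    have "l1 (\<lambda>x. g \<omega> x - f \<omega> x) = 0" for \<omega>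
    proof -
      have "ae_class D (g \<omega>) = ae_class D (f \<omega>)" using g by (simp add: in_ae_class_iff ae_class_eq_iff)
      then show ?thesis using ae_class_eq_iff_l1[OF gg f] by simp
    qed
    moreover have "juxt D (\<lambda>\<omega> x. g \<omega> x - f \<omega> x) = (\<lambda>x. juxt D g x - juxt D f x)"
      by (intro ext juxt_diff)
    ultimately have "l1 (\<lambda>x. juxt D g x - juxt D f x) \<le> 0"
      using l1_juxt[of "\<lambda>\<omega> x. g \<omega> x - f \<omega> x", OF gridded_diff[OF gg f]] by simp
    then have "l1 (\<lambda>x. juxt D g x - juxt D f x) = 0" by (simp add: antisym)
    then show ?thesis using ae_class_eq_iff_l1[OF gridded_juxt[OF gg] gridded_juxt[OF f]] by simp
  qed
  have "\<exists>g. g \<in> ae_class D (f \<omega>) \<inter> elementary D" for \<omega>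
  proof -
    obtain t c J g where g: "elementary_rep D t c J g" "ae_class D (f \<omega>) = ae_class D g"
      using f by (rule gridded_rep)
    then have "g \<in> elementary D" unfolding elementary_def by blast
    then show ?thesis using g(2) ae_class_self[of g] by auto
  qed
  then obtain g where "\<forall>\<omega>. g \<omega> \<in> ae_class D (f \<omega>) \<inter> elementary D" by metis
  then show ?thesis unfolding S_juxt_def using eq by blast
qed

lemma S_juxt_bounded: "bounded_tuple_hom 1 (S_mod D) (S_juxt D)"
proof -
  have rep: "\<exists>f. (\<forall>\<omega>. gridded D (f \<omega>)) \<and> F = (\<lambda>\<omega>. ae_class D (f \<omega>))"
    if "\<forall>\<omega>. F \<omega> \<in> mcarrier (S_mod D)" for F :: "('n \<Rightarrow> bool) \<Rightarrow> (('n \<Rightarrow> 'k) \<Rightarrow> 'k) set"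
    using that unfolding S_carrier by metis
  show ?thesis
    unfolding bounded_tuple_hom_def mod_hom_direct_sum
  proof (intro conjI allI impI)
    fix F :: "('n \<Rightarrow> bool) \<Rightarrow> (('n \<Rightarrow> 'k) \<Rightarrow> 'k) set" assume F: "\<forall>\<omega>. F \<omega> \<in> mcarrier (S_mod D)"
    obtain f where f: "\<And>\<omega>. gridded D (f \<omega>)" "F = (\<lambda>\<omega>. ae_class D (f \<omega>))" using rep[OF F] by blast
    show "S_juxt D F \<in> mcarrier (S_mod D)"
      unfolding f(2) S_juxt_class[OF f(1)] by (intro S_closed gridded_juxt f)
    show "mnorm (S_mod D) (S_juxt D F) \<le> 1 * (\<Sum>\<omega>\<in>UNIV. mnorm (S_mod D) (F \<omega>))"
      using l1_juxt[OF f(1)] unfolding f(2) S_juxt_class[OF f(1)]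
      by (simp add: S_norm gridded_juxt f(1))
    fix r
    show "S_juxt D (\<lambda>\<omega>. mact (S_mod D) r (F \<omega>)) = mact (S_mod D) r (S_juxt D F)"
      unfolding f(2) S_act S_juxt_class[OF f(1)] S_juxt_class[OF gridded_scale[OF f(1)]] juxt_scale ..
    fix G :: "('n \<Rightarrow> bool) \<Rightarrow> (('n \<Rightarrow> 'k) \<Rightarrow> 'k) set" assume G: "\<forall>\<omega>. G \<omega> \<in> mcarrier (S_mod D)"
    obtain g where g: "\<And>\<omega>. gridded D (g \<omega>)" "G = (\<lambda>\<omega>. ae_class D (g \<omega>))" using rep[OF G] by blast
    show "S_juxt D (\<lambda>\<omega>. madd (S_mod D) (F \<omega>) (G \<omega>)) = madd (S_mod D) (S_juxt D F) (S_juxt D G)"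
      unfolding f(2) g(2) S_add S_juxt_class[OF f(1)] S_juxt_class[OF g(1)]
        S_juxt_class[OF gridded_add[OF f(1) g(1)]] juxt_add ..
  qed
qed

text \<open>The set of points with \<open>i\<close>-th coordinate \<open>\<xi>\<close> is a box with one degenerate side.\<close>

lemma AE_off_mid: "AE x in rho. \<forall>i. x i \<noteq> mid D"
proof (rule eventually_all_finite)
  fix i
  let ?v = "\<lambda>j :: 'n. if j = i then {mid D} else base_ivl D"
  have "{mid D} = up D True (mid D) \<inter> dn D True (mid D)"
    by (auto simp: up_def dn_def intro: leq_antisym)
  then have pcs: "?v j \<in> pieces D" for j using base_piece piecesI[OF mid_in mid_in] by simp
  have "measure (lam_mu D) (Pi UNIV ?v) = 0"
    using box_measure[of ?v] piece_measurable[OF pcs] by (simp add: prod_zero_iff)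
  then have "measure rho (Pi UNIV ?v) = 0" using box_subset[OF pcs] by (simp add: measure_rho)
  then have "emeasure rho (Pi UNIV ?v) = 0"
    using finite_measure.emeasure_eq_measure[OF finite_rho] by simp
  then show "AE x in rho. x i \<noteq> mid D"
    by (rule AE_I[rotated]) (auto simp: lam_ivl_def box_sets_rho[OF pcs])
qed

text \<open>Away from \<open>\<xi>\<close> every point lies in exactly one of the transported boxes, namely the one whose word
  records which coordinates are to the right of \<open>\<xi>\<close>.\<close>

lemma juxt_const: "ae_class D (juxt D (\<lambda>_ _. c)) = ae_class D (\<lambda>_. c)"
  unfolding ae_class_eq_iff
  using AE_off_mid AE_space
proof eventually_elim
  fix x assume mid: "\<forall>i. x i \<noteq> mid D" and "x \<in> space rho"
  then have xI: "x i \<in> base_ivl D" for i by (auto simp: lam_ivl_def)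
  have "x i \<in> kap D e ` base_ivl D \<longleftrightarrow> e = leq D (mid D) (x i)" for i e
    using mid xI[of i] leq_not[of "mid D" "x i"] leq_antisym[of "mid D" "x i"]
    unfolding kap_image by (cases e) (auto simp: cc_ivl_def in_base)
  then have "x \<in> Pi UNIV (\<lambda>i. kap D (\<omega> i) ` base_ivl D) \<longleftrightarrow> \<omega> = (\<lambda>i. leq D (mid D) (x i))" for \<omega>
    by (auto simp: Pi_iff fun_eq_iff)
  then have "juxt D (\<lambda>_ _. c) x = (\<Sum>\<omega>\<in>UNIV. if \<omega> = (\<lambda>i. leq D (mid D) (x i)) then c else 0)"
    unfolding juxt_def by (intro sum.cong) (auto simp: indicator_def)
  then show "juxt D (\<lambda>_ _. c) x = c" by simp
qed

lemma S_one_eq: "S_one D = ae_class D (\<lambda>_. 1)"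
  by (simp add: S_one_def)

lemma S_juxt_const: "S_juxt D (\<lambda>_. ae_class D (\<lambda>_. c)) = ae_class D (\<lambda>_. c)"
  using S_juxt_class[of "\<lambda>_ _. c"] gridded_const[of D c] by (simp add: juxt_const)

lemma integ_const: "integ (\<lambda>_. c :: 'k) = of_real (lam_mass D) * c"
proof -
  have "integ (\<lambda>_. c) = integ (boxsum {()} (\<lambda>_ _. base_ivl D) (\<lambda>_. c))"
    by (intro integ_cong) (simp add: boxsum_def lam_ivl_def)
  also have "\<dots> = of_real (lam_mass D) * c"
    using integ_boxsum[of "{()}" "\<lambda>_ _. base_ivl D" "\<lambda>_. c"] base_piece by (simp add: lam_ivl_def)
  finally show ?thesis .
qed

lemma level_pt_0: "level_pt D u 0 = lft D"
  using kap_lft[of False] by (induction u) (simp_all add: kap_def)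

lemma level_pt_last: "level_pt D u (2 ^ u) = rgt D"
  using kap_rgt[of True] by (induction u) (simp_all add: kap_def mult_2)

lemma level_pt_kapA: "s \<le> 2 ^ u \<Longrightarrow> level_pt D (Suc u) s = kap D False (level_pt D u s)"
  by (simp add: kap_def)

text \<open>At \<open>s = 0\<close> the defining equation uses \<open>\<kappa>\<^sub>a\<close> instead of \<open>\<kappa>\<^sub>b\<close>; both yield \<open>\<xi>\<close>.\<close>

lemma level_pt_kapB: "level_pt D (Suc u) (s + 2 ^ u) = kap D True (level_pt D u s)"
  using kap_lft[of True] kap_rgt[of False]
  by (cases "s = 0") (simp_all add: kap_def level_pt_0 level_pt_last)

lemma level_pt_in: "s \<le> 2 ^ u \<Longrightarrow> level_pt D u s \<in> base_ivl D"
proof (induction u arbitrary: s)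
  case (Suc u)
  show ?case
  proof (cases "s \<le> 2 ^ u")
    case True
    then show ?thesis using Suc.IH kap_in[of _ False] by (simp only: level_pt_kapA)
  next
    case False
    then obtain r where r: "s = r + 2 ^ u" by (metis add.commute le_add_diff_inverse nat_le_linear)
    then show ?thesis using Suc.prems Suc.IH[of r] kap_in[of _ True] by (simp only: level_pt_kapB) simp
  qed
qed simp

lemma level_ivl_eq: "level_ivl D u s = up D True (level_pt D u s) \<inter> dn D True (level_pt D u (Suc s))"
  by (simp add: level_ivl_def cc_ivl_eq)

lemma level_ivl_piece: "s < 2 ^ u \<Longrightarrow> level_ivl D u s \<in> pieces D"
  unfolding level_ivl_eq by (intro piecesI level_pt_in) auto

lemma level_ivl_kap:
  assumes "s < 2 ^ u"
  shows "kap D e ` level_ivl D u s = level_ivl D (Suc u) (s + (if e then 2 ^ u else 0))"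
proof -
  have "kap D e ` level_ivl D u s =
      up D True (kap D e (level_pt D u s)) \<inter> dn D True (kap D e (level_pt D u (Suc s)))"
    unfolding level_ivl_eq using assms by (intro kap_up_dn level_pt_in) auto
  also have "\<dots> = level_ivl D (Suc u) (s + (if e then 2 ^ u else 0))"
    using assms level_pt_kapA[of s u] level_pt_kapA[of "Suc s" u] level_pt_kapB[of u s] level_pt_kapB[of u "Suc s"]
    unfolding level_ivl_eq by (cases e) (simp_all del: level_pt.simps)
  finally show ?thesis .
qed

definition indices :: "nat \<Rightarrow> ('n \<Rightarrow> nat) set" where "indices u = {v. \<forall>i. v i < 2 ^ u}"

lemma finite_indices: "finite (indices u)"
proof -
  have "indices u = PiE UNIV (\<lambda>_. {..<2 ^ u})" by (auto simp: indices_def)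
  then show ?thesis by (simp add: finite_PiE)
qed

abbreviation level_boxes :: "nat \<Rightarrow> ('n \<Rightarrow> nat) \<Rightarrow> 'n \<Rightarrow> 'k set" where
  "level_boxes u \<equiv> (\<lambda>v i. level_ivl D u (v i))"

lemma step_fun_boxsum: "step_fun D u c = boxsum (indices u) (level_boxes u) c"
  by (intro ext) (simp only: step_fun_def boxsum_def indices_def level_box_def)

lemma level_boxes_pieces: "v \<in> indices u \<Longrightarrow> level_boxes u v i \<in> pieces D"
  by (simp add: indices_def level_ivl_piece)

lemma gridded_step: "gridded D (step_fun D u c)"
  unfolding step_fun_boxsum by (rule gridded_boxsum[OF finite_indices level_boxes_pieces])

text \<open>In passing to level \<open>u + 1\<close>, \<open>\<kappa>\<^sub>a\<close> keeps the position of an interval of level \<open>u\<close> and \<open>\<kappa>\<^sub>b\<close> shifts it by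
  \<open>2\<^sup>u\<close>. So the word \<open>\<omega>\<close> consists of the leading binary digits of the new indices. The identity holds
  pointwise, not only almost everywhere.\<close>

lemma juxt_step:
  "juxt D (\<lambda>\<omega>. step_fun D u (c \<omega>)) =
     step_fun D (Suc u) (\<lambda>v. c (\<lambda>i. 2 ^ u \<le> v i) (\<lambda>i. v i mod 2 ^ u))"
proof
  fix x
  let ?c = "\<lambda>v. c (\<lambda>i. 2 ^ u \<le> v i) (\<lambda>i. v i mod 2 ^ u)"
  \<comment> \<open>Writes the letters of a word in front of the binary digits of the indices.\<close>
  let ?join = "\<lambda>(\<omega> :: 'n \<Rightarrow> bool, v :: 'n \<Rightarrow> nat) i. v i + (if \<omega> i then 2 ^ u else 0)"
  have "juxt D (\<lambda>\<omega>. step_fun D u (c \<omega>)) x =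
      boxsum (SIGMA \<omega>:UNIV. indices u) (kap_index (\<lambda>_. level_boxes u)) (\<lambda>(\<omega>, a). c \<omega> a) x"
    by (rule juxt_eq_boxsum[OF finite_indices level_boxes_pieces]) (simp_all only: step_fun_boxsum)
  also have "\<dots> = (\<Sum>p\<in>(SIGMA \<omega>:UNIV. indices u). ?c (?join p) * indicator (Pi UNIV (level_boxes (Suc u) (?join p))) x)"
    unfolding boxsum_def
  proof (rule sum.cong[OF refl])
    fix p :: "('n \<Rightarrow> bool) \<times> ('n \<Rightarrow> nat)" assume "p \<in> (SIGMA \<omega>:UNIV. indices u)"
    then obtain \<omega> v where p: "p = (\<omega>, v)" and v: "\<And>i. v i < 2 ^ u" by (auto simp: indices_def)
    have "kap_index (\<lambda>_. level_boxes u) p = level_boxes (Suc u) (?join p)"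
      unfolding p kap_index_def by (intro ext) (simp only: prod.case level_ivl_kap[OF v])
    moreover have "(\<lambda>i. 2 ^ u \<le> ?join p i) = \<omega>" "(\<lambda>i. ?join p i mod 2 ^ u) = v"
      unfolding p using v by (auto simp: fun_eq_iff not_le)
    ultimately show "(case p of (\<omega>, a) \<Rightarrow> c \<omega> a) * indicator (Pi UNIV (kap_index (\<lambda>_. level_boxes u) p)) x =
        ?c (?join p) * indicator (Pi UNIV (level_boxes (Suc u) (?join p))) x"
      by (simp only: p prod.case)
  qed
  also have "\<dots> = (\<Sum>v\<in>indices (Suc u). ?c v * indicator (Pi UNIV (level_boxes (Suc u) v)) x)"
  proof (rule sum.reindex_bij_betw, rule bij_betwI)
    show "?join \<in> (SIGMA \<omega>:UNIV. indices u) \<rightarrow> indices (Suc u)"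
    proof
      fix p :: "('n \<Rightarrow> bool) \<times> ('n \<Rightarrow> nat)" assume "p \<in> (SIGMA \<omega>:UNIV. indices u)"
      then obtain \<omega> v where p: "p = (\<omega>, v)" and v: "\<And>i. v i < 2 ^ u" by (auto simp: indices_def)
      have "v i + (if \<omega> i then 2 ^ u else 0) < 2 ^ Suc u" for i using v[of i] by simp
      then show "?join p \<in> indices (Suc u)" by (simp add: p indices_def)
    qed
    show "(\<lambda>v. (\<lambda>i. 2 ^ u \<le> v i, \<lambda>i. v i mod 2 ^ u)) \<in> indices (Suc u) \<rightarrow> (SIGMA \<omega>:UNIV. indices u)"
      by (auto simp: indices_def)
    show "(\<lambda>i. 2 ^ u \<le> ?join p i, \<lambda>i. ?join p i mod 2 ^ u) = p" if "p \<in> (SIGMA \<omega>:UNIV. indices u)" for p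
      using that by (auto simp: indices_def fun_eq_iff not_le)
    show "?join (\<lambda>i. 2 ^ u \<le> v i, \<lambda>i. v i mod 2 ^ u) = v" if v: "v \<in> indices (Suc u)" for v
    proof
      fix i
      have "v i < 2 ^ u + 2 ^ u" using v by (simp add: indices_def mult_2)
      then show "?join (\<lambda>i. 2 ^ u \<le> v i, \<lambda>i. v i mod 2 ^ u) i = v i"
        by (cases "2 ^ u \<le> v i") (simp_all add: le_mod_geq)
    qed
  qed
  also have "\<dots> = step_fun D (Suc u) ?c x"
    unfolding step_fun_boxsum boxsum_def ..
  finally show "juxt D (\<lambda>\<omega>. step_fun D u (c \<omega>)) x = step_fun D (Suc u) ?c x" .
qed

lemma indices_0: "indices 0 = {\<lambda>_. 0}"
  by (auto simp: indices_def)

lemma step_0: "x \<in> lam_ivl D \<Longrightarrow> step_fun D 0 c x = c (\<lambda>_. 0)"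
  unfolding step_fun_boxsum boxsum_def indices_0
  by (simp add: level_ivl_def lam_ivl_def base_ivl_def)

text \<open>Constants are fixed by juxtaposition, so the claim at one level carries over to the next.\<close>

lemma const_step: "ae_class D (\<lambda>_. c) = ae_class D (step_fun D u (\<lambda>_. c))"
proof (induction u)
  case 0
  show ?case by (rule ae_class_cong) (simp add: step_0)
next
  case (Suc u)
  have "ae_class D (\<lambda>_. c) = S_juxt D (\<lambda>_. ae_class D (\<lambda>_. c))" by (simp add: S_juxt_const)
  also have "\<dots> = ae_class D (juxt D (\<lambda>_. step_fun D u (\<lambda>_. c)))"
    unfolding Suc.IH by (rule S_juxt_class[OF gridded_step])
  also have "\<dots> = ae_class D (step_fun D (Suc u) (\<lambda>_. c))" by (simp add: juxt_step)
  finally show ?case .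
qed

text \<open>The defining sum of \<open>T\<^sub>u\<close> is the integral, which depends on the class only.\<close>

lemma T_level_step: "T_level D u (ae_class D (step_fun D u c)) = integ (step_fun D u c)"
proof -
  have sum: "(\<Sum>v\<in>{v. \<forall>i. v i < 2 ^ u}. c v * of_real (measure (lam_mu D) (level_box D u v))) = integ (step_fun D u c)" for c
  proof -
    have "integ (step_fun D u c) =
        (\<Sum>v\<in>indices u. of_real (measure (lam_mu D) (Pi UNIV (level_boxes u v))) * c v)"
      unfolding step_fun_boxsum by (rule integ_boxsum[OF finite_indices level_boxes_pieces])
    then show ?thesis by (simp add: indices_def level_box_def mult.commute)
  qed
  show ?thesis
    unfolding T_level_def sum
    using integ_ae_cong[OF gridded_step gridded_step] by (intro the_equality) metis+
qed

text \<open>The constants are step functions of level \<open>u\<close>, so that \<open>T\<^sub>u\<^sub>+\<^sub>1\<close> is applied to a step function of its own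
  level and computes the integral of the juxtaposition.\<close>

lemma m_map_eq: "m_map D u x = (\<Sum>\<omega>\<in>UNIV. of_real (weight \<omega>) * x \<omega>)"
proof -
  let ?c = "\<lambda>\<omega>. x \<omega> / of_real (lam_mass D)"
  have "S_juxt D (\<lambda>\<omega>. ae_class D (\<lambda>_. ?c \<omega>)) = ae_class D (juxt D (\<lambda>\<omega>. step_fun D u (\<lambda>_. ?c \<omega>)))"
    unfolding const_step[where u = u] by (rule S_juxt_class[OF gridded_step])
  then have "m_map D u x = integ (juxt D (\<lambda>\<omega>. step_fun D u (\<lambda>_. ?c \<omega>)))"
    unfolding m_map_def by (simp only: juxt_step T_level_step)
  also have "\<dots> = (\<Sum>\<omega>\<in>UNIV. of_real (weight \<omega>) * integ (step_fun D u (\<lambda>_. ?c \<omega>)))"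
    by (rule integ_juxt[OF gridded_step])
  also have "\<dots> = (\<Sum>\<omega>\<in>UNIV. of_real (weight \<omega>) * x \<omega>)"
  proof (rule sum.cong[OF refl])
    fix \<omega>
    have "integ (step_fun D u (\<lambda>_. ?c \<omega>)) = integ (\<lambda>_. ?c \<omega>)"
      using integ_ae_cong[OF gridded_const gridded_step const_step[of "?c \<omega>" u]] by simp
    also have "\<dots> = x \<omega>" using lam_mass_pos by (simp add: integ_const)
    finally show "of_real (weight \<omega>) * integ (step_fun D u (\<lambda>_. ?c \<omega>)) = of_real (weight \<omega>) * x \<omega>" by simp
  qed
  finally show ?thesis .
qed

end

section \<open>The integral on the completion\<close>

context integration
begin

lemma k_simps [simp]:
  "mcarrier (k_mod D) = UNIV" "madd (k_mod D) = (+)" "mzero (k_mod D) = 0"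
  "mact (k_mod D) = (\<lambda>r x. tau D r * x)" "mnorm (k_mod D) = norm"
  by (simp_all add: k_mod_def)

lemma k_normed_left_module: "normed_left_module (tau D) (k_mod D)"
proof (rule normed_left_moduleI)
  have "\<exists>y. x + y = 0" for x :: 'k by (rule exI[of _ "- x"]) simp
  then show "normed_module (tau D) (k_mod D)"
    by (simp add: normed_module_def left_module_def tau_one tau_mult tau_add algebra_simps norm_mult norm_triangle_ineq)
qed (simp add: tau_minus_one)

lemma k_mdist [simp]: "mdist (k_mod D) x y = norm (x - y)"
  by (simp add: mdist_def tau_minus_one)

lemma expo_pos: "0 < expo D"
  using expo_ge_1 by simp

text \<open>A Cauchy sequence of scalars is moved to the coordinate axis of one basis vector, where the norm of the
  algebra is a multiple of the norm of the field. The coordinate of the limit in the algebra along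
  that basis vector is the limit of the scalars.\<close>

lemma k_complete:
  assumes y: "mCauchy (k_mod D) y"
  shows "\<exists>L. (\<lambda>j. norm (y j - L)) \<longlonglongrightarrow> 0"
proof -
  interpret finite_dimensional_vector_space "scl D" "range (bas D)"
    using algebra by (simp add: algebra_data_def)
  fix i0 :: 'n
  define b where "b = bas D i0"
  define w where "w = wgt D i0"
  define R where "R x = representation (range (bas D)) x" for x
  have w: "0 < w" using algebra by (simp add: algebra_data_def w_def)
  have inj: "inj (bas D)" using algebra by (simp add: algebra_data_def)
  have span: "x \<in> span (range (bas D))" for x using span_Basis by simp
  have Rb: "R (scl D c b) (bas D i) = (if i = i0 then c else 0)" for c i
    using representation_scale[OF independent_Basis span, of c b] representation_basis[OF independent_Basis, of b] inj
    by (auto simp: R_def b_def inj_eq)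
  have Rdiff: "R (x - z) v = R x v - R z v" for x z v
    using representation_diff[OF independent_Basis span span] by (simp add: R_def)
  have norm_axis: "alg_norm D (scl D c b) = norm c * w" for c
  proof -
    have "(\<Sum>i\<in>UNIV. (norm (R (scl D c b) (bas D i)) * wgt D i) powr expo D) =
        (\<Sum>i\<in>UNIV. if i = i0 then (norm c * w) powr expo D else 0)"
      by (intro sum.cong) (auto simp: Rb w_def)
    then show ?thesis using w expo_pos by (simp add: alg_norm_def R_def powr_powr)
  qed
  have coord_le: "norm (R x b) * w \<le> alg_norm D x" for x
  proof -
    have "(norm (R x (bas D i0)) * wgt D i0) powr expo D \<le>
        (\<Sum>i\<in>UNIV. (norm (R x (bas D i)) * wgt D i) powr expo D)"
      by (intro member_le_sum) auto
    then have "((norm (R x b) * w) powr expo D) powr (1 / expo D) \<le> alg_norm D x"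
      unfolding alg_norm_def R_def b_def w_def using expo_pos by (intro powr_mono2) auto
    then show ?thesis using w expo_pos by (simp add: powr_powr)
  qed
  have diff: "scl D (y i) b - scl D (y j) b = scl D (y i - y j) b" for i j
    by (simp add: scale_left_diff_distrib)
  have "\<forall>e>0. \<exists>K. \<forall>i\<ge>K. \<forall>j\<ge>K. alg_norm D (scl D (y i) b - scl D (y j) b) < e"
  proof (intro allI impI)
    fix e :: real assume "0 < e"
    then have "0 < e / w" using w by simp
    then obtain K where "\<forall>i\<ge>K. \<forall>j\<ge>K. norm (y i - y j) < e / w"
      using y unfolding mCauchy_def k_mdist by blast
    then show "\<exists>K. \<forall>i\<ge>K. \<forall>j\<ge>K. alg_norm D (scl D (y i) b - scl D (y j) b) < e"
      unfolding diff norm_axis using w by (simp add: pos_less_divide_eq) blast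
  qed
  then obtain L where L: "(\<lambda>j. alg_norm D (scl D (y j) b - L)) \<longlonglongrightarrow> 0"
    using algebra unfolding algebra_data_def by (elim conjE allE[of _ "\<lambda>j. scl D (y j) b"]) blast
  have le: "norm (y j - R L b) \<le> alg_norm D (scl D (y j) b - L) / w" for j
    using coord_le[of "scl D (y j) b - L"] Rb[of "y j" i0] w by (simp add: Rdiff b_def pos_le_divide_eq)
  have "(\<lambda>j. alg_norm D (scl D (y j) b - L) / w) \<longlonglongrightarrow> 0"
    using tendsto_divide[OF L tendsto_const[of w]] w by simp
  from tendsto_sandwich[OF always_eventually always_eventually tendsto_const this]
  have "(\<lambda>j. norm (y j - R L b)) \<longlonglongrightarrow> 0" by (simp add: le)
  then show ?thesis by blast
qed

lemma k_banach: "banach_module (tau D) (k_mod D)"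
proof -
  interpret k: normed_left_module "tau D" "k_mod D" by (rule k_normed_left_module)
  have "X \<in> cembed (k_mod D) ` mcarrier (k_mod D)" if X: "X \<in> mcarrier (mcompletion (k_mod D))" for X
  proof -
    obtain y where y: "mCauchy (k_mod D) y" "X = cclass (k_mod D) y"
      using X by (rule k.completion_carrierE)
    obtain L where "(\<lambda>j. norm (y j - L)) \<longlonglongrightarrow> 0" using k_complete[OF y(1)] by blast
    then have "X = cembed (k_mod D) L"
      using y k.cclass_eq_iff[OF y(1) k.mCauchy_const[of L]] by (simp add: cembed_def)
    then show ?thesis by simp
  qed
  then show ?thesis using k.normed k.cembed_closed unfolding banach_module_def by blast
qed

sublocale S: normed_left_module "tau D" "S_mod D" by (rule S_normed_left_module)
sublocale k: normed_left_module "tau D" "k_mod D" by (rule k_normed_left_module)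
sublocale Sh: normed_left_module "tau D" "mcompletion (S_mod D)"
  by (rule S.completion_normed_left_module)
sublocale Sk: two_modules "tau D" "S_mod D" "k_mod D" by unfold_locales
sublocale Shk: two_modules "tau D" "mcompletion (S_mod D)" "k_mod D" by unfold_locales
sublocale SS: two_modules "tau D" "S_mod D" "S_mod D" by unfold_locales

definition S_integ :: "(('n \<Rightarrow> 'k) \<Rightarrow> 'k) set \<Rightarrow> 'k" where
  "S_integ F = integ (SOME f. gridded D f \<and> F = ae_class D f)"

lemma S_integ_class: assumes "gridded D f" shows "S_integ (ae_class D f) = integ f"
proof -
  let ?g = "SOME g. gridded D g \<and> ae_class D f = ae_class D g"
  have "\<exists>g. gridded D g \<and> ae_class D f = ae_class D g" using assms by blast
  then have g: "gridded D ?g \<and> ae_class D f = ae_class D ?g" by (rule someI_ex)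
  have "integ ?g = integ f" by (rule integ_ae_cong) (use g assms in simp_all)
  then show ?thesis by (simp add: S_integ_def)
qed

lemma S_integ_hom: "mod_hom (S_mod D) (k_mod D) S_integ"
  unfolding mod_hom_def
proof (intro conjI ballI allI)
  fix F assume "F \<in> mcarrier (S_mod D)"
  then obtain f where f: "gridded D f" "F = ae_class D f" by (rule S_carrierE)
  show "S_integ F \<in> mcarrier (k_mod D)" by simp
  show "S_integ (mact (S_mod D) r F) = mact (k_mod D) r (S_integ F)" for r
    using f by (simp add: S_act S_integ_class gridded_scale integ_scale)
  fix G assume "G \<in> mcarrier (S_mod D)"
  then obtain g where g: "gridded D g" "G = ae_class D g" by (rule S_carrierE)
  show "S_integ (madd (S_mod D) F G) = madd (k_mod D) (S_integ F) (S_integ G)"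
    using f g by (simp add: S_add S_integ_class gridded_add integ_add)
qed

lemma S_integ_bound:
  assumes "F \<in> mcarrier (S_mod D)" shows "norm (S_integ F) \<le> mnorm (S_mod D) F"
proof -
  obtain f where "gridded D f" "F = ae_class D f" using assms by (rule S_carrierE)
  then show ?thesis by (simp add: S_integ_class S_norm norm_integ_le)
qed

lemma S_integ_juxt:
  assumes "\<And>\<omega>. F \<omega> \<in> mcarrier (S_mod D)"
  shows "S_integ (S_juxt D F) = m_map D u (\<lambda>\<omega>. S_integ (F \<omega>))"
proof -
  obtain f where f: "\<And>\<omega>. gridded D (f \<omega>)" "\<And>\<omega>. F \<omega> = ae_class D (f \<omega>)"
    using assms unfolding S_carrier by metis
  have "F = (\<lambda>\<omega>. ae_class D (f \<omega>))" using f(2) by (rule ext)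
  then show ?thesis
    using f(1) by (simp add: S_juxt_class S_integ_class gridded_juxt integ_juxt m_map_eq)
qed

text \<open>The integral of \<open>|f|\<close> is the norm of \<open>f\<close>. This reduces \<open>|T f| \<le> T |f|\<close> to the contraction property.\<close>

lemma S_integ_abs:
  assumes "F \<in> mcarrier (S_mod D)" shows "S_integ (S_abs D F) = of_real (mnorm (S_mod D) F)"
proof -
  obtain f where f: "gridded D f" "F = ae_class D f" using assms by (rule S_carrierE)
  have "integ (\<lambda>x. of_real (norm (f x)) :: 'k) = of_real (integ (\<lambda>x. norm (f x)))"
    by (rule simple_bochner_integral_linear[OF bounded_linear.linear[OF bounded_linear_of_real]
          gridded_simple[OF gridded_compose1[OF f(1), of norm]]])
  then show ?thesis
    using f gridded_compose1[OF f(1), of "\<lambda>y. of_real (norm y) :: 'k"]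
    by (simp add: S_abs_class S_integ_class S_norm l1_def)
qed

lemma S_abs_lipschitz: "SS.lipschitz_tuple 1 (\<lambda>F::unit \<Rightarrow> _. S_abs D (F ()))"
proof -
  have g: "gridded D (\<lambda>x. of_real (norm (f x)) :: 'k)" if "gridded D f" for f :: "_ \<Rightarrow> 'k"
    using gridded_compose1[OF that, of "\<lambda>y. of_real (norm y) :: 'k"] .
  have "S_abs D F \<in> mcarrier (S_mod D)" if F: "F \<in> mcarrier (S_mod D)" for F
  proof -
    obtain f where "gridded D f" "F = ae_class D f" using F by (rule S_carrierE)
    then show ?thesis using g by (simp add: S_abs_class)
  qed
  moreover have "mdist (S_mod D) (S_abs D F) (S_abs D G) \<le> mdist (S_mod D) F G"
    if F: "F \<in> mcarrier (S_mod D)" and G: "G \<in> mcarrier (S_mod D)" for F G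
  proof -
    obtain f where f: "gridded D f" "F = ae_class D f" using F by (rule S_carrierE)
    obtain h where h: "gridded D h" "G = ae_class D h" using G by (rule S_carrierE)
    have "l1 (\<lambda>x. of_real (norm (f x)) - of_real (norm (h x))) \<le> l1 (\<lambda>x. f x - h x)"
    proof (rule l1_mono[OF gridded_diff[OF g[OF f(1)] g[OF h(1)]] gridded_diff[OF f(1) h(1)]])
      fix x
      have "norm (of_real (norm (f x)) - of_real (norm (h x)) :: 'k) = \<bar>norm (f x) - norm (h x)\<bar>"
        by (metis norm_of_real of_real_diff)
      also have "\<dots> \<le> norm (f x - h x)" by (rule norm_triangle_ineq3)
      finally show "norm (of_real (norm (f x)) - of_real (norm (h x)) :: 'k) \<le> norm (f x - h x)" .
    qed
    then show ?thesis using f h g by (simp add: S_abs_class S_mdist)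
  qed
  ultimately show ?thesis by (simp add: SS.lipschitz_tuple_def UNIV_unit)
qed

lemma S_integ_one: "S_integ (S_one D) = of_real (lam_mass D)"
  by (simp add: S_one_eq S_integ_class gridded_const integ_const)

text \<open>Apply compatibility of integration with juxtaposition to the constant function \<open>1\<close>.\<close>

lemma weight_sum: "(\<Sum>\<omega>\<in>UNIV. of_real (weight \<omega>) :: 'k) = 1"
proof -
  have "m_map D 0 (\<lambda>_. S_integ (S_one D)) = S_integ (S_one D)"
    using S_integ_juxt[of "\<lambda>_. S_one D" 0] by (simp add: S_one_eq S_juxt_const gridded_const)
  then have "(\<Sum>\<omega>\<in>UNIV. of_real (weight \<omega>)) * (of_real (lam_mass D) :: 'k) = of_real (lam_mass D)"
    by (simp add: S_integ_one m_map_eq sum_distrib_right)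
  then show ?thesis using lam_mass_pos by simp
qed

lemma m_map_bounded: "bounded_tuple_hom 1 (k_mod D) (m_map D u)"
proof -
  have "norm (m_map D u x) \<le> (\<Sum>\<omega>\<in>UNIV. norm (x \<omega>))" for x
    unfolding m_map_eq
  proof (rule order_trans[OF norm_sum sum_mono])
    fix \<omega>
    show "norm (of_real (weight \<omega>) * x \<omega>) \<le> norm (x \<omega>)"
      using mult_right_mono[OF weight_le_1[of \<omega>], of "norm (x \<omega>)"] weight_nonneg[of \<omega>] by (simp add: norm_mult)
  qed
  then show ?thesis
    by (simp add: bounded_tuple_hom_def mod_hom_direct_sum)
      (simp add: m_map_eq distrib_left sum.distrib sum_distrib_left mult.left_commute)
qed

lemma mass_ratio_pos: "0 < measure (mu D) (base_ivl D) / lam_mass D"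
  using mass_pos lam_mass_pos by simp

lemma S_one_closed: "S_one D \<in> mcarrier (S_mod D)"
  by (simp add: S_one_eq gridded_const)

lemma S_one_norm: "mnorm (S_mod D) (S_one D) = lam_mass D"
  by (simp add: S_one_eq S_norm gridded_const l1_one)

lemma S_juxt_one: "S_juxt D (\<lambda>_. S_one D) = S_one D"
  by (simp add: S_one_eq S_juxt_const)

lemma S_N_obj: "N_obj D (S_obj D)"
  unfolding S_obj_def using S_one_closed S_one_norm S_juxt_one mass_ratio_pos expo_pos
  by (intro N_objI[OF S_normed_left_module S_juxt_bounded]) simp_all

lemma S_hat_N_obj: "N_obj D (S_hat_obj D)"
  unfolding S_hat_obj_def
  using S_one_closed S_one_norm S_juxt_one mass_ratio_pos expo_pos S.tuple_ext_cembed[OF S_juxt_bounded, of "\<lambda>_. S_one D"]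
  by (intro N_objI[OF S.completion_normed_left_module S.completion_bounded_tuple_hom[OF S_juxt_bounded]])
    (simp_all add: S.mnorm_cembed)

lemma k_N_obj: "N_obj D (k_obj D u)"
  unfolding k_obj_def
proof (rule N_objI[OF k_normed_left_module m_map_bounded])
  show "m_map D u (\<lambda>_. of_real (lam_mass D)) = of_real (lam_mass D)"
    using weight_sum by (simp add: m_map_eq flip: sum_distrib_right)
qed (use mass_ratio_pos expo_pos lam_mass_pos in simp_all)

lemma S_hat_A_obj: "A_obj D (S_hat_obj D)"
  using S_hat_N_obj S.completion_banach by (simp add: A_obj_def S_hat_obj_def)

lemma k_A_obj: "A_obj D (k_obj D u)"
  using k_N_obj k_banach by (simp add: A_obj_def k_obj_def)

lemma power_sum_carrier: "x \<in> mcarrier (power_sum D N) \<longleftrightarrow> (\<forall>\<omega>. x \<omega> \<in> mcarrier N)"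
  by (simp add: power_sum_def)

lemma S_incl_apply: "F \<in> mcarrier (S_mod D) \<Longrightarrow> S_incl D F = cembed (S_mod D) F"
  by (simp add: S_incl_def)

lemma S_incl_Hom: "S_incl D \<in> Hom_N D (S_obj D) (S_hat_obj D)"
proof -
  have hom: "mod_hom (S_mod D) (mcompletion (S_mod D)) (S_incl D)"
    using S.cembed_hom S.add_closed S.act_closed by (simp add: mod_hom_def S_incl_apply)
  have "mnorm (mcompletion (S_mod D)) (S_incl D F) \<le> mnorm (S_mod D) F" if "F \<in> mcarrier (S_mod D)" for F
    using that by (simp add: S_incl_apply S.mnorm_cembed)
  then have cont: "mcontinuous (S_mod D) (mcompletion (S_mod D)) (S_incl D)"
    by (rule two_modules.contraction_mcontinuous[OF two_modules.intro[OF S_normed_left_module S.completion_normed_left_module] hom])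
  have "S_incl D (S_juxt D x) = tuple_ext (S_mod D) (S_juxt D) (\<lambda>\<omega>. S_incl D (x \<omega>))"
    if "\<forall>\<omega>. x \<omega> \<in> mcarrier (S_mod D)" for x
  proof -
    have "S_juxt D x \<in> mcarrier (S_mod D)"
      using S_juxt_bounded that unfolding bounded_tuple_hom_def mod_hom_direct_sum by blast
    then show ?thesis
      using that S.tuple_ext_cembed[OF S_juxt_bounded, of x] by (simp add: S_incl_apply)
  qed
  moreover have "S_incl D (S_one D) = cembed (S_mod D) (S_one D)"
    by (simp add: S_incl_apply S_one_closed)
  moreover have "S_incl D \<in> cont_homs (S_mod D) (mcompletion (S_mod D))"
    using hom cont by (simp add: cont_homs_def S_incl_def)
  ultimately show ?thesis
    using S_N_obj S_hat_N_obj by (simp add: Hom_N_def S_obj_def S_hat_obj_def power_sum_carrier)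
qed

lemma steps_dense:
  assumes X: "X \<in> mcarrier (mcompletion (S_mod D))" and e: "0 < e"
  shows "\<exists>u c. mdist (mcompletion (S_mod D)) X (cembed (S_mod D) (ae_class D (step_fun D u c))) < e"
proof -
  let ?d = "mdist (mcompletion (S_mod D))"
  obtain F where F: "F \<in> mcarrier (S_mod D)" "?d (cembed (S_mod D) F) X < e / 2"
    using S.cembed_dense[OF X, of "e / 2"] e by auto
  obtain u G where G: "G \<in> mcarrier (E_mod D u)" "mdist (S_mod D) F G < e / 2"
    using exhausts F(1) e unfolding E_exhausts_def by (metis half_gt_zero)
  obtain c where c: "G = ae_class D (step_fun D u c)" using G(1) by (auto simp: E_mod_def)
  then have GS: "G \<in> mcarrier (S_mod D)" by (simp add: gridded_step)
  have "?d X (cembed (S_mod D) G) \<le> ?d (cembed (S_mod D) F) X + ?d (cembed (S_mod D) F) (cembed (S_mod D) G)"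
    using Sh.mdist_triangle[of X "cembed (S_mod D) F" "cembed (S_mod D) G"]
      Sh.mdist_commute[of X "cembed (S_mod D) F"] X F(1) GS by simp
  then have "?d X (cembed (S_mod D) G) < e" using F G GS by (simp add: S.mdist_cembed)
  then show ?thesis unfolding c by blast
qed

text \<open>Step functions are dense in the completion, so they determine continuous homomorphisms.\<close>

lemma cont_homs_eq:
  assumes g: "g \<in> cont_homs (mcompletion (S_mod D)) (k_mod D)"
    and h: "h \<in> cont_homs (mcompletion (S_mod D)) (k_mod D)"
    and eq: "\<And>u c. g (cembed (S_mod D) (ae_class D (step_fun D u c))) = h (cembed (S_mod D) (ae_class D (step_fun D u c)))"
  shows "g = h"
proof (rule extensionalityI[of _ "mcarrier (mcompletion (S_mod D))"])
  let ?B = "{cembed (S_mod D) (ae_class D (step_fun D u c)) | u c. True}"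
  fix X assume X: "X \<in> mcarrier (mcompletion (S_mod D))"
  show "g X = h X"
  proof (rule Shk.mcontinuous_eq_on_dense[where B = ?B])
    show "mcontinuous (mcompletion (S_mod D)) (k_mod D) g" "mcontinuous (mcompletion (S_mod D)) (k_mod D) h"
      using g h by (simp_all add: cont_homs_def)
    show "?B \<subseteq> mcarrier (mcompletion (S_mod D))" by (auto simp: gridded_step)
    show "\<exists>y\<in>?B. mdist (mcompletion (S_mod D)) X y < e" if "0 < e" for e
      using steps_dense[OF X that] by blast
  qed (use X eq in auto)
qed (use g h in \<open>simp_all add: cont_homs_def\<close>)

text \<open>Inverse reading of \<open>juxt_step\<close>: every step function of the next level is a juxtaposition.\<close>

lemma step_Suc:
  "step_fun D (Suc u) c = juxt D (\<lambda>\<omega>. step_fun D u (\<lambda>v. c (\<lambda>i. v i + (if \<omega> i then 2 ^ u else 0))))"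
proof -
  have "(\<lambda>i. v i mod 2 ^ u + (if 2 ^ u \<le> v i then 2 ^ u else 0)) = v" if "v \<in> indices (Suc u)" for v
  proof
    fix i
    have "v i < 2 ^ u + 2 ^ u" using that by (simp add: indices_def mult_2)
    then show "v i mod 2 ^ u + (if 2 ^ u \<le> v i then 2 ^ u else 0) = v i"
      by (cases "2 ^ u \<le> v i") (simp_all add: le_mod_geq)
  qed
  then have "step_fun D (Suc u) c = step_fun D (Suc u) (\<lambda>v. c (\<lambda>i. v i mod 2 ^ u + (if 2 ^ u \<le> v i then 2 ^ u else 0)))"
    unfolding step_fun_boxsum boxsum_def by (intro ext sum.cong) simp_all
  then show ?thesis by (simp only: juxt_step)
qed

text \<open>At level \<open>0\<close> step functions are multiples of the constant function \<open>1\<close>, whose value is prescribed; at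
  level \<open>u + 1\<close> they are juxtapositions of step functions of level \<open>u\<close>. This forces the values of \<open>h\<close>.\<close>

lemma Hom_A_on_steps:
  assumes h: "h \<in> Hom_A D (S_hat_obj D) (k_obj D u0)"
  shows "h (cembed (S_mod D) (ae_class D (step_fun D u c))) = integ (step_fun D u c)"
proof (induction u arbitrary: c)
  have hom: "mod_hom (mcompletion (S_mod D)) (k_mod D) h"
    and one: "h (cembed (S_mod D) (S_one D)) = of_real (lam_mass D)"
    and comm: "\<And>X. \<forall>\<omega>. X \<omega> \<in> mcarrier (mcompletion (S_mod D)) \<Longrightarrow>
      h (tuple_ext (S_mod D) (S_juxt D) X) = m_map D u0 (\<lambda>\<omega>. h (X \<omega>))"
    using h by (simp_all add: Hom_A_def Hom_N_def S_hat_obj_def k_obj_def power_sum_carrier cont_homs_def)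
  {
    case 0
    let ?c = "c (\<lambda>_. 0)"
    have "ae_class D (step_fun D 0 c) = mact (S_mod D) (scl D ?c 1) (S_one D)"
      unfolding S_one_eq S_act by (rule ae_class_cong) (simp add: step_0 tau_scl)
    then have "cembed (S_mod D) (ae_class D (step_fun D 0 c)) =
        mact (mcompletion (S_mod D)) (scl D ?c 1) (cembed (S_mod D) (S_one D))"
      using S.cembed_hom S_one_closed by (simp add: mod_hom_def)
    then have "h (cembed (S_mod D) (ae_class D (step_fun D 0 c))) = ?c * of_real (lam_mass D)"
      using hom S_one_closed one by (simp add: mod_hom_def tau_scl)
    also have "\<dots> = integ (\<lambda>_. ?c)" by (simp add: integ_const)
    also have "\<dots> = integ (step_fun D 0 c)" by (rule integ_cong) (simp add: step_0)
    finally show ?case .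
  next
    case (Suc u)
    let ?f = "\<lambda>\<omega>. step_fun D u (\<lambda>v. c (\<lambda>i. v i + (if \<omega> i then 2 ^ u else 0)))"
    have "cembed (S_mod D) (ae_class D (step_fun D (Suc u) c)) =
        tuple_ext (S_mod D) (S_juxt D) (\<lambda>\<omega>. cembed (S_mod D) (ae_class D (?f \<omega>)))"
      using S.tuple_ext_cembed[OF S_juxt_bounded, of "\<lambda>\<omega>. ae_class D (?f \<omega>)"]
      by (simp add: step_Suc S_juxt_class gridded_step)
    then have "h (cembed (S_mod D) (ae_class D (step_fun D (Suc u) c))) =
        m_map D u0 (\<lambda>\<omega>. h (cembed (S_mod D) (ae_class D (?f \<omega>))))"
      using comm[of "\<lambda>\<omega>. cembed (S_mod D) (ae_class D (?f \<omega>))"] by (simp add: gridded_step)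
    also have "\<dots> = integ (step_fun D (Suc u) c)"
      unfolding Suc.IH m_map_eq step_Suc integ_juxt[OF gridded_step] ..
    finally show ?case .
  }
qed

text \<open>Existence is the continuous extension of the integral, which inherits compatibility with
  juxtaposition in the limit. Uniqueness combines the values on step functions with their density.\<close>

lemma ex_unique_integral:
  obtains That where "Hom_A D (S_hat_obj D) (k_obj D u) = {That}"
    "\<And>F. F \<in> mcarrier (S_mod D) \<Longrightarrow> That (cembed (S_mod D) F) = S_integ F"
    "\<And>X. X \<in> mcarrier (mcompletion (S_mod D)) \<Longrightarrow>
        That (S_hat_abs D X) = of_real (mnorm (mcompletion (S_mod D)) X) \<and>
        norm (That X) \<le> mnorm (mcompletion (S_mod D)) X"
proof -
  obtain That where extl: "That \<in> extensional (mcarrier (mcompletion (S_mod D)))"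
    and hom: "mod_hom (mcompletion (S_mod D)) (k_mod D) That"
    and bd: "\<And>X. X \<in> mcarrier (mcompletion (S_mod D)) \<Longrightarrow> norm (That X) \<le> mnorm (mcompletion (S_mod D)) X"
    and lim0: "\<And>x. mCauchy (S_mod D) x \<Longrightarrow> (\<lambda>j. norm (S_integ (x j) - That (cclass (S_mod D) x))) \<longlonglongrightarrow> 0"
    using Sk.extend_contraction[OF S_integ_hom] S_integ_bound k_complete by simp metis
  have lim: "(\<lambda>j. S_integ (x j)) \<longlonglongrightarrow> That (cclass (S_mod D) x)" if "mCauchy (S_mod D) x" for x
    using lim0[OF that] by (simp add: tendsto_norm_zero_iff LIM_zero_iff)
  have cont: "mcontinuous (mcompletion (S_mod D)) (k_mod D) That"
    using bd by (intro Shk.contraction_mcontinuous[OF hom]) simp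
  then have ch: "That \<in> cont_homs (mcompletion (S_mod D)) (k_mod D)"
    using extl hom by (simp add: cont_homs_def)
  have emb: "That (cembed (S_mod D) F) = S_integ F" if "F \<in> mcarrier (S_mod D)" for F
    using lim[of "\<lambda>_. F"] that by (simp add: cembed_def LIMSEQ_const_iff)
  have comm: "That (tuple_ext (S_mod D) (S_juxt D) X) = m_map D u (\<lambda>\<omega>. That (X \<omega>))"
    if XC: "\<forall>\<omega>. X \<omega> \<in> mcarrier (mcompletion (S_mod D))" for X
  proof -
    obtain x where x: "\<And>\<omega>. mCauchy (S_mod D) (x \<omega>)" and X: "\<And>\<omega>. X \<omega> = cclass (S_mod D) (x \<omega>)"
      using XC unfolding S.completion_carrier by metis
    have XX: "X = (\<lambda>\<omega>. cclass (S_mod D) (x \<omega>))" by (intro ext X)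
    have Cau: "mCauchy (S_mod D) (\<lambda>j. S_juxt D (\<lambda>\<omega>. x \<omega> j))"
      by (rule SS.lipschitz_tuple_Cauchy[OF S.bounded_tuple_lipschitz[OF S_juxt_bounded] x])
    have "(\<lambda>j. S_integ (S_juxt D (\<lambda>\<omega>. x \<omega> j))) \<longlonglongrightarrow> That (tuple_ext (S_mod D) (S_juxt D) X)"
      unfolding XX S.tuple_ext_cclass[OF S_juxt_bounded x] by (rule lim[OF Cau])
    moreover have "S_integ (S_juxt D (\<lambda>\<omega>. x \<omega> j)) = (\<Sum>\<omega>\<in>UNIV. of_real (weight \<omega>) * S_integ (x \<omega> j))" for j
      using S_integ_juxt[of "\<lambda>\<omega>. x \<omega> j" u] x by (simp add: m_map_eq)
    moreover have "(\<lambda>j. \<Sum>\<omega>\<in>UNIV. of_real (weight \<omega>) * S_integ (x \<omega> j)) \<longlonglongrightarrow> m_map D u (\<lambda>\<omega>. That (X \<omega>))"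
      unfolding m_map_eq X by (intro tendsto_intros lim x)
    ultimately show ?thesis using LIMSEQ_unique by simp
  qed
  have That: "That \<in> Hom_A D (S_hat_obj D) (k_obj D u)"
    unfolding Hom_A_def Hom_N_def S_hat_obj_def k_obj_def
    using ch comm S_hat_A_obj k_A_obj S_hat_N_obj k_N_obj emb[OF S_one_closed] S_integ_one
    by (simp add: power_sum_carrier S_hat_obj_def k_obj_def)
  have "h = That" if h: "h \<in> Hom_A D (S_hat_obj D) (k_obj D u)" for h
  proof (rule cont_homs_eq[OF _ ch])
    show "h \<in> cont_homs (mcompletion (S_mod D)) (k_mod D)"
      using h by (simp add: Hom_A_def Hom_N_def S_hat_obj_def k_obj_def)
  qed (simp only: Hom_A_on_steps[OF h] Hom_A_on_steps[OF That])
  then have "Hom_A D (S_hat_obj D) (k_obj D u) = {That}" using That by blast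
  moreover have "That (S_hat_abs D X) = of_real (mnorm (mcompletion (S_mod D)) X)"
    if "X \<in> mcarrier (mcompletion (S_mod D))" for X
  proof -
    obtain x where x: "mCauchy (S_mod D) x" "X = cclass (S_mod D) x" using \<open>X \<in> _\<close> by (rule S.completion_carrierE)
    have "S_hat_abs D X = cclass (S_mod D) (\<lambda>j. S_abs D (x j))"
      unfolding S_hat_abs_def x(2) by (rule SS.lipschitz_tuple_image_single(2)[OF S_abs_lipschitz x(1)])
    then have "(\<lambda>j. S_integ (S_abs D (x j))) \<longlonglongrightarrow> That (S_hat_abs D X)"
      using lim[OF SS.lipschitz_tuple_image_single(1)[OF S_abs_lipschitz x(1)]] by simp
    moreover have "S_integ (S_abs D (x j)) = of_real (mnorm (S_mod D) (x j))" for j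
      using S_integ_abs x(1) by simp
    moreover have "(\<lambda>j. of_real (mnorm (S_mod D) (x j)) :: 'k) \<longlonglongrightarrow> of_real (mnorm (mcompletion (S_mod D)) X)"
      unfolding x(2) by (intro tendsto_of_real S.completion_norm x(1))
    ultimately show ?thesis using LIMSEQ_unique by simp
  qed
  ultimately show thesis using that[of That] emb bd by blast
qed

end

theorem theorem1p3:
  fixes D :: "('k::real_normed_field, 'l::ring_1, 'n::finite) integration_data"
    and u :: nat
  assumes "algebra_data D"
    and "interval_data D"
    and "order_extends_real D"
    and "measure_data D"
    and "1 \<le> expo D"
    and "0 < measure (mu D) (base_ivl D)"
    and "self_similar D"
    and "E_exhausts D"
    and "1 < expo D \<Longrightarrow> norm_well_defined D"
  shows "\<exists>That.
    Hom_A D (S_hat_obj D) (k_obj D u) = {That} \<and>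
    S_incl D \<in> Hom_N D (S_obj D) (S_hat_obj D) \<and>
    (\<exists>!T. T \<in> Hom_N D (S_obj D) (k_obj D u) \<and> T = compose (mcarrier (S_mod D)) That (S_incl D)) \<and>
    (expo D = 1 \<longrightarrow>
       is_lim_T D That \<and>
       That (cembed (S_mod D) (S_one D)) = of_real (lam_mass D) \<and>
       mod_hom (mcompletion (S_mod D)) (k_mod D) That \<and>
       (\<forall>f\<in>mcarrier (mcompletion (S_mod D)).
          That (S_hat_abs D f) \<in> \<real> \<and> leq D (of_real (norm (That f))) (That (S_hat_abs D f))))"
proof -
  interpret integration D by unfold_locales (rule assms; assumption?)+
  obtain That where uniq: "Hom_A D (S_hat_obj D) (k_obj D u) = {That}"
    and emb: "\<And>F. F \<in> mcarrier (S_mod D) \<Longrightarrow> That (cembed (S_mod D) F) = S_integ F"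
    and abs: "\<And>X. X \<in> mcarrier (mcompletion (S_mod D)) \<Longrightarrow>
        That (S_hat_abs D X) = of_real (mnorm (mcompletion (S_mod D)) X) \<and>
        norm (That X) \<le> mnorm (mcompletion (S_mod D)) X"
    using ex_unique_integral by metis
  let ?T = "compose (mcarrier (S_mod D)) That (S_incl D)"
  have That: "That \<in> Hom_N D (S_hat_obj D) (k_obj D u)" using uniq by (auto simp: Hom_A_def)
  then have ch: "That \<in> cont_homs (mcompletion (S_mod D)) (k_mod D)"
    by (simp add: Hom_N_def S_hat_obj_def k_obj_def)
  then have hom: "mod_hom (mcompletion (S_mod D)) (k_mod D) That" by (simp add: cont_homs_def)
  have T: "?T F = S_integ F" if "F \<in> mcarrier (S_mod D)" for F
    using that emb by (simp add: compose_eq S_incl_apply)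
  have Thom: "mod_hom (S_mod D) (k_mod D) ?T"
    using S_integ_hom S.add_closed S.act_closed by (simp add: mod_hom_def T)
  have "?T \<in> Hom_N D (S_obj D) (k_obj D u)"
  proof -
    have "mcontinuous (S_mod D) (k_mod D) ?T"
      using S_integ_bound by (intro Sk.contraction_mcontinuous[OF Thom]) (simp add: T)
    moreover have "?T (S_juxt D x) = m_map D u (\<lambda>\<omega>. ?T (x \<omega>))" if "\<forall>\<omega>. x \<omega> \<in> mcarrier (S_mod D)" for x
    proof -
      have "S_juxt D x \<in> mcarrier (S_mod D)"
        using S_juxt_bounded that unfolding bounded_tuple_hom_def mod_hom_direct_sum by blast
      then show ?thesis using that S_integ_juxt[of x u] by (simp add: T)
    qed
    moreover have "?T (S_one D) = of_real (lam_mass D)" using S_one_closed S_integ_one by (simp add: T)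
    moreover have "?T \<in> extensional (mcarrier (S_mod D))" by (simp add: compose_def)
    ultimately show ?thesis
      using Thom S_N_obj k_N_obj by (simp add: Hom_N_def S_obj_def k_obj_def cont_homs_def power_sum_carrier)
  qed
  moreover have "is_lim_T D That"
  proof -
    have E: "(\<forall>F\<in>mcarrier (E_mod D u). g (S_incl D F) = T_level D u F) \<longleftrightarrow>
        (\<forall>c. g (cembed (S_mod D) (ae_class D (step_fun D u c))) = integ (step_fun D u c))" for g u
    proof -
      have "mcarrier (E_mod D u) = {ae_class D (step_fun D u c) | c. True}"
        by (auto simp: E_mod_def gridded_step)
      then show ?thesis by (auto simp: S_incl_apply T_level_step gridded_step)
    qed
    have "That (cembed (S_mod D) (ae_class D (step_fun D u c))) = integ (step_fun D u c)" for u c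
      by (simp add: emb gridded_step S_integ_class)
    note lim = this
    have "g = That" if "g \<in> cont_homs (mcompletion (S_mod D)) (k_mod D)"
      "\<forall>u c. g (cembed (S_mod D) (ae_class D (step_fun D u c))) = integ (step_fun D u c)" for g
      by (rule cont_homs_eq[OF that(1) ch]) (simp only: lim that(2))
    then show ?thesis
      unfolding is_lim_T_def E using ch lim by blast
  qed
  \<comment> \<open>The value at \<open>|f|\<close> is the norm of \<open>f\<close>, a real number, so the order of the reals applies.\<close>
  moreover have "leq D (of_real x) (of_real y) \<longleftrightarrow> x \<le> y" for x y
    using order_extends by (simp add: order_extends_real_def)
  then have "\<forall>f\<in>mcarrier (mcompletion (S_mod D)).
      That (S_hat_abs D f) \<in> \<real> \<and> leq D (of_real (norm (That f))) (That (S_hat_abs D f))"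
    using abs by simp
  ultimately show ?thesis
    using uniq S_incl_Hom emb[OF S_one_closed] S_integ_one hom by (intro exI[of _ That]) auto
qed

end
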